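(* Let $L$ be a regular Lagrangian on a Lie algebroid $E$. (a) If $X$ is an exact Cartan symmetry of $L$ and $f\in C^\infty(E)$ is a function with $\mathcal{L}_X\theta_L=d^Ef$, then $f-\theta_L(X)$ is a conservation law for $L$. (b) Conversely, if $f\in C^\infty(E)$ is a conservation law for $L$, then the unique solution $X\in\Gamma(\mathcal{T}E\setminus\{0\})$ of the equation $i_X\omega_L=-d^Ef$ is an exact Cartan symmetry of $L$.
   Context: Lie algebroid: $\pi:E\to M$ is a vector bundle of rank $m$ over a smooth manifold $M$ of dimension $n$, with a Lie bracket $[\cdot,\cdot]_E$ on $\Gamma(E)$ and a bundle map (anchor) $\sigma:E\to TM$ inducing a Lie algebra homomorphism $\Gamma(E)\to\mathfrak{X}(M)$ with $[s_1,fs_2]_E=f[s_1,s_2]_E+(\sigma(s_1)f)s_2$. In local coordinates $x^i$ and a local basis $\{s_\alpha\}$ of sections (with induced coordinates $(x^i,y^\alpha)$ on $E$), $\sigma(s_\alpha)=\sigma_\alpha^i\,\partial/\partial x^i$, $[s_\alpha,s_\beta]_E=L_{\alpha\beta}^\gamma s_\gamma$; repeated indices are summed. The prolongation $\mathcal{T}E\to E$ has fibre $\mathcal{T}_wE=\{(u,v)\in E_{\pi(w)}\times T_wE:\sigma(u)=T_w\pi(v)\}$ at $w\in E$. It is a Lie algebroid over $E$ with anchor $\sigma^1(u,v)=v$, local basis $\mathcal{X}_\alpha(w)=(s_\alpha(\pi(w)),\sigma_\alpha^i\partial/\partial x^i|_w)$, $\mathcal{V}_\alpha(w)=(0,\partial/\partial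 y^\alpha|_w)$ with dual basis $\{\mathcal{X}^\alpha,\mathcal{V}^\alpha\}$, and bracket determined by $[\mathcal{X}_\alpha,\mathcal{X}_\beta]_{\mathcal{T}E}=L_{\alpha\beta}^\gamma\mathcal{X}_\gamma$, $[\mathcal{X}_\alpha,\mathcal{V}_\beta]_{\mathcal{T}E}=0$, $[\mathcal{V}_\alpha,\mathcal{V}_\beta]_{\mathcal{T}E}=0$. $\Gamma(\mathcal{T}E\setminus\{0\})$ denotes the sections of $\mathcal{T}E$ over $E\setminus\{0\}$ ($E$ without zero section). $\mathbb{C}=y^\alpha\mathcal{V}_\alpha$ is the Euler section. $d^E$ denotes the exterior derivative of the Lie algebroid $\mathcal{T}E$: $d^Ef(X)=\sigma^1(X)f$, $d^E\theta(X,Y)=\sigma^1(X)\theta(Y)-\sigma^1(Y)\theta(X)-\theta([X,Y]_{\mathcal{T}E})$, and so on in higher degree; $\mathcal{L}_X=i_X\circ d^E+d^E\circ i_X$ on forms; $X(f)=\sigma^1(X)f$. A smooth $L:E\to\mathbb{R}$ is a regular Lagrangian if the matrix $g_{\alpha\beta}=\partial^2L/\partial y^\alpha\partial y^\beta$ has rank $m$ everywhere. $\theta_L=\frac{\partial L}{\partial y^\alpha}\mathcal{X}^\alpha$ is the Cartan 1-section, $\omega_L=d^E\theta_L$ the Cartan 2-section (a symplectic, i.e. closed nondegenerate, section), $E_L=\mathbb{C}(L)-L$ the energy, and the canonical semispray $\mathcal{S}$ is the unique section of $\mathcal{T}E$ with $i_{\mathcal{S}}\omega_L=-d^EE_L$.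 A section $X\in\Gamma(\mathcal{T}E\setminus\{0\})$ is a Cartan symmetry of $L$ if $\mathcal{L}_X\omega_L=0$ and $\mathcal{L}_XE_L=0$; it is an exact Cartan symmetry if moreover $\mathcal{L}_X\theta_L$ is exact, i.e. $\mathcal{L}_X\theta_L=d^Ef$ for some function $f$. A function $f$ is a conservation law (constant of motion) for $L$ if $\mathcal{S}(f)=0$. *)

theory Defs
  imports "HOL-Analysis.Analysis"
begin

section \<open>Smooth maps between open subsets of normed spaces\<close>

text \<open>Continuous differentiability of order \<open>k\<close>, via iterated directional derivatives. This is
  meant for open \<open>S\<close> in a finite-dimensional space, where it is the usual notion.\<close>

primrec Ck_on :: "nat \<Rightarrow> 'a::real_normed_vector set \<Rightarrow> ('a \<Rightarrow> 'b::real_normed_vector) \<Rightarrow> bool" where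
  "Ck_on 0 S f \<longleftrightarrow> continuous_on S f"
| "Ck_on (Suc k) S f \<longleftrightarrow>
     (\<forall>x\<in>S. f differentiable (at x)) \<and> (\<forall>v. Ck_on k S (\<lambda>x. frechet_derivative f (at x) v))"

definition smooth_on :: "'a::real_normed_vector set \<Rightarrow> ('a \<Rightarrow> 'b::real_normed_vector) \<Rightarrow> bool" where
  "smooth_on S f \<longleftrightarrow> (\<forall>k. Ck_on k S f)"

section \<open>Smooth manifolds\<close>

text \<open>A chart is a pair of its domain and its coordinate map. The points of a manifold are all the
  points of the type \<open>'a\<close>. The model space \<open>'v\<close> is a finite-dimensional inner product space;
  \<open>euclidean_space\<close> is avoided because it excludes dimension \<open>0\<close>, and so would exclude
  Lie algebras, the Lie algebroids over a point.\<close>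

type_synonym ('a, 'v) chart = "'a set \<times> ('a \<Rightarrow> 'v)"

abbreviation chart_inv :: "('a, 'v) chart \<Rightarrow> 'v \<Rightarrow> 'a" where
  "chart_inv c \<equiv> inv_into (fst c) (snd c)"

definition smooth_atlas ::
  "('a::{t2_space,second_countable_topology}, 'v::real_inner) chart set \<Rightarrow> bool" where
  "smooth_atlas A \<longleftrightarrow>
     (\<exists>B. finite B \<and> span B = (UNIV :: 'v set)) \<and>
     (\<Union>c\<in>A. fst c) = UNIV \<and>
     (\<forall>c\<in>A. open (fst c) \<and> open (snd c ` fst c) \<and>
        homeomorphism (fst c) (snd c ` fst c) (snd c) (chart_inv c)) \<and>
     (\<forall>c\<in>A. \<forall>c'\<in>A. smooth_on (snd c ` (fst c \<inter> fst c')) (snd c' \<circ> chart_inv c))"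

definition charts_at :: "('a, 'v) chart set \<Rightarrow> 'a \<Rightarrow> ('a, 'v) chart set" where
  "charts_at A p = {c \<in> A. p \<in> fst c}"

definition chart_at :: "('a, 'v) chart set \<Rightarrow> 'a \<Rightarrow> ('a, 'v) chart" where
  "chart_at A p = (SOME c. c \<in> charts_at A p)"

definition mfd_smooth_on ::
  "('a, 'v::real_normed_vector) chart set \<Rightarrow> 'a set \<Rightarrow> ('a \<Rightarrow> 'b::real_normed_vector) \<Rightarrow> bool" where
  "mfd_smooth_on A W f \<longleftrightarrow> (\<forall>c\<in>A. smooth_on (snd c ` (fst c \<inter> W)) (f \<circ> chart_inv c))"

text \<open>A tangent vector at \<open>p\<close> is the family of its coordinate representations in the charts around
  \<open>p\<close>, which transform into each other by the Jacobians of the coordinate changes.\<close>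

type_synonym ('a, 'v) tvec = "('a, 'v) chart \<Rightarrow> 'v"

definition coord_change_deriv ::
  "('a, 'v::real_normed_vector) chart \<Rightarrow> ('a, 'v) chart \<Rightarrow> 'a \<Rightarrow> 'v \<Rightarrow> 'v" where
  "coord_change_deriv c c' p \<xi> = frechet_derivative (snd c' \<circ> chart_inv c) (at (snd c p)) \<xi>"

definition tangent_space ::
  "('a, 'v::real_normed_vector) chart set \<Rightarrow> 'a \<Rightarrow> ('a, 'v) tvec set" where
  "tangent_space A p =
     {v. (\<forall>c\<in>charts_at A p. \<forall>c'\<in>charts_at A p. v c' = coord_change_deriv c c' p (v c)) \<and>
         (\<forall>c. c \<notin> charts_at A p \<longrightarrow> v c = 0)}"

definition tvec_of ::
  "('a, 'v::real_normed_vector) chart set \<Rightarrow> ('a, 'v) chart \<Rightarrow> 'a \<Rightarrow> 'v \<Rightarrow> ('a, 'v) tvec" where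
  "tvec_of A c p \<xi> = (\<lambda>c'. if c' \<in> charts_at A p then coord_change_deriv c c' p \<xi> else 0)"

text \<open>The derivative \<open>v(f)\<close> and the tangent map \<open>T\<^sub>pF\<close>; by the chain rule, neither depends on the
  chart chosen around \<open>p\<close>.\<close>

definition tvec_apply ::
  "('a, 'v::real_normed_vector) chart set \<Rightarrow> 'a \<Rightarrow> ('a, 'v) tvec \<Rightarrow> ('a \<Rightarrow> real) \<Rightarrow> real" where
  "tvec_apply A p v f =
     (let c = chart_at A p in frechet_derivative (f \<circ> chart_inv c) (at (snd c p)) (v c))"

definition tangent_map ::
  "('a, 'v::real_normed_vector) chart set \<Rightarrow> ('b, 'w::real_normed_vector) chart set \<Rightarrow>
   ('a \<Rightarrow> 'b) \<Rightarrow> 'a \<Rightarrow> ('a, 'v) tvec \<Rightarrow> ('b, 'w) tvec" where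
  "tangent_map A B F p v =
     (let c = chart_at A p in
      (\<lambda>c'. if c' \<in> charts_at B (F p)
            then frechet_derivative (snd c' \<circ> F \<circ> chart_inv c) (at (snd c p)) (v c) else 0))"

section \<open>Vector bundles\<close>

text \<open>A system of local coordinates \<open>(x\<^sup>i, y\<^sup>\<alpha>)\<close> on \<open>E\<close> adapted to \<open>\<pi>\<close> is given by a
  chart \<open>(U, x)\<close> of \<open>M\<close> and fibre coordinates \<open>y\<close>, which matter on \<open>\<pi>\<^sup>-\<^sup>1(U)\<close> only.
  The rank \<open>m\<close> is \<open>CARD('k)\<close>.\<close>

type_synonym ('p, 'e, 'x, 'k) adapted = "('p, 'x) chart \<times> ('e \<Rightarrow> real^'k)"

record ('p, 'e, 'x, 'k) algebroid =
  proj :: "'e \<Rightarrow> 'p"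
  adapted :: "('p, 'e, 'x, 'k) adapted set"
  anchor :: "'e \<Rightarrow> ('p, 'x) tvec"
  bracket :: "('p \<Rightarrow> 'e) \<Rightarrow> ('p \<Rightarrow> 'e) \<Rightarrow> ('p \<Rightarrow> 'e)"

definition base_atlas :: "('p, 'e, 'x, 'k) algebroid \<Rightarrow> ('p, 'x) chart set" where
  "base_atlas G = fst ` adapted G"

definition total_chart ::
  "('p, 'e, 'x, 'k::finite) algebroid \<Rightarrow> ('p, 'e, 'x, 'k) adapted \<Rightarrow> ('e, 'x \<times> (real^'k)) chart" where
  "total_chart G c = (proj G -` fst (fst c), \<lambda>w. (snd (fst c) (proj G w), snd c w))"

definition total_atlas ::
  "('p, 'e, 'x, 'k::finite) algebroid \<Rightarrow> ('e, 'x \<times> (real^'k)) chart set" where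
  "total_atlas G = total_chart G ` adapted G"

definition vector_bundle ::
  "('p::{t2_space,second_countable_topology}, 'e::{t2_space,second_countable_topology},
    'x::real_inner, 'k::finite) algebroid \<Rightarrow> bool" where
  "vector_bundle G \<longleftrightarrow>
     smooth_atlas (base_atlas G) \<and> smooth_atlas (total_atlas G) \<and>
     (\<forall>c\<in>adapted G. \<forall>p\<in>fst (fst c). bij_betw (snd c) (proj G -` {p}) UNIV) \<and>
     (\<forall>c\<in>adapted G. \<forall>c'\<in>adapted G. \<exists>T :: 'x \<Rightarrow> real^'k^'k.
        smooth_on (snd (fst c) ` (fst (fst c) \<inter> fst (fst c'))) T \<and>
        (\<forall>w. proj G w \<in> fst (fst c) \<inter> fst (fst c') \<longrightarrow>
             snd c' w = T (snd (fst c) (proj G w)) *v snd c w))"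

definition adapted_at :: "('p, 'e, 'x, 'k) algebroid \<Rightarrow> 'p \<Rightarrow> ('p, 'e, 'x, 'k) adapted" where
  "adapted_at G p = (SOME c. c \<in> adapted G \<and> p \<in> fst (fst c))"

text \<open>The element \<open>a\<^sup>\<alpha> s\<^sub>\<alpha>(p)\<close> of \<open>E\<^sub>p\<close>.\<close>

definition fibre_elem ::
  "('p, 'e, 'x, 'k::finite) algebroid \<Rightarrow> ('p, 'e, 'x, 'k) adapted \<Rightarrow> 'p \<Rightarrow> real^'k \<Rightarrow> 'e" where
  "fibre_elem G c p a = (THE e. proj G e = p \<and> snd c e = a)"

definition local_basis ::
  "('p, 'e, 'x, 'k::finite) algebroid \<Rightarrow> ('p, 'e, 'x, 'k) adapted \<Rightarrow> 'k \<Rightarrow> 'p \<Rightarrow> 'e" where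
  "local_basis G c \<alpha> p = fibre_elem G c p (axis \<alpha> 1)"

text \<open>The vector space structure of the fibres: since fibre coordinates change linearly, the
  choice of the adapted coordinates does not matter.\<close>

definition vb_zero :: "('p, 'e, 'x, 'k::finite) algebroid \<Rightarrow> 'p \<Rightarrow> 'e" where
  "vb_zero G p = fibre_elem G (adapted_at G p) p 0"

definition vb_add :: "('p, 'e, 'x, 'k::finite) algebroid \<Rightarrow> 'e \<Rightarrow> 'e \<Rightarrow> 'e" where
  "vb_add G e e' = (let p = proj G e; c = adapted_at G p in fibre_elem G c p (snd c e + snd c e'))"

definition vb_scale :: "('p, 'e, 'x, 'k::finite) algebroid \<Rightarrow> real \<Rightarrow> 'e \<Rightarrow> 'e" where
  "vb_scale G r e = (let p = proj G e; c = adapted_at G p in fibre_elem G c p (r *\<^sub>R snd c e))"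

definition sec_add ::
  "('p, 'e, 'x, 'k::finite) algebroid \<Rightarrow> ('p \<Rightarrow> 'e) \<Rightarrow> ('p \<Rightarrow> 'e) \<Rightarrow> ('p \<Rightarrow> 'e)" where
  "sec_add G s t = (\<lambda>p. vb_add G (s p) (t p))"

definition sec_scale ::
  "('p, 'e, 'x, 'k::finite) algebroid \<Rightarrow> ('p \<Rightarrow> real) \<Rightarrow> ('p \<Rightarrow> 'e) \<Rightarrow> ('p \<Rightarrow> 'e)" where
  "sec_scale G f s = (\<lambda>p. vb_scale G (f p) (s p))"

definition sections ::
  "('p, 'e, 'x::real_normed_vector, 'k::finite) algebroid \<Rightarrow> ('p \<Rightarrow> 'e) set" where
  "sections G = {s. (\<forall>p. proj G (s p) = p) \<and>
     (\<forall>c\<in>adapted G. mfd_smooth_on (base_atlas G) (fst (fst c)) (\<lambda>p. snd c (s p)))}"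

section \<open>Lie algebroids\<close>

definition anchor_apply ::
  "('p, 'e, 'x::real_normed_vector, 'k) algebroid \<Rightarrow> ('p \<Rightarrow> 'e) \<Rightarrow> ('p \<Rightarrow> real) \<Rightarrow> 'p \<Rightarrow> real" where
  "anchor_apply G s f = (\<lambda>p. tvec_apply (base_atlas G) p (anchor G (s p)) f)"

definition anchor_axioms ::
  "('p, 'e, 'x::real_normed_vector, 'k::finite) algebroid \<Rightarrow> bool" where
  "anchor_axioms G \<longleftrightarrow>
     (\<forall>e. anchor G e \<in> tangent_space (base_atlas G) (proj G e)) \<and>
     (\<forall>e e'. proj G e = proj G e' \<longrightarrow>
        anchor G (vb_add G e e') = (\<lambda>c. anchor G e c + anchor G e' c)) \<and>
     (\<forall>r e. anchor G (vb_scale G r e) = (\<lambda>c. r *\<^sub>R anchor G e c)) \<and>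
     (\<forall>c\<in>adapted G. mfd_smooth_on (total_atlas G) (proj G -` fst (fst c)) (\<lambda>e. anchor G e (fst c)))"

definition bracket_axioms ::
  "('p, 'e, 'x::real_normed_vector, 'k::finite) algebroid \<Rightarrow> bool" where
  "bracket_axioms G \<longleftrightarrow>
     (\<forall>s\<in>sections G. \<forall>t\<in>sections G. bracket G s t \<in> sections G) \<and>
     (\<forall>s\<in>sections G. \<forall>s'\<in>sections G. \<forall>t\<in>sections G.
        bracket G (sec_add G s s') t = sec_add G (bracket G s t) (bracket G s' t)) \<and>
     (\<forall>r. \<forall>s\<in>sections G. \<forall>t\<in>sections G.
        bracket G (sec_scale G (\<lambda>_. r) s) t = sec_scale G (\<lambda>_. r) (bracket G s t)) \<and>
     (\<forall>s\<in>sections G. \<forall>t\<in>sections G. bracket G s t = sec_scale G (\<lambda>_. - 1) (bracket G t s)) \<and>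
     (\<forall>s\<in>sections G. \<forall>t\<in>sections G. \<forall>u\<in>sections G.
        sec_add G (bracket G s (bracket G t u))
          (sec_add G (bracket G t (bracket G u s)) (bracket G u (bracket G s t))) = vb_zero G)"

definition lie_algebroid ::
  "('p::{t2_space,second_countable_topology}, 'e::{t2_space,second_countable_topology},
    'x::real_inner, 'k::finite) algebroid \<Rightarrow> bool" where
  "lie_algebroid G \<longleftrightarrow> vector_bundle G \<and> anchor_axioms G \<and> bracket_axioms G \<and>
     (\<forall>s\<in>sections G. \<forall>t\<in>sections G. \<forall>f. mfd_smooth_on (base_atlas G) UNIV f \<longrightarrow>
        anchor_apply G (bracket G s t) f =
          (\<lambda>p. anchor_apply G s (anchor_apply G t f) p - anchor_apply G t (anchor_apply G s f) p)) \<and>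
     (\<forall>s\<in>sections G. \<forall>t\<in>sections G. \<forall>f. mfd_smooth_on (base_atlas G) UNIV f \<longrightarrow>
        bracket G s (sec_scale G f t) =
          sec_add G (sec_scale G f (bracket G s t)) (sec_scale G (anchor_apply G s f) t))"

text \<open>The bracket of sections defined near \<open>p\<close> only, at \<open>p\<close>: by locality of the bracket, it is
  computed by any global sections that agree with the given ones near \<open>p\<close>.\<close>

definition local_bracket ::
  "('p::topological_space, 'e, 'x::real_normed_vector, 'k::finite) algebroid \<Rightarrow>
   ('p \<Rightarrow> 'e) \<Rightarrow> ('p \<Rightarrow> 'e) \<Rightarrow> 'p \<Rightarrow> 'e" where
  "local_bracket G s t p = (THE e. \<exists>s'\<in>sections G. \<exists>t'\<in>sections G.
     (\<forall>\<^sub>F q in nhds p. s' q = s q) \<and> (\<forall>\<^sub>F q in nhds p. t' q = t q) \<and> e = bracket G s' t' p)"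

text \<open>\<open>L\<^sub>\<alpha>\<^sub>\<beta>\<^sup>\<gamma>\<close>\<close>

definition structure_fun ::
  "('p::topological_space, 'e, 'x::real_normed_vector, 'k::finite) algebroid \<Rightarrow>
   ('p, 'e, 'x, 'k) adapted \<Rightarrow> 'k \<Rightarrow> 'k \<Rightarrow> 'k \<Rightarrow> 'p \<Rightarrow> real" where
  "structure_fun G c \<alpha> \<beta> \<gamma> p =
     snd c (local_bracket G (local_basis G c \<alpha>) (local_basis G c \<beta>) p) $ \<gamma>"

section \<open>The prolongation \<open>\<T>E\<close>\<close>

text \<open>An element \<open>(u, v)\<close> of \<open>\<T>\<^sub>wE\<close> is represented without its base point \<open>w\<close>.\<close>

type_synonym ('e, 'x, 'k) prol = "'e \<times> ('e, 'x \<times> (real^'k)) tvec"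
type_synonym ('e, 'x, 'k) psec = "'e \<Rightarrow> ('e, 'x, 'k) prol"

definition prol_fibre ::
  "('p, 'e, 'x::real_normed_vector, 'k::finite) algebroid \<Rightarrow> 'e \<Rightarrow> ('e, 'x, 'k) prol set" where
  "prol_fibre G w = {(u, v). proj G u = proj G w \<and> v \<in> tangent_space (total_atlas G) w \<and>
     anchor G u = tangent_map (total_atlas G) (base_atlas G) (proj G) w v}"

definition basis_X ::
  "('p, 'e, 'x::real_normed_vector, 'k::finite) algebroid \<Rightarrow> ('p, 'e, 'x, 'k) adapted \<Rightarrow> 'k \<Rightarrow>
   ('e, 'x, 'k) psec" where
  "basis_X G c \<alpha> w =
     (local_basis G c \<alpha> (proj G w),
      tvec_of (total_atlas G) (total_chart G c) w (anchor G (local_basis G c \<alpha> (proj G w)) (fst c), 0))"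

definition basis_V ::
  "('p, 'e, 'x::real_normed_vector, 'k::finite) algebroid \<Rightarrow> ('p, 'e, 'x, 'k) adapted \<Rightarrow> 'k \<Rightarrow>
   ('e, 'x, 'k) psec" where
  "basis_V G c \<alpha> w =
     (vb_zero G (proj G w), tvec_of (total_atlas G) (total_chart G c) w (0, axis \<alpha> 1))"

text \<open>The element \<open>a\<^sup>\<alpha> \<X>\<^sub>\<alpha>(w) + b\<^sup>\<alpha> \<V>\<^sub>\<alpha>(w)\<close> and, conversely, the values of the dual basis
  \<open>\<X>\<^sup>\<alpha>\<close>, \<open>\<V>\<^sup>\<alpha>\<close>.\<close>

definition prol_elem ::
  "('p, 'e, 'x::real_normed_vector, 'k::finite) algebroid \<Rightarrow> ('p, 'e, 'x, 'k) adapted \<Rightarrow> 'e \<Rightarrow>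
   real^'k \<Rightarrow> real^'k \<Rightarrow> ('e, 'x, 'k) prol" where
  "prol_elem G c w a b =
     (fibre_elem G c (proj G w) a,
      \<lambda>c'. (\<Sum>\<alpha>\<in>UNIV. a $ \<alpha> *\<^sub>R snd (basis_X G c \<alpha> w) c' + b $ \<alpha> *\<^sub>R snd (basis_V G c \<alpha> w) c'))"

definition dual_X :: "('p, 'e, 'x, 'k::finite) adapted \<Rightarrow> 'k \<Rightarrow> ('e, 'x, 'k) prol \<Rightarrow> real" where
  "dual_X c \<alpha> z = snd c (fst z) $ \<alpha>"

definition dual_V ::
  "('p, 'e, 'x, 'k::finite) algebroid \<Rightarrow> ('p, 'e, 'x, 'k) adapted \<Rightarrow> 'k \<Rightarrow>
   ('e, 'x, 'k) prol \<Rightarrow> real" where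
  "dual_V G c \<alpha> z = snd (snd z (total_chart G c)) $ \<alpha>"

text \<open>Sections over an open set \<open>W\<close>, extensional outside \<open>W\<close>.\<close>

definition prol_sections ::
  "('p, 'e, 'x::real_normed_vector, 'k::finite) algebroid \<Rightarrow> 'e set \<Rightarrow> ('e, 'x, 'k) psec set" where
  "prol_sections G W = {Z \<in> (\<Pi>\<^sub>E w\<in>W. prol_fibre G w). \<forall>c\<in>adapted G. \<forall>\<alpha>.
     mfd_smooth_on (total_atlas G) (W \<inter> proj G -` fst (fst c)) (\<lambda>w. dual_X c \<alpha> (Z w)) \<and>
     mfd_smooth_on (total_atlas G) (W \<inter> proj G -` fst (fst c)) (\<lambda>w. dual_V G c \<alpha> (Z w))}"

text \<open>\<open>Z(f) = \<sigma>\<^sup>1(Z) f\<close>\<close>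

definition prol_apply ::
  "('p, 'e, 'x::real_normed_vector, 'k::finite) algebroid \<Rightarrow> ('e, 'x, 'k) psec \<Rightarrow>
   ('e \<Rightarrow> real) \<Rightarrow> 'e \<Rightarrow> real" where
  "prol_apply G Z f = (\<lambda>w. tvec_apply (total_atlas G) w (snd (Z w)) f)"

text \<open>The bracket of \<open>\<T>E\<close>, in components: this is the extension by the Leibniz rule of
  \<open>[\<X>\<^sub>\<alpha>, \<X>\<^sub>\<beta>] = L\<^sub>\<alpha>\<^sub>\<beta>\<^sup>\<gamma> \<X>\<^sub>\<gamma>\<close>, \<open>[\<X>\<^sub>\<alpha>, \<V>\<^sub>\<beta>] = 0\<close>, \<open>[\<V>\<^sub>\<alpha>, \<V>\<^sub>\<beta>] = 0\<close>. The result does not depend on the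
  adapted coordinates chosen around \<open>w\<close>. It is a local operation; for sections over an open
  set \<open>W\<close>, only its values on \<open>W\<close> are meaningful.\<close>

definition prol_bracket ::
  "('p::topological_space, 'e, 'x::real_normed_vector, 'k::finite) algebroid \<Rightarrow>
   ('e, 'x, 'k) psec \<Rightarrow> ('e, 'x, 'k) psec \<Rightarrow> ('e, 'x, 'k) psec" where
  "prol_bracket G Y Z = (\<lambda>w. let c = adapted_at G (proj G w) in
     prol_elem G c w
       (\<chi> \<gamma>. prol_apply G Y (\<lambda>w'. dual_X c \<gamma> (Z w')) w - prol_apply G Z (\<lambda>w'. dual_X c \<gamma> (Y w')) w +
         (\<Sum>\<alpha>\<in>UNIV. \<Sum>\<beta>\<in>UNIV.
            dual_X c \<alpha> (Y w) * dual_X c \<beta> (Z w) * structure_fun G c \<alpha> \<beta> \<gamma> (proj G w)))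
       (\<chi> \<gamma>. prol_apply G Y (\<lambda>w'. dual_V G c \<gamma> (Z w')) w - prol_apply G Z (\<lambda>w'. dual_V G c \<gamma> (Y w')) w))"

section \<open>Exterior calculus on \<open>\<T>E\<close>\<close>

text \<open>A \<open>k\<close>-form is an operator that takes lists of \<open>k\<close> sections to functions; it vanishes on lists
  of any other length, so that functions are the forms supported on the empty list. Forms on an
  open set \<open>W\<close> are compared on sections over \<open>W\<close> and at points of \<open>W\<close>; all the operators are
  local.\<close>

type_synonym ('e, 'x, 'k) pform = "('e, 'x, 'k) psec list \<Rightarrow> 'e \<Rightarrow> real"

definition fun_form :: "('e \<Rightarrow> real) \<Rightarrow> ('e, 'x, 'k) pform" where
  "fun_form f Zs w = (if Zs = [] then f w else 0)"

definition form_eq_on ::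
  "('p, 'e, 'x::real_normed_vector, 'k::finite) algebroid \<Rightarrow> 'e set \<Rightarrow>
   ('e, 'x, 'k) pform \<Rightarrow> ('e, 'x, 'k) pform \<Rightarrow> bool" where
  "form_eq_on G W \<omega> \<eta> \<longleftrightarrow> (\<forall>Zs. set Zs \<subseteq> prol_sections G W \<longrightarrow> (\<forall>w\<in>W. \<omega> Zs w = \<eta> Zs w))"

definition ext_d ::
  "('p::topological_space, 'e, 'x::real_normed_vector, 'k::finite) algebroid \<Rightarrow>
   ('e, 'x, 'k) pform \<Rightarrow> ('e, 'x, 'k) pform" where
  "ext_d G \<omega> Zs w =
     (\<Sum>i<length Zs. (- 1) ^ i * prol_apply G (Zs ! i) (\<omega> (nths Zs (- {i}))) w) +
     (\<Sum>j<length Zs. \<Sum>i<j.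
        (- 1) ^ (i + j) * \<omega> (prol_bracket G (Zs ! i) (Zs ! j) # nths Zs (- {i, j})) w)"

definition inner_prod ::
  "('e, 'x, 'k) psec \<Rightarrow> ('e, 'x, 'k) pform \<Rightarrow> ('e, 'x, 'k) pform" where
  "inner_prod X \<omega> Zs = \<omega> (X # Zs)"

definition lie_deriv ::
  "('p::topological_space, 'e, 'x::real_normed_vector, 'k::finite) algebroid \<Rightarrow>
   ('e, 'x, 'k) psec \<Rightarrow> ('e, 'x, 'k) pform \<Rightarrow> ('e, 'x, 'k) pform" where
  "lie_deriv G X \<omega> Zs w = inner_prod X (ext_d G \<omega>) Zs w + ext_d G (inner_prod X \<omega>) Zs w"

section \<open>Regular Lagrangians\<close>

text \<open>\<open>\<partial>f/\<partial>y\<^sup>\<alpha>\<close>, as a function on \<open>\<pi>\<^sup>-\<^sup>1(U)\<close>\<close>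

definition partial_y ::
  "('p, 'e, 'x::real_normed_vector, 'k::finite) algebroid \<Rightarrow> ('p, 'e, 'x, 'k) adapted \<Rightarrow> 'k \<Rightarrow>
   ('e \<Rightarrow> real) \<Rightarrow> 'e \<Rightarrow> real" where
  "partial_y G c \<alpha> f w =
     frechet_derivative (f \<circ> chart_inv (total_chart G c)) (at (snd (total_chart G c) w)) (0, axis \<alpha> 1)"

definition fibre_hessian ::
  "('p, 'e, 'x::real_normed_vector, 'k::finite) algebroid \<Rightarrow> ('p, 'e, 'x, 'k) adapted \<Rightarrow>
   ('e \<Rightarrow> real) \<Rightarrow> 'e \<Rightarrow> real^'k^'k" where
  "fibre_hessian G c L w = (\<chi> \<alpha> \<beta>. partial_y G c \<alpha> (partial_y G c \<beta> L) w)"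

definition regular_lagrangian ::
  "('p, 'e, 'x::real_normed_vector, 'k::finite) algebroid \<Rightarrow> ('e \<Rightarrow> real) \<Rightarrow> bool" where
  "regular_lagrangian G L \<longleftrightarrow> mfd_smooth_on (total_atlas G) UNIV L \<and>
     (\<forall>c\<in>adapted G. \<forall>w. proj G w \<in> fst (fst c) \<longrightarrow> rank (fibre_hessian G c L w) = CARD('k))"

definition cartan_1 ::
  "('p, 'e, 'x::real_normed_vector, 'k::finite) algebroid \<Rightarrow> ('e \<Rightarrow> real) \<Rightarrow>
   ('e, 'x, 'k) pform" where
  "cartan_1 G L Zs w = (case Zs of
     [Z] \<Rightarrow> (let c = adapted_at G (proj G w) in \<Sum>\<alpha>\<in>UNIV. partial_y G c \<alpha> L w * dual_X c \<alpha> (Z w))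
   | _ \<Rightarrow> 0)"

definition cartan_2 ::
  "('p::topological_space, 'e, 'x::real_normed_vector, 'k::finite) algebroid \<Rightarrow> ('e \<Rightarrow> real) \<Rightarrow>
   ('e, 'x, 'k) pform" where
  "cartan_2 G L = ext_d G (cartan_1 G L)"

definition euler_section ::
  "('p, 'e, 'x::real_normed_vector, 'k::finite) algebroid \<Rightarrow> ('e, 'x, 'k) psec" where
  "euler_section G w = (let c = adapted_at G (proj G w) in prol_elem G c w 0 (snd c w))"

definition energy ::
  "('p, 'e, 'x::real_normed_vector, 'k::finite) algebroid \<Rightarrow> ('e \<Rightarrow> real) \<Rightarrow> 'e \<Rightarrow> real" where
  "energy G L = (\<lambda>w. prol_apply G (euler_section G) L w - L w)"

text \<open>\<open>X\<close> solves \<open>i\<^sub>X \<omega>\<^sub>L = - d\<^sup>E f\<close> on \<open>W\<close>.\<close>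

definition hamiltonian_on ::
  "('p::topological_space, 'e, 'x::real_normed_vector, 'k::finite) algebroid \<Rightarrow> ('e \<Rightarrow> real) \<Rightarrow>
   'e set \<Rightarrow> ('e \<Rightarrow> real) \<Rightarrow> ('e, 'x, 'k) psec \<Rightarrow> bool" where
  "hamiltonian_on G L W f X \<longleftrightarrow>
     form_eq_on G W (inner_prod X (cartan_2 G L)) (\<lambda>Zs w. - ext_d G (fun_form f) Zs w)"

definition canonical_semispray ::
  "('p::topological_space, 'e, 'x::real_normed_vector, 'k::finite) algebroid \<Rightarrow> ('e \<Rightarrow> real) \<Rightarrow>
   ('e, 'x, 'k) psec" where
  "canonical_semispray G L =
     (THE S. S \<in> prol_sections G UNIV \<and> hamiltonian_on G L UNIV (energy G L) S)"

text \<open>A conservation law defined on an open set \<open>W\<close> of \<open>E\<close>.\<close>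

definition conservation_law_on ::
  "('p::topological_space, 'e, 'x::real_normed_vector, 'k::finite) algebroid \<Rightarrow> ('e \<Rightarrow> real) \<Rightarrow>
   'e set \<Rightarrow> ('e \<Rightarrow> real) \<Rightarrow> bool" where
  "conservation_law_on G L W f \<longleftrightarrow> mfd_smooth_on (total_atlas G) W f \<and>
     (\<forall>w\<in>W. prol_apply G (canonical_semispray G L) f w = 0)"

text \<open>\<open>E \<setminus> {0}\<close>\<close>

definition slit :: "('p, 'e, 'x, 'k::finite) algebroid \<Rightarrow> 'e set" where
  "slit G = {w. w \<noteq> vb_zero G (proj G w)}"

definition cartan_symmetry ::
  "('p::topological_space, 'e, 'x::real_normed_vector, 'k::finite) algebroid \<Rightarrow> ('e \<Rightarrow> real) \<Rightarrow>
   ('e, 'x, 'k) psec \<Rightarrow> bool" where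
  "cartan_symmetry G L X \<longleftrightarrow> X \<in> prol_sections G (slit G) \<and>
     form_eq_on G (slit G) (lie_deriv G X (cartan_2 G L)) (\<lambda>_ _. 0) \<and>
     form_eq_on G (slit G) (lie_deriv G X (fun_form (energy G L))) (\<lambda>_ _. 0)"

definition exact_cartan_symmetry ::
  "('p::topological_space, 'e, 'x::real_normed_vector, 'k::finite) algebroid \<Rightarrow> ('e \<Rightarrow> real) \<Rightarrow>
   ('e, 'x, 'k) psec \<Rightarrow> bool" where
  "exact_cartan_symmetry G L X \<longleftrightarrow> cartan_symmetry G L X \<and>
     (\<exists>f. mfd_smooth_on (total_atlas G) UNIV f \<and>
        form_eq_on G (slit G) (lie_deriv G X (cartan_1 G L)) (ext_d G (fun_form f)))"

end

theory Submission
  imports Defs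
begin

text \<open>The theorem is Cartan calculus on the Lie algebroid \<open>\<T>E\<close>. By Cartan's formula
  \<open>\<L>\<^sub>X \<theta>\<^sub>L = i\<^sub>X \<omega>\<^sub>L + d\<^sup>E(\<theta>\<^sub>L(X))\<close>, the equation \<open>\<L>\<^sub>X \<theta>\<^sub>L = d\<^sup>E f\<close> says that
  \<open>i\<^sub>X \<omega>\<^sub>L = d\<^sup>E(f - \<theta>\<^sub>L(X))\<close>; contracting with the semispray \<open>\<S>\<close>, for which
  \<open>i\<^sub>\<S> \<omega>\<^sub>L = - d\<^sup>E E\<^sub>L\<close>, gives \<open>\<S>(f - \<theta>\<^sub>L(X)) = \<omega>\<^sub>L(X, \<S>) = X(E\<^sub>L) = 0\<close>. Conversely
  \<open>i\<^sub>X \<omega>\<^sub>L = - d\<^sup>E f\<close> yields \<open>\<L>\<^sub>X \<omega>\<^sub>L = i\<^sub>X d\<^sup>E\<omega>\<^sub>L - d\<^sup>E d\<^sup>E f = 0\<close>, then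
  \<open>X(E\<^sub>L) = - \<S>(f) = 0\<close>, and \<open>\<L>\<^sub>X \<theta>\<^sub>L = d\<^sup>E(\<theta>\<^sub>L(X) - f)\<close>. Exactness asks for a potential that is
  smooth on all of \<open>E\<close>, although \<open>X\<close> is only given off the zero section; it exists because the equation
  \<open>i\<^sub>X \<omega>\<^sub>L = - d\<^sup>E f\<close> also has a unique solution on \<open>E\<close>, which restricts to \<open>X\<close>.

  Three facts carry this argument. The first is \<open>d\<^sup>E d\<^sup>E = 0\<close>, on functions (\<open>along_bracket\<close>) and on
  \<open>\<theta>\<^sub>L\<close> (\<open>cartan_2_closed\<close>). Both come from one formula for the bracket of \<open>E\<close> in
  coordinates (\<open>bracket_formula\<close>), which on sections with constant components yields the smoothness,
  the Jacobi identity and the change of coordinates of the structure functions and, since the anchor is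
  a homomorphism, their relation to the anchor. The second is that \<open>\<omega>\<^sub>L\<close> is a nondegenerate bilinear form on each fibre whose linear
  equations have smooth solutions (\<open>hamiltonian_unique_existence\<close>). The third is that forms, being
  operators on globally defined sections, are nevertheless determined fibre by fibre
  (\<open>hamiltonian_on_iff\<close>, \<open>section_through\<close>): this needs cut-off functions on manifolds
  (\<open>cutoff_function\<close>), as does the locality of the bracket (\<open>bracket_local\<close>).

  Smoothness is handled through germs (\<open>smooth_near\<close>, \<open>smooth_at\<close>), and derivatives are
  taken in a single chart or system of adapted coordinates (\<open>chart_deriv\<close>, \<open>base_deriv\<close>,
  \<open>prol_deriv\<close>), where lemmas on coordinate changes make the choice immaterial. The brackets of
  \<open>\<T>E\<close> enter through their value at a point and their \<open>\<X>\<close>-components near it, and it is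
  for these components that coordinate independence is proved (\<open>prol_bracket_fst\<close>).\<close>

section \<open>Smooth germs in normed spaces\<close>

lemma Ck_on_cong:
  assumes "open S" "\<And>x. x \<in> S \<Longrightarrow> f x = g x" "Ck_on k S f"
  shows "Ck_on k S g"
  using assms(2,3)
proof (induction k arbitrary: f g)
  case 0
  then show ?case using continuous_on_cong[of S S f g] by simp
next
  case (Suc k)
  have d: "(g has_derivative frechet_derivative f (at x)) (at x)" if "x \<in> S" for x
    by (rule has_derivative_transform_within_open[of f _ x UNIV S g])
       (use that Suc.prems assms(1) in \<open>auto simp: frechet_derivative_works[symmetric]\<close>)
  then have e: "frechet_derivative g (at x) = frechet_derivative f (at x)" if "x \<in> S" for x
    using frechet_derivative_at[OF d[OF that]] by simp
  have "Ck_on k S (\<lambda>x. frechet_derivative g (at x) v)" for v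
    by (rule Suc.IH[of "\<lambda>x. frechet_derivative f (at x) v"]) (use Suc.prems in \<open>auto simp: e\<close>)
  then show ?case using differentiableI[OF d] by simp
qed

lemma Ck_on_subset: "Ck_on k S f \<Longrightarrow> T \<subseteq> S \<Longrightarrow> Ck_on k T f"
  by (induction k arbitrary: f) (auto intro: continuous_on_subset)

lemma Ck_on_SucD: "Ck_on (Suc k) S f \<Longrightarrow> Ck_on k S f"
proof (induction k arbitrary: f)
  case 0
  then show ?case
    by (simp add: differentiable_imp_continuous_on differentiable_at_imp_differentiable_on)
next
  case (Suc k)
  then show ?case by auto
qed

lemma Ck_on_local:
  assumes "\<And>x. x \<in> S \<Longrightarrow> \<exists>T. open T \<and> x \<in> T \<and> Ck_on k T f"
  shows "Ck_on k S f"
  using assms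
proof (induction k arbitrary: f)
  case 0
  have "isCont f x" if "x \<in> S" for x
    using 0[OF that] by (auto simp: continuous_on_eq_continuous_at)
  then show ?case by (simp add: continuous_at_imp_continuous_on)
next
  case (Suc k)
  have "f differentiable (at x)" if "x \<in> S" for x
    using Suc.prems[OF that] by auto
  moreover have "Ck_on k S (\<lambda>x. frechet_derivative f (at x) v)" for v
    using Suc.prems by (intro Suc.IH) fastforce
  ultimately show ?case by simp
qed

text \<open>Smoothness near a point: being insensitive to the domain, it lets all later arguments be made
  with functions that agree eventually, rather than with open sets.\<close>

definition smooth_near :: "'a::real_normed_vector \<Rightarrow> ('a \<Rightarrow> 'b::real_normed_vector) \<Rightarrow> bool" where
  "smooth_near z f \<longleftrightarrow> (\<exists>S. open S \<and> z \<in> S \<and> smooth_on S f)"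

lemma smooth_on_iff_near: "open S \<Longrightarrow> smooth_on S f \<longleftrightarrow> (\<forall>z\<in>S. smooth_near z f)"
  unfolding smooth_near_def smooth_on_def by (metis Ck_on_local)

lemma smooth_near_eventually: "smooth_near z f \<Longrightarrow> \<forall>\<^sub>F z' in nhds z. smooth_near z' f"
  unfolding smooth_near_def eventually_nhds by blast

lemma smooth_near_cong:
  assumes "smooth_near z f" "\<forall>\<^sub>F z' in nhds z. f z' = g z'"
  shows "smooth_near z g"
proof -
  obtain S T where "open S" "z \<in> S" "smooth_on S f" "open T" "z \<in> T" "\<And>x. x \<in> T \<Longrightarrow> f x = g x"
    using assms unfolding smooth_near_def eventually_nhds by blast
  moreover have "Ck_on k (S \<inter> T) g" for k
    by (rule Ck_on_cong[of "S \<inter> T" f g k])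
       (use calculation Ck_on_subset[of k S f "S \<inter> T"] in \<open>auto simp: smooth_on_def\<close>)
  ultimately show ?thesis
    unfolding smooth_near_def smooth_on_def by (intro exI[of _ "S \<inter> T"]) auto
qed

lemma frechet_derivative_cong:
  assumes "\<forall>\<^sub>F z' in nhds z. f z' = g z'"
  shows "frechet_derivative f (at z) = frechet_derivative g (at z)"
proof -
  obtain S where "open S" "z \<in> S" "\<And>x. x \<in> S \<Longrightarrow> f x = g x"
    using assms unfolding eventually_nhds by blast
  then have "(f has_derivative D) (at z) \<longleftrightarrow> (g has_derivative D) (at z)" for D
    by (auto intro: has_derivative_transform_within_open[of _ D z UNIV S])
  then show ?thesis unfolding frechet_derivative_def by simp
qed

lemma smooth_near_differentiable: "smooth_near z f \<Longrightarrow> f differentiable (at z)"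
  unfolding smooth_near_def smooth_on_def by (metis Ck_on.simps(2))

lemma smooth_near_continuous: "smooth_near z f \<Longrightarrow> isCont f z"
  by (simp add: smooth_near_differentiable differentiable_imp_continuous_within)

lemma smooth_near_has_derivative:
  "smooth_near z f \<Longrightarrow> (f has_derivative frechet_derivative f (at z)) (at z)"
  using smooth_near_differentiable frechet_derivative_works by blast

lemma smooth_near_linear: "smooth_near z f \<Longrightarrow> linear (frechet_derivative f (at z))"
  using smooth_near_differentiable linear_frechet_derivative by blast

lemma smooth_near_directional:
  "smooth_near z f \<Longrightarrow> smooth_near z (\<lambda>z'. frechet_derivative f (at z') v)"
  unfolding smooth_near_def smooth_on_def by (metis Ck_on.simps(2))

subsection \<open>Closure properties\<close>

lemma Ck_on_const: "Ck_on k S (\<lambda>_. c)"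
  by (induction k arbitrary: c) auto

lemma Ck_on_bounded_linear:
  assumes "bounded_linear f" shows "Ck_on k S f"
proof (cases k)
  case 0
  then show ?thesis using assms by (simp add: linear_continuous_on)
next
  case (Suc k')
  have d: "(f has_derivative f) (at x)" for x
    using assms by (simp add: bounded_linear_imp_has_derivative)
  have "frechet_derivative f (at x) = f" for x
    using frechet_derivative_at[OF d] by simp
  then show ?thesis using Suc d by (auto simp: Ck_on_const differentiable_def)
qed

lemma Ck_on_add:
  assumes "open S" "Ck_on k S f" "Ck_on k S g"
  shows "Ck_on k S (\<lambda>x. f x + g x)"
  using assms(2,3)
proof (induction k arbitrary: f g)
  case 0 then show ?case by (simp add: continuous_on_add)
next
  case (Suc k)
  have d: "((\<lambda>x. f x + g x) has_derivative
      (\<lambda>v. frechet_derivative f (at x) v + frechet_derivative g (at x) v)) (at x)" if "x \<in> S" for x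
    using Suc.prems that by (intro has_derivative_add) (auto simp: frechet_derivative_works)
  have e: "frechet_derivative f (at x) v + frechet_derivative g (at x) v =
      frechet_derivative (\<lambda>x. f x + g x) (at x) v" if "x \<in> S" for x v
    unfolding frechet_derivative_at[OF d[OF that], symmetric] ..
  have "Ck_on k S (\<lambda>x. frechet_derivative (\<lambda>x. f x + g x) (at x) v)" for v
    by (rule Ck_on_cong[OF assms(1) e], assumption, rule Suc.IH) (use Suc.prems in auto)
  then show ?case using differentiableI[OF d] by simp
qed

lemma Ck_on_sum:
  assumes "open S" "\<And>i. i \<in> I \<Longrightarrow> Ck_on k S (f i)"
  shows "Ck_on k S (\<lambda>x. \<Sum>i\<in>I. f i x)"
  using assms(2)
  by (induction I rule: infinite_finite_induct) (simp_all add: Ck_on_const Ck_on_add[OF assms(1)])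

lemma Ck_on_bilinear:
  assumes "bounded_bilinear pr" "open S" "Ck_on k S f" "Ck_on k S g"
  shows "Ck_on k S (\<lambda>x. pr (f x) (g x))"
  using assms(3,4)
proof (induction k arbitrary: f g)
  case 0 then show ?case by (simp add: bounded_bilinear.continuous_on[OF assms(1)])
next
  case (Suc k)
  have d: "((\<lambda>x. pr (f x) (g x)) has_derivative
      (\<lambda>v. pr (f x) (frechet_derivative g (at x) v) + pr (frechet_derivative f (at x) v) (g x))) (at x)"
    if "x \<in> S" for x
    using Suc.prems that
    by (intro bounded_bilinear.FDERIV[OF assms(1)]) (auto simp: frechet_derivative_works)
  have e: "pr (f x) (frechet_derivative g (at x) v) + pr (frechet_derivative f (at x) v) (g x) =
      frechet_derivative (\<lambda>x. pr (f x) (g x)) (at x) v" if "x \<in> S" for x v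
    unfolding frechet_derivative_at[OF d[OF that], symmetric] ..
  have "Ck_on k S (\<lambda>x. frechet_derivative (\<lambda>x. pr (f x) (g x)) (at x) v)" for v
    by (rule Ck_on_cong[OF assms(2) e], assumption, rule Ck_on_add[OF assms(2) Suc.IH Suc.IH])
       (use Suc.prems Ck_on_SucD in auto)
  then show ?case using differentiableI[OF d] by simp
qed

text \<open>Finite dimension is used through the expansion in an orthogonal spanning set: it turns
  \<open>Dg\<^sub>x(\<xi>(x))\<close> into a finite sum of products of smooth functions.\<close>

definition findim :: "'a::real_vector itself \<Rightarrow> bool" where
  "findim _ \<longleftrightarrow> (\<exists>B. finite B \<and> span B = (UNIV :: 'a set))"

lemma findim_euclidean: "findim TYPE('a::euclidean_space)"
  unfolding findim_def using finite_Basis span_Basis by blast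

lemma findim_orthogonal_expansion:
  assumes "findim TYPE('a::real_inner)"
  obtains B :: "'a::real_inner set" where "finite B" "\<And>x. x = (\<Sum>b\<in>B. (x \<bullet> b / (b \<bullet> b)) *\<^sub>R b)"
proof -
  obtain B0 :: "'a set" where "finite B0" "span B0 = UNIV"
    using assms unfolding findim_def by blast
  then obtain B :: "'a set" where B: "finite B" "span B = UNIV" "pairwise orthogonal B"
    using basis_orthogonal by metis
  have "x = (\<Sum>b\<in>B. (x \<bullet> b / (b \<bullet> b)) *\<^sub>R b)" for x
  proof -
    have "x \<in> span B" using B by simp
    then show ?thesis
    proof (induction rule: span_induct_alt)
      case base then show ?case by simp
    next
      case (step r a y)
      have 1: "(\<Sum>b\<in>B. (a \<bullet> b / (b \<bullet> b)) *\<^sub>R b) = (\<Sum>b\<in>B. if b = a then a else 0)"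
        using B(3) step(1) by (intro sum.cong) (auto simp: pairwise_def orthogonal_def)
      show ?case
      proof -
        have "(\<Sum>b\<in>B. ((r *\<^sub>R a + y) \<bullet> b / (b \<bullet> b)) *\<^sub>R b) =
            r *\<^sub>R (\<Sum>b\<in>B. (a \<bullet> b / (b \<bullet> b)) *\<^sub>R b) + (\<Sum>b\<in>B. (y \<bullet> b / (b \<bullet> b)) *\<^sub>R b)"
          by (simp add: inner_add_left add_divide_distrib scaleR_add_left sum.distrib scaleR_sum_right)
        also have "\<dots> = r *\<^sub>R a + y"
          using 1 B(1) step by simp
        finally show ?thesis by simp
      qed
    qed
  qed
  then show ?thesis using B(1) that by blast
qed

lemma linear_expansion:
  fixes x :: "'a::real_inner" and h :: "'a \<Rightarrow> 'b::real_vector"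
  assumes "linear h" "x = (\<Sum>b\<in>B. (x \<bullet> b / (b \<bullet> b)) *\<^sub>R b)"
  shows "h x = (\<Sum>b\<in>B. (x \<bullet> b / (b \<bullet> b)) *\<^sub>R h b)"
  by (subst assms(2)) (simp add: linear_sum[OF assms(1)] linear_scale[OF assms(1)])

text \<open>By the chain rule and the expansion of \<open>Df\<^sub>x(v)\<close>, the directional derivatives of the composition are
  sums of products of directional derivatives of \<open>f\<close> and \<open>g\<close> of one order less.\<close>

lemma Ck_on_compose:
  fixes f :: "'a::real_normed_vector \<Rightarrow> 'b::real_inner" and g :: "'b \<Rightarrow> 'c::real_normed_vector"
  assumes "findim TYPE('b)" "open S" "open T" "f ` S \<subseteq> T" "Ck_on k S f" "Ck_on k T g"
  shows "Ck_on k S (\<lambda>x. g (f x))"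
  using assms(5,6)
proof (induction k arbitrary: g)
  case 0 then show ?case using assms(4) by (auto intro: continuous_on_compose2)
next
  case (Suc k)
  obtain B :: "'b set" where B: "finite B" "\<And>x. x = (\<Sum>b\<in>B. (x \<bullet> b / (b \<bullet> b)) *\<^sub>R b)"
    using findim_orthogonal_expansion[OF assms(1)] by metis
  let ?D = "\<lambda>h x. frechet_derivative h (at x)"
  have dg: "g differentiable at (f x)" if "x \<in> S" for x using that Suc.prems assms(4) by auto
  have d: "((\<lambda>x. g (f x)) has_derivative (\<lambda>v. ?D g (f x) (?D f x v))) (at x)" if "x \<in> S" for x
    using Suc.prems that dg
    by (intro has_derivative_compose[of f _ _ _ g]) (auto simp: frechet_derivative_works)
  have e: "?D (\<lambda>x. g (f x)) x v = (\<Sum>b\<in>B. ((?D f x v \<bullet> b) / (b \<bullet> b)) *\<^sub>R ?D g (f x) b)" if "x \<in> S" for x v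
    unfolding frechet_derivative_at[OF d[OF that], symmetric]
    by (rule linear_expansion[OF linear_frechet_derivative[OF dg[OF that]] B(2)])
  have c: "Ck_on k S (\<lambda>x. (?D f x v \<bullet> b) / (b \<bullet> b))" for v b
  proof -
    have "Ck_on k S (\<lambda>x. (inverse (b \<bullet> b)) * (?D f x v \<bullet> b))"
      using Suc.prems(1)
      by (intro Ck_on_bilinear[OF bounded_bilinear_mult assms(2)]
          Ck_on_bilinear[OF bounded_bilinear_inner assms(2)] Ck_on_const) auto
    then show ?thesis by (simp add: divide_inverse mult.commute)
  qed
  have "Ck_on k S (\<lambda>x. ?D (\<lambda>x. g (f x)) x v)" for v
  proof (rule Ck_on_cong[OF assms(2)])
    show "Ck_on k S (\<lambda>x. \<Sum>b\<in>B. ((?D f x v \<bullet> b) / (b \<bullet> b)) *\<^sub>R ?D g (f x) b)"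
      using Suc.prems
      by (intro Ck_on_sum Ck_on_bilinear[OF bounded_bilinear_scaleR] c Suc.IH assms(2))
         (auto intro: Ck_on_SucD)
  qed (simp add: e)
  then show ?case using differentiableI[OF d] by simp
qed

lemma smooth_near_const [simp, intro]: "smooth_near z (\<lambda>_. c)"
  unfolding smooth_near_def smooth_on_def using Ck_on_const by blast

lemma smooth_near_bounded_linear: "bounded_linear f \<Longrightarrow> smooth_near z f"
  unfolding smooth_near_def smooth_on_def using Ck_on_bounded_linear by blast

lemma smooth_near_bilinear:
  assumes "bounded_bilinear pr" "smooth_near z f" "smooth_near z g"
  shows "smooth_near z (\<lambda>x. pr (f x) (g x))"
proof -
  obtain S T where S: "open S" "z \<in> S" "smooth_on S f" and T: "open T" "z \<in> T" "smooth_on T g"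
    using assms(2,3) unfolding smooth_near_def by blast
  then have "Ck_on k (S \<inter> T) (\<lambda>x. pr (f x) (g x))" for k
    using Ck_on_subset[of k S f "S \<inter> T"] Ck_on_subset[of k T g "S \<inter> T"]
    by (auto simp: smooth_on_def intro!: Ck_on_bilinear[OF assms(1)])
  then show ?thesis
    unfolding smooth_near_def smooth_on_def using S T by (intro exI[of _ "S \<inter> T"]) auto
qed

lemma smooth_near_add:
  assumes "smooth_near z f" "smooth_near z g"
  shows "smooth_near z (\<lambda>x. f x + g x)"
proof -
  obtain S T where S: "open S" "z \<in> S" "smooth_on S f" and T: "open T" "z \<in> T" "smooth_on T g"
    using assms unfolding smooth_near_def by blast
  then have "Ck_on k (S \<inter> T) (\<lambda>x. f x + g x)" for k
    using Ck_on_subset[of k S f "S \<inter> T"] Ck_on_subset[of k T g "S \<inter> T"]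
    by (auto simp: smooth_on_def intro!: Ck_on_add)
  then show ?thesis
    unfolding smooth_near_def smooth_on_def using S T by (intro exI[of _ "S \<inter> T"]) auto
qed

lemma smooth_near_compose:
  fixes f :: "'a::real_normed_vector \<Rightarrow> 'b::real_inner" and g :: "'b \<Rightarrow> 'c::real_normed_vector"
  assumes "findim TYPE('b)" "smooth_near z f" "smooth_near (f z) g"
  shows "smooth_near z (\<lambda>x. g (f x))"
proof -
  obtain S T where S: "open S" "z \<in> S" "smooth_on S f" and T: "open T" "f z \<in> T" "smooth_on T g"
    using assms(2,3) unfolding smooth_near_def by blast
  obtain S' where S': "open S'" "z \<in> S'" "\<And>x. x \<in> S' \<Longrightarrow> f x \<in> T"
    using continuous_at_open[THEN iffD1, OF smooth_near_continuous[OF assms(2)], rule_format, OF conjI[OF T(1,2)]]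
    by metis
  have fT: "f ` (S \<inter> S') \<subseteq> T" using S'(3) by blast
  have fS: "Ck_on k (S \<inter> S') f" for k
    using S(3) Ck_on_subset[of k S f] by (simp add: smooth_on_def)
  have gT: "Ck_on k T g" for k using T(3) by (simp add: smooth_on_def)
  have "smooth_on (S \<inter> S') (\<lambda>x. g (f x))"
    unfolding smooth_on_def
    using Ck_on_compose[OF assms(1) open_Int[OF S(1) S'(1)] T(1) fT fS gT] by blast
  moreover have "open (S \<inter> S')" "z \<in> S \<inter> S'" using S(1,2) S'(1,2) by (simp_all add: open_Int)
  ultimately show ?thesis unfolding smooth_near_def by blast
qed

lemma smooth_near_bl_compose:
  assumes "bounded_linear h" "smooth_near z f" shows "smooth_near z (\<lambda>x. h (f x))"
proof -
  have "bounded_bilinear (\<lambda>(r::real) y. r *\<^sub>R h y)"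
    using bounded_bilinear.comp[OF bounded_bilinear_scaleR bounded_linear_ident assms(1)] .
  from smooth_near_bilinear[OF this smooth_near_const[of z 1] assms(2)] show ?thesis by simp
qed

lemmas smooth_near_scaleR = smooth_near_bilinear[OF bounded_bilinear_scaleR]
lemmas smooth_near_mult = smooth_near_bilinear[OF bounded_bilinear_mult]
lemmas smooth_near_inner = smooth_near_bilinear[OF bounded_bilinear_inner]

lemma smooth_near_minus: "smooth_near z f \<Longrightarrow> smooth_near z (\<lambda>x. - f x)"
  by (rule smooth_near_bl_compose[of uminus]) (auto intro: bounded_linear_minus bounded_linear_ident)

lemma smooth_near_diff: "smooth_near z f \<Longrightarrow> smooth_near z g \<Longrightarrow> smooth_near z (\<lambda>x. f x - g x)"
  using smooth_near_add[of z f "\<lambda>x. - g x"] smooth_near_minus by auto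

lemma smooth_near_sum:
  "(\<And>i. i \<in> I \<Longrightarrow> smooth_near z (f i)) \<Longrightarrow> smooth_near z (\<lambda>x. \<Sum>i\<in>I. f i x)"
  by (induction I rule: infinite_finite_induct) (simp_all add: smooth_near_add)

lemma smooth_near_prod:
  fixes f :: "'i \<Rightarrow> 'a::real_normed_vector \<Rightarrow> real"
  shows "(\<And>i. i \<in> I \<Longrightarrow> smooth_near z (f i)) \<Longrightarrow> smooth_near z (\<lambda>x. \<Prod>i\<in>I. f i x)"
  by (induction I rule: infinite_finite_induct) (simp_all add: smooth_near_mult)

lemma smooth_near_Pair:
  assumes "smooth_near z f" "smooth_near z g" shows "smooth_near z (\<lambda>x. (f x, g x))"
proof -
  have "smooth_near z (\<lambda>x. (f x, 0) + (0, g x))"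
    by (intro smooth_near_add smooth_near_bl_compose[OF _ assms(1)] smooth_near_bl_compose[OF _ assms(2)])
       (intro bounded_linear_Pair bounded_linear_ident bounded_linear_zero)+
  then show ?thesis by simp
qed

lemma smooth_near_fst: "smooth_near z f \<Longrightarrow> smooth_near z (\<lambda>x. fst (f x))"
  and smooth_near_snd: "smooth_near z f \<Longrightarrow> smooth_near z (\<lambda>x. snd (f x))"
  by (auto intro: smooth_near_bl_compose bounded_linear_fst bounded_linear_snd)

lemma smooth_near_vec_nth: "smooth_near z f \<Longrightarrow> smooth_near z (\<lambda>x. f x $ i)"
  by (rule smooth_near_bl_compose[OF bounded_linear_vec_nth])

lemma smooth_near_vec:
  fixes f :: "'a::real_normed_vector \<Rightarrow> ('b::real_normed_vector)^'k"
  assumes "\<And>i. smooth_near z (\<lambda>x. f x $ i)"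
  shows "smooth_near z f"
proof -
  have bl: "bounded_linear (\<lambda>b::'b. (\<chi> j. if j = i then b else 0) :: 'b^'k)" for i :: 'k
  proof (rule bounded_linear_intro[where K = 1])
    fix b :: 'b
    have "norm ((\<chi> j. if j = i then b else 0) :: 'b^'k) \<le> (\<Sum>j\<in>UNIV. norm (if j = i then b else 0))"
      by (rule order_trans[OF L2_set_le_sum[of UNIV "\<lambda>j. norm (((\<chi> j. if j = i then b else 0) :: 'b^'k) $ j)", folded norm_vec_def]]) simp_all
    also have "\<dots> = norm b" by (simp add: if_distrib[of norm] cong: if_cong)
    finally show "norm ((\<chi> j. if j = i then b else 0) :: 'b^'k) \<le> norm b * 1" by simp
  qed (auto simp: vec_eq_iff)
  have "smooth_near z (\<lambda>x. \<Sum>i\<in>UNIV. (\<chi> j. if j = i then f x $ i else 0))"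
    by (intro smooth_near_sum smooth_near_bl_compose[OF bl] assms)
  moreover have "(\<Sum>i\<in>UNIV. (\<chi> j. if j = i then f x $ i else 0)) = f x" for x
    by (simp add: vec_eq_iff sum_component)
  ultimately show ?thesis by simp
qed

lemma smooth_near_matrix_vector:
  fixes A :: "'a::real_normed_vector \<Rightarrow> real^'k^'m"
  assumes "smooth_near z A" "smooth_near z f" shows "smooth_near z (\<lambda>x. A x *v f x)"
proof -
  have "bounded_bilinear ((*v) :: real^'k^'m \<Rightarrow> _)"
    unfolding bilinear_conv_bounded_bilinear[symmetric] bilinear_def
    by (auto intro!: linearI simp: vec_eq_iff matrix_vector_mult_def algebra_simps sum.distrib sum_distrib_left)
  from smooth_near_bilinear[OF this assms] show ?thesis .
qed

lemma Ck_on_inverse: "Ck_on k (- {0}) (inverse :: real \<Rightarrow> real)"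
proof (induction k)
  case 0 then show ?case by (auto intro!: continuous_intros)
next
  case (Suc k)
  have d: "(inverse has_derivative (\<lambda>v. - (inverse x * v * inverse x))) (at x)" if "x \<noteq> 0" for x :: real
    using that by (rule has_derivative_inverse')
  have "Ck_on k (- {0::real}) (\<lambda>x. frechet_derivative inverse (at x) v)" for v
  proof (rule Ck_on_cong)
    show "Ck_on k (- {0}) (\<lambda>x. - v * (inverse x * inverse x :: real))"
      by (intro Ck_on_bilinear[OF bounded_bilinear_mult] Suc Ck_on_const open_Compl closed_singleton)
  qed (auto simp: frechet_derivative_at[OF d, symmetric])
  then show ?case using differentiableI[OF d] by simp
qed

lemma smooth_near_inverse:
  fixes f :: "'a::real_normed_vector \<Rightarrow> real"
  assumes "smooth_near z f" "f z \<noteq> 0" shows "smooth_near z (\<lambda>x. inverse (f x))"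
proof (rule smooth_near_compose[OF findim_euclidean assms(1)])
  show "smooth_near (f z) inverse"
    unfolding smooth_near_def smooth_on_def using assms(2) Ck_on_inverse
    by (intro exI[of _ "- {0}"]) auto
qed

text \<open>Cramer's rule writes the solution as a quotient of smooth determinants: this is how
  the solution of a pointwise linear equation becomes a smooth section.\<close>

lemma smooth_near_linear_solution:
  fixes A :: "'a::real_normed_vector \<Rightarrow> real^'k^'k"
  assumes "smooth_near z A" "smooth_near z b" "det (A z) \<noteq> 0"
    and "\<forall>\<^sub>F z' in nhds z. A z' *v x z' = b z'"
  shows "smooth_near z x"
proof -
  have det: "smooth_near z (\<lambda>z'. det (M z'))" if "\<And>i j. smooth_near z (\<lambda>z'. M z' $ i $ j)"
    for M :: "'a \<Rightarrow> real^'k^'k"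
    unfolding det_def by (intro smooth_near_sum smooth_near_mult smooth_near_prod smooth_near_const that)
  have A: "smooth_near z (\<lambda>z'. A z' $ i $ j)" for i j
    using assms(1) by (intro smooth_near_vec_nth)
  have "smooth_near z (\<lambda>z'. \<chi> k. det (\<chi> i j. if j = k then b z' $ i else A z' $ i $ j) * inverse (det (A z')))"
    (is "smooth_near z ?s")
  proof (intro smooth_near_vec, simp only: vec_lambda_beta, intro smooth_near_mult smooth_near_inverse det A assms(3))
    fix k i j
    show "smooth_near z (\<lambda>z'. (\<chi> i j. if j = k then b z' $ i else A z' $ i $ j) $ i $ j)"
      using A assms(2) by (cases "j = k") (auto intro: smooth_near_vec_nth)
  qed
  moreover have "\<forall>\<^sub>F z' in nhds z. det (A z') \<noteq> 0"
    using smooth_near_continuous[OF det[OF A]] assms(3)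
    by (auto simp: isCont_def intro: tendsto_imp_eventually_ne eventually_nhds_conv_at[THEN iffD2])
  then have "\<forall>\<^sub>F z' in nhds z. ?s z' = x z'"
    using assms(4)
    by eventually_elim (simp add: cramer divide_inverse)
  ultimately show ?thesis by (rule smooth_near_cong)
qed

subsection \<open>Derivatives along vector fields\<close>

lemma frechet_derivative_bilinear:
  assumes "bounded_bilinear pr" "f differentiable at z" "g differentiable at z"
  shows "frechet_derivative (\<lambda>x. pr (f x) (g x)) (at z) v =
    pr (f z) (frechet_derivative g (at z) v) + pr (frechet_derivative f (at z) v) (g z)"
proof -
  have "((\<lambda>x. pr (f x) (g x)) has_derivative
      (\<lambda>v. pr (f z) (frechet_derivative g (at z) v) + pr (frechet_derivative f (at z) v) (g z))) (at z)"
    using assms(2,3)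
    by (intro bounded_bilinear.FDERIV[OF assms(1)]) (auto simp: frechet_derivative_works)
  from fun_cong[OF frechet_derivative_at[OF this]] show ?thesis by (rule sym)
qed

lemma frechet_derivative_add:
  assumes "f differentiable at z" "g differentiable at z"
  shows "frechet_derivative (\<lambda>x. f x + g x) (at z) v =
    frechet_derivative f (at z) v + frechet_derivative g (at z) v"
proof -
  have "((\<lambda>x. f x + g x) has_derivative
      (\<lambda>v. frechet_derivative f (at z) v + frechet_derivative g (at z) v)) (at z)"
    using assms by (intro has_derivative_add) (auto simp: frechet_derivative_works)
  from fun_cong[OF frechet_derivative_at[OF this]] show ?thesis by (rule sym)
qed

lemma frechet_derivative_bl_compose:
  assumes "bounded_linear h" "f differentiable at z"
  shows "frechet_derivative (\<lambda>x. h (f x)) (at z) v = h (frechet_derivative f (at z) v)"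
proof -
  have "((\<lambda>x. h (f x)) has_derivative (\<lambda>v. h (frechet_derivative f (at z) v))) (at z)"
    using assms(2) by (intro bounded_linear.has_derivative[OF assms(1)]) (auto simp: frechet_derivative_works)
  from fun_cong[OF frechet_derivative_at[OF this]] show ?thesis by (rule sym)
qed

lemma frechet_derivative_chain:
  assumes "f differentiable at z" "g differentiable at (f z)"
  shows "frechet_derivative (\<lambda>x. g (f x)) (at z) v =
    frechet_derivative g (at (f z)) (frechet_derivative f (at z) v)"
  using frechet_derivative_compose[OF assms] by (simp add: o_def fun_eq_iff)

lemma smooth_near_derivative_along:
  fixes f :: "'a::real_inner \<Rightarrow> 'b::real_normed_vector"
  assumes "findim TYPE('a)" "smooth_near z f" "smooth_near z \<xi>"
  shows "smooth_near z (\<lambda>z'. frechet_derivative f (at z') (\<xi> z'))"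
proof -
  obtain B :: "'a set" where B: "finite B" "\<And>x. x = (\<Sum>b\<in>B. (x \<bullet> b / (b \<bullet> b)) *\<^sub>R b)"
    using findim_orthogonal_expansion[OF assms(1)] by metis
  have "smooth_near z (\<lambda>z'. \<Sum>b\<in>B. (\<xi> z' \<bullet> b * inverse (b \<bullet> b)) *\<^sub>R frechet_derivative f (at z') b)"
    by (intro smooth_near_sum smooth_near_scaleR smooth_near_mult smooth_near_inner smooth_near_const
        assms smooth_near_directional)
  moreover have "\<forall>\<^sub>F z' in nhds z. (\<Sum>b\<in>B. (\<xi> z' \<bullet> b * inverse (b \<bullet> b)) *\<^sub>R frechet_derivative f (at z') b)
      = frechet_derivative f (at z') (\<xi> z')"
    using smooth_near_eventually[OF assms(2)]
  proof eventually_elim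
    case (elim z')
    show ?case
      unfolding linear_expansion[OF smooth_near_linear[OF elim] B(2), of "\<xi> z'"] by (simp add: divide_inverse)
  qed
  ultimately show ?thesis by (rule smooth_near_cong)
qed

text \<open>The product rule for \<open>z \<mapsto> Df\<^sub>z(\<xi>(z))\<close>. The first summand is a second derivative of \<open>f\<close> in constant
  directions, hence symmetric, and will cancel in commutators.\<close>

lemma frechet_derivative_along:
  fixes f :: "'a::real_inner \<Rightarrow> 'b::real_normed_vector"
  assumes "findim TYPE('a)" "smooth_near z f" "\<xi> differentiable at z"
  shows "frechet_derivative (\<lambda>z'. frechet_derivative f (at z') (\<xi> z')) (at z) u =
    frechet_derivative (\<lambda>z'. frechet_derivative f (at z') (\<xi> z)) (at z) u +
    frechet_derivative f (at z) (frechet_derivative \<xi> (at z) u)"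
proof -
  obtain B :: "'a set" where B: "finite B" "\<And>x. x = (\<Sum>b\<in>B. (x \<bullet> b / (b \<bullet> b)) *\<^sub>R b)"
    using findim_orthogonal_expansion[OF assms(1)] by metis
  let ?D = "\<lambda>h x. frechet_derivative h (at x)"
  let ?c = "\<lambda>x b. x \<bullet> b * inverse (b \<bullet> b)"
  have ex: "?D f z' x = (\<Sum>b\<in>B. ?c x b *\<^sub>R ?D f z' b)" if "smooth_near z' f" for z' x
    unfolding linear_expansion[OF smooth_near_linear[OF that] B(2), of x] by (simp add: divide_inverse)
  have ev: "\<forall>\<^sub>F z' in nhds z. \<forall>x. ?D f z' x = (\<Sum>b\<in>B. ?c x b *\<^sub>R ?D f z' b)"
    using smooth_near_eventually[OF assms(2)] by eventually_elim (use ex in blast)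
  have hd: "((\<lambda>z'. ?D f z' b) has_derivative ?D (\<lambda>z'. ?D f z' b) z) (at z)" for b
    using smooth_near_has_derivative[OF smooth_near_directional[OF assms(2)]] .
  have hx: "(\<xi> has_derivative ?D \<xi> z) (at z)" using assms(3) frechet_derivative_works by blast
  have 1: "((\<lambda>z'. \<Sum>b\<in>B. ?c (\<xi> z') b *\<^sub>R ?D f z' b) has_derivative
     (\<lambda>u. \<Sum>b\<in>B. ?c (\<xi> z) b *\<^sub>R ?D (\<lambda>z'. ?D f z' b) z u + ?c (?D \<xi> z u) b *\<^sub>R ?D f z b)) (at z)"
    by (rule derivative_eq_intros hd hx refl | simp)+
  have 2: "((\<lambda>z'. \<Sum>b\<in>B. ?c (\<xi> z) b *\<^sub>R ?D f z' b) has_derivative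
     (\<lambda>u. \<Sum>b\<in>B. ?c (\<xi> z) b *\<^sub>R ?D (\<lambda>z'. ?D f z' b) z u)) (at z)"
    by (rule derivative_eq_intros hd refl | simp)+
  have "?D (\<lambda>z'. ?D f z' (\<xi> z')) z = ?D (\<lambda>z'. \<Sum>b\<in>B. ?c (\<xi> z') b *\<^sub>R ?D f z' b) z"
    by (rule frechet_derivative_cong) (use ev in eventually_elim, blast)
  moreover have "?D (\<lambda>z'. ?D f z' (\<xi> z)) z = ?D (\<lambda>z'. \<Sum>b\<in>B. ?c (\<xi> z) b *\<^sub>R ?D f z' b) z"
    by (rule frechet_derivative_cong) (use ev in eventually_elim, blast)
  ultimately show ?thesis
    by (simp add: frechet_derivative_at[OF 1, symmetric] frechet_derivative_at[OF 2, symmetric]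
        sum.distrib ex[OF assms(2), of "?D \<xi> z u"])
qed

subsection \<open>Symmetry of second derivatives\<close>

lemma DERIV_along_line:
  fixes F :: "'a::real_normed_vector \<Rightarrow> real"
  assumes "F differentiable at (p + t *\<^sub>R v)"
  shows "((\<lambda>t. F (p + t *\<^sub>R v)) has_real_derivative frechet_derivative F (at (p + t *\<^sub>R v)) v) (at t)"
proof -
  have 1: "((\<lambda>t. p + t *\<^sub>R v) has_derivative (\<lambda>s. s *\<^sub>R v)) (at t)"
    by (rule derivative_eq_intros refl | simp)+
  have 2: "(F has_derivative frechet_derivative F (at (p + t *\<^sub>R v))) (at (p + t *\<^sub>R v))"
    using assms frechet_derivative_works by blast
  have "((\<lambda>t. F (p + t *\<^sub>R v)) has_derivative
      (\<lambda>s. frechet_derivative F (at (p + t *\<^sub>R v)) (s *\<^sub>R v))) (at t)"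
    by (rule has_derivative_compose[OF 1 2])
  then show ?thesis
    unfolding has_field_derivative_def
    by (simp add: linear_scale[OF linear_frechet_derivative[OF assms]] mult.commute[of _ "frechet_derivative _ _ _"])
qed

lemma double_difference_mvt:
  fixes F :: "'a::real_normed_vector \<Rightarrow> real"
  assumes "s > 0"
    and "\<And>t u. 0 \<le> t \<Longrightarrow> t \<le> s \<Longrightarrow> 0 \<le> u \<Longrightarrow> u \<le> s \<Longrightarrow> smooth_near (z + t *\<^sub>R v + u *\<^sub>R w) F"
  obtains t u where "0 \<le> t" "t \<le> s" "0 \<le> u" "u \<le> s"
    "F (z + s *\<^sub>R v + s *\<^sub>R w) - F (z + s *\<^sub>R v) - F (z + s *\<^sub>R w) + F z =
      s * s * frechet_derivative (\<lambda>z'. frechet_derivative F (at z') v) (at (z + t *\<^sub>R v + u *\<^sub>R w)) w"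
proof -
  let ?D = "\<lambda>z'. frechet_derivative F (at z') v"
  have dF: "((\<lambda>t. F (z + u *\<^sub>R w + t *\<^sub>R v)) has_real_derivative ?D (z + t *\<^sub>R v + u *\<^sub>R w)) (at t)"
    if "0 \<le> t" "t \<le> s" "0 \<le> u" "u \<le> s" for t u
  proof -
    have e: "z + t *\<^sub>R v + u *\<^sub>R w = z + u *\<^sub>R w + t *\<^sub>R v" by simp
    show ?thesis
      unfolding e using assms(2)[OF that, unfolded e]
      by (intro DERIV_along_line smooth_near_differentiable)
  qed
  have d: "((\<lambda>t. F (z + s *\<^sub>R w + t *\<^sub>R v) - F (z + 0 *\<^sub>R w + t *\<^sub>R v)) has_real_derivative
      ?D (z + t *\<^sub>R v + s *\<^sub>R w) - ?D (z + t *\<^sub>R v + 0 *\<^sub>R w)) (at t)" if "0 \<le> t" "t \<le> s" for t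
    using that assms(1) by (intro DERIV_diff dF) auto
  obtain t where t: "0 < t" "t < s"
    "(F (z + s *\<^sub>R w + s *\<^sub>R v) - F (z + 0 *\<^sub>R w + s *\<^sub>R v)) - (F (z + s *\<^sub>R w + 0 *\<^sub>R v) - F (z + 0 *\<^sub>R w + 0 *\<^sub>R v))
      = (s - 0) * (?D (z + t *\<^sub>R v + s *\<^sub>R w) - ?D (z + t *\<^sub>R v + 0 *\<^sub>R w))"
    using MVT2[OF assms(1) d] by blast
  have d': "((\<lambda>u. ?D (z + t *\<^sub>R v + u *\<^sub>R w)) has_real_derivative
      frechet_derivative ?D (at (z + t *\<^sub>R v + u *\<^sub>R w)) w) (at u)" if "0 \<le> u" "u \<le> s" for u
    using that t by (intro DERIV_along_line smooth_near_differentiable smooth_near_directional assms(2)) auto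
  obtain u where u: "0 < u" "u < s"
    "?D (z + t *\<^sub>R v + s *\<^sub>R w) - ?D (z + t *\<^sub>R v + 0 *\<^sub>R w) =
      (s - 0) * frechet_derivative ?D (at (z + t *\<^sub>R v + u *\<^sub>R w)) w"
    using MVT2[OF assms(1) d'] by blast
  show ?thesis
    by (rule that[of t u]) (use t u in \<open>simp_all add: algebra_simps\<close>)
qed

text \<open>The second difference of \<open>F\<close> over a small parallelogram is \<open>s\<^sup>2\<close> times either mixed derivative at some
  nearby point; by continuity the two agree in the limit.\<close>

lemma second_derivative_symmetric_real:
  fixes F :: "'a::real_normed_vector \<Rightarrow> real"
  assumes "smooth_near z F"
  shows "frechet_derivative (\<lambda>z'. frechet_derivative F (at z') v) (at z) w =
    frechet_derivative (\<lambda>z'. frechet_derivative F (at z') w) (at z) v"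
proof (rule ccontr)
  define A where "A v w z' = frechet_derivative (\<lambda>z'. frechet_derivative F (at z') v) (at z') w" for v w z'
  assume "\<not> ?thesis"
  then have ne: "\<bar>A v w z - A w v z\<bar> / 2 > 0" unfolding A_def by simp
  have c: "isCont (A v w) z" for v w
    unfolding A_def using assms by (intro smooth_near_continuous smooth_near_directional)
  have cv: "\<forall>\<^sub>F z' in nhds z. \<bar>A v w z' - A v w z\<bar> < d" if "0 < d" for v w d
    using tendstoD[OF c[of v w, unfolded isCont_def tendsto_at_iff_tendsto_nhds] that]
    by (simp add: dist_real_def)
  have ev: "\<forall>\<^sub>F z' in nhds z. smooth_near z' F \<and> \<bar>A v w z' - A v w z\<bar> < \<bar>A v w z - A w v z\<bar> / 2 \<and>
      \<bar>A w v z' - A w v z\<bar> < \<bar>A v w z - A w v z\<bar> / 2"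
    using smooth_near_eventually[OF assms] cv[OF ne, of v w] cv[OF ne, of w v]
    by (intro eventually_conj)
  then obtain r where r: "r > 0" "\<And>z'. dist z' z < r \<Longrightarrow> smooth_near z' F \<and>
      \<bar>A v w z' - A v w z\<bar> < \<bar>A v w z - A w v z\<bar> / 2 \<and> \<bar>A w v z' - A w v z\<bar> < \<bar>A v w z - A w v z\<bar> / 2"
    unfolding eventually_nhds_metric by blast
  define s where "s = r / (2 * (norm v + norm w + 1))"
  have s: "s > 0" unfolding s_def using r(1) by (simp add: add_nonneg_pos)
  have near: "dist (z + t *\<^sub>R v + u *\<^sub>R w) z < r" if "0 \<le> t" "t \<le> s" "0 \<le> u" "u \<le> s" for t u
  proof -
    have "dist (z + t *\<^sub>R v + u *\<^sub>R w) z \<le> t * norm v + u * norm w"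
      using that norm_triangle_ineq[of "t *\<^sub>R v" "u *\<^sub>R w"] by (simp add: dist_norm add.assoc)
    also have "\<dots> \<le> s * norm v + s * norm w"
      using that by (intro add_mono mult_right_mono) auto
    also have "\<dots> \<le> s * (norm v + norm w + 1)"
      using s by (simp add: algebra_simps)
    also have "\<dots> = r / 2"
      unfolding s_def using add_nonneg_pos[of "norm v + norm w" 1] by (simp add: field_simps)
    finally show ?thesis using r(1) by simp
  qed
  have near': "dist (z + t *\<^sub>R w + u *\<^sub>R v) z < r" if "0 \<le> t" "t \<le> s" "0 \<le> u" "u \<le> s" for t u
    using near[OF that(3,4,1,2)] by (simp add: add.assoc add.commute[of "u *\<^sub>R v"])
  obtain t u where tu: "0 \<le> t" "t \<le> s" "0 \<le> u" "u \<le> s"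
    "F (z + s *\<^sub>R v + s *\<^sub>R w) - F (z + s *\<^sub>R v) - F (z + s *\<^sub>R w) + F z =
      s * s * A v w (z + t *\<^sub>R v + u *\<^sub>R w)"
    using double_difference_mvt[OF s, of z v w F] near r(2) unfolding A_def by metis
  obtain t' u' where tu': "0 \<le> t'" "t' \<le> s" "0 \<le> u'" "u' \<le> s"
    "F (z + s *\<^sub>R w + s *\<^sub>R v) - F (z + s *\<^sub>R w) - F (z + s *\<^sub>R v) + F z =
      s * s * A w v (z + t' *\<^sub>R w + u' *\<^sub>R v)"
    using double_difference_mvt[OF s, of z w v F] near' r(2) unfolding A_def by metis
  have "s * s * A v w (z + t *\<^sub>R v + u *\<^sub>R w) = s * s * A w v (z + t' *\<^sub>R w + u' *\<^sub>R v)"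
    using tu(5)[unfolded add.assoc add.commute[of "s *\<^sub>R v"]]
      tu'(5)[unfolded add.assoc add.commute[of "s *\<^sub>R v"]]
    unfolding add.assoc by linarith
  then have "A v w (z + t *\<^sub>R v + u *\<^sub>R w) = A w v (z + t' *\<^sub>R w + u' *\<^sub>R v)"
    using s by simp
  then show False
    using r(2)[OF near[OF tu(1-4)]] r(2)[OF near'[OF tu'(1-4)]] by argo
qed

lemma second_derivative_symmetric:
  fixes F :: "'a::real_normed_vector \<Rightarrow> 'b::real_inner"
  assumes "smooth_near z F"
  shows "frechet_derivative (\<lambda>z'. frechet_derivative F (at z') v) (at z) w =
    frechet_derivative (\<lambda>z'. frechet_derivative F (at z') w) (at z) v"
proof -
  have 1: "frechet_derivative (\<lambda>z'. frechet_derivative (\<lambda>x. F x \<bullet> k) (at z') v) (at z) w =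
      frechet_derivative (\<lambda>z'. frechet_derivative F (at z') v) (at z) w \<bullet> k" for v w k
  proof -
    have "\<forall>\<^sub>F z' in nhds z. frechet_derivative (\<lambda>x. F x \<bullet> k) (at z') v = frechet_derivative F (at z') v \<bullet> k"
      using smooth_near_eventually[OF assms]
      by eventually_elim
        (rule frechet_derivative_bl_compose[OF bounded_linear_inner_left smooth_near_differentiable])
    note frechet_derivative_cong[OF this]
    moreover have "frechet_derivative (\<lambda>z'. frechet_derivative F (at z') v \<bullet> k) (at z) w =
        frechet_derivative (\<lambda>z'. frechet_derivative F (at z') v) (at z) w \<bullet> k"
      by (rule frechet_derivative_bl_compose[OF bounded_linear_inner_left
            smooth_near_differentiable[OF smooth_near_directional[OF assms]]])
    ultimately show ?thesis by simp
  qed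
  have "smooth_near z (\<lambda>x. F x \<bullet> k)" for k
    by (rule smooth_near_bl_compose[OF bounded_linear_inner_left assms])
  note second_derivative_symmetric_real[OF this, of _ v w, unfolded 1]
  then show ?thesis by (rule vector_eq_rdot[THEN iffD1, OF allI])
qed

subsection \<open>Bump functions\<close>

text \<open>The polynomial factor makes this family closed under differentiation, so that smoothness of all
  its members follows by one induction.\<close>

definition flat_exp :: "real poly \<Rightarrow> real \<Rightarrow> real" where
  "flat_exp p x = (if x \<le> 0 then 0 else poly p (1 / x) * exp (- (1 / x)))"

lemma poly_times_exp_minus_tendsto_0: "((\<lambda>t::real. poly p t * exp (- t)) \<longlongrightarrow> 0) at_top"
proof -
  have "((\<lambda>t::real. \<Sum>i\<le>degree p. coeff p i * (t ^ i / exp t)) \<longlongrightarrow> (\<Sum>i\<le>degree p. coeff p i * 0)) at_top"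
    by (intro tendsto_sum tendsto_mult tendsto_const tendsto_power_div_exp_0)
  then show ?thesis
    by (simp add: poly_altdef exp_minus sum_distrib_right divide_inverse mult.assoc)
qed

lemma DERIV_flat_exp:
  "(flat_exp p has_real_derivative flat_exp ([:0, 0, 1:] * (p - pderiv p)) x) (at x)"
proof (cases x "0::real" rule: linorder_cases)
  case less
  have "((\<lambda>_. 0) has_real_derivative flat_exp ([:0, 0, 1:] * (p - pderiv p)) x) (at x)"
    using less by (simp add: flat_exp_def)
  then show ?thesis
    by (rule has_field_derivative_transform_within_open[where S = "{..<0}"]) (use less in \<open>auto simp: flat_exp_def\<close>)
next
  case greater
  have "((\<lambda>x. poly p (1 / x) * exp (- (1 / x))) has_real_derivative flat_exp ([:0, 0, 1:] * (p - pderiv p)) x) (at x)"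
    using greater
    by (auto intro!: derivative_eq_intros DERIV_chain'[of _ _ x _ "poly p"] poly_DERIV
        simp: flat_exp_def field_simps power2_eq_square)
  then show ?thesis
    by (rule has_field_derivative_transform_within_open[where S = "{0<..}"]) (use greater in \<open>auto simp: flat_exp_def\<close>)
next
  case equal
  have r: "((\<lambda>h. flat_exp p h / h) \<longlongrightarrow> 0) (at_right 0)"
  proof (rule Lim_transform_eventually)
    have "((\<lambda>t::real. poly ([:0, 1:] * p) t * exp (- t)) \<longlongrightarrow> 0) at_top"
      by (rule poly_times_exp_minus_tendsto_0)
    from filterlim_compose[OF this filterlim_inverse_at_top_right]
    show "((\<lambda>h. poly ([:0, 1:] * p) (inverse h) * exp (- inverse h)) \<longlongrightarrow> 0) (at_right 0)" .
    show "\<forall>\<^sub>F h in at_right 0. poly ([:0, 1:] * p) (inverse h) * exp (- inverse h) = flat_exp p h / h"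
      by (simp add: eventually_at_right_less eventually_at_filter flat_exp_def field_simps)
  qed
  have l: "((\<lambda>h. flat_exp p h / h) \<longlongrightarrow> 0) (at_left 0)"
    by (rule Lim_transform_eventually[OF tendsto_const]) (simp add: eventually_at_filter flat_exp_def)
  have "((\<lambda>h. flat_exp p h / h) \<longlongrightarrow> 0) (at 0)"
    using r l by (simp add: filterlim_split_at)
  then show ?thesis using equal by (simp add: DERIV_def flat_exp_def)
qed

lemma Ck_on_flat_exp: "Ck_on k UNIV (flat_exp p)"
proof (induction k arbitrary: p)
  case 0
  show ?case using DERIV_flat_exp DERIV_continuous_on by (metis Ck_on.simps(1) DERIV_subset subset_UNIV)
next
  case (Suc k)
  let ?q = "[:0, 0, 1:] * (p - pderiv p)"
  have d: "(flat_exp p has_derivative (\<lambda>v. flat_exp ?q x * v)) (at x)" for x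
    using DERIV_flat_exp[of p x] by (simp only: has_field_derivative_def)
  have "Ck_on k UNIV (\<lambda>x. flat_exp ?q x * v)" for v
    by (intro Ck_on_bilinear[OF bounded_bilinear_mult] Suc Ck_on_const open_UNIV)
  then show ?case
    using differentiableI[OF d] by (simp only: Ck_on.simps frechet_derivative_at[OF d, symmetric]) blast
qed

lemma smooth_near_flat_exp:
  "smooth_near z f \<Longrightarrow> smooth_near z (\<lambda>x. flat_exp p (f x))"
  by (rule smooth_near_compose[OF findim_euclidean])
    (auto simp: smooth_near_def smooth_on_def intro!: exI[of _ UNIV] Ck_on_flat_exp)

lemma flat_exp_1: "flat_exp 1 x = (if x \<le> 0 then 0 else exp (- (1 / x)))"
  by (simp add: flat_exp_def)

text \<open>Nesting the flat function makes the bump constant near its centre: the inner occurrence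
  vanishes on the smaller ball, and exceeds the threshold outside the larger one.\<close>

lemma bump_function:
  fixes z0 :: "'v::real_inner"
  assumes "r > 0"
  obtains \<beta> :: "'v \<Rightarrow> real" where "\<And>z. smooth_near z \<beta>" "\<forall>\<^sub>F z in nhds z0. \<beta> z = 1"
    "\<And>z. z \<notin> cball z0 r \<Longrightarrow> \<beta> z = 0"
proof -
  define e where "e = flat_exp 1"
  define q where "q z = ((z - z0) \<bullet> (z - z0)) * inverse (r * r)" for z
  define \<beta> where "\<beta> z = e (1 - e (q z - 1 / 2) * inverse (e (1 / 2))) * inverse (e 1)" for z
  have e_mono: "e a \<ge> e (1 / 2)" if "a \<ge> 1 / 2" for a
  proof -
    have "0 < a" "1 / a \<le> 2" using that by (auto simp: field_simps)
    then show ?thesis by (simp add: e_def flat_exp_1)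
  qed
  have e_pos: "e a > 0" if "a > 0" for a using that by (simp add: e_def flat_exp_1)
  have e_0: "e a = 0" if "a \<le> 0" for a using that by (simp add: e_def flat_exp_1)
  have q_s: "smooth_near z q" for z
    unfolding q_def
    by (intro smooth_near_mult smooth_near_inner smooth_near_diff smooth_near_const
        smooth_near_bounded_linear bounded_linear_ident)
  have 1: "smooth_near z \<beta>" for z
    unfolding \<beta>_def e_def
    by (intro smooth_near_mult smooth_near_const smooth_near_flat_exp smooth_near_diff q_s)
  have "isCont q z0" using q_s smooth_near_continuous by blast
  moreover have "q z0 < 1 / 2" by (simp add: q_def)
  ultimately have "\<forall>\<^sub>F z in nhds z0. q z < 1 / 2"
    by (metis (full_types) isCont_def order_tendstoD(2) tendsto_at_iff_tendsto_nhds)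
  then have 2: "\<forall>\<^sub>F z in nhds z0. \<beta> z = 1"
    by eventually_elim (use e_pos[of 1] in \<open>simp add: \<beta>_def e_0\<close>)
  have 3: "\<beta> z = 0" if "z \<notin> cball z0 r" for z
  proof -
    have "r < norm (z - z0)" using that by (simp add: dist_norm norm_minus_commute)
    then have "r * r \<le> (z - z0) \<bullet> (z - z0)"
      using assms by (metis less_imp_le mult_mono norm_ge_zero power2_eq_square power2_norm_eq_inner)
    then have "q z \<ge> 1" using assms by (simp add: q_def field_simps)
    then have "e (q z - 1 / 2) \<ge> e (1 / 2)" by (intro e_mono) simp
    then have "1 - e (q z - 1 / 2) * inverse (e (1 / 2)) \<le> 0"
      using e_pos[of "1/2"] by (simp add: field_simps)
    then show ?thesis by (simp add: \<beta>_def e_0)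
  qed
  show ?thesis using that 1 2 3 by blast
qed

text \<open>The coefficients in an orthogonal expansion are bounded on the ball, which therefore is a closed
  subset of a finite sum of compact segments.\<close>

lemma compact_cball_findim:
  fixes z0 :: "'v::real_inner"
  assumes "findim TYPE('v)"
  shows "compact (cball z0 r)"
proof -
  obtain B :: "'v set" where B: "finite B" "\<And>x. x = (\<Sum>b\<in>B. (x \<bullet> b / (b \<bullet> b)) *\<^sub>R b)"
    using findim_orthogonal_expansion[OF assms] by metis
  have "compact {x. \<exists>u. (\<forall>b. \<bar>u b\<bar> \<le> r / norm b) \<and> x = (\<Sum>b\<in>C. u b *\<^sub>R b)}"
    if "finite C" for C :: "'v set"
    using that
  proof (induction C)
    case empty
    show ?case by (rule finite_imp_compact, rule finite_subset[of _ "{0}"]) auto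
  next
    case (insert a C)
    let ?K = "{x. \<exists>u. (\<forall>b. \<bar>u b\<bar> \<le> r / norm b) \<and> x = (\<Sum>b\<in>C. u b *\<^sub>R b)}"
    have "compact ((\<lambda>t. t *\<^sub>R a) ` {- (r / norm a)..r / norm a})"
      by (intro compact_continuous_image continuous_intros compact_Icc)
    from compact_sums[OF this insert.IH]
    have "compact {x + y |x y. x \<in> (\<lambda>t. t *\<^sub>R a) ` {- (r / norm a)..r / norm a} \<and> y \<in> ?K}" .
    also have "{x + y |x y. x \<in> (\<lambda>t. t *\<^sub>R a) ` {- (r / norm a)..r / norm a} \<and> y \<in> ?K} =
      {x. \<exists>u. (\<forall>b. \<bar>u b\<bar> \<le> r / norm b) \<and> x = (\<Sum>b\<in>insert a C. u b *\<^sub>R b)}" (is "?L = ?R")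
    proof (intro set_eqI iffI)
      fix x assume "x \<in> ?L"
      then obtain y z where x: "x = y + z" and y: "y \<in> (\<lambda>t. t *\<^sub>R a) ` {- (r / norm a)..r / norm a}"
        and z: "z \<in> ?K" by blast
      obtain t where t: "t \<in> {- (r / norm a)..r / norm a}" "y = t *\<^sub>R a" using y by (rule imageE)
      obtain u where u: "\<forall>b. \<bar>u b\<bar> \<le> r / norm b" "z = (\<Sum>b\<in>C. u b *\<^sub>R b)" using z by blast
      have "\<bar>t\<bar> \<le> r / norm a" using t(1) unfolding atLeastAtMost_iff by linarith
      moreover have "(\<Sum>b\<in>C. u b *\<^sub>R b) = (\<Sum>b\<in>C. (u(a := t)) b *\<^sub>R b)"
        using insert(2) by (intro sum.cong) auto
      ultimately show "x \<in> ?R"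
        using x t(2) u insert(1,2) by (intro CollectI exI[of _ "u(a := t)"] conjI) simp_all
    next
      fix x assume "x \<in> ?R"
      then obtain u where u: "\<forall>b. \<bar>u b\<bar> \<le> r / norm b" "x = (\<Sum>b\<in>insert a C. u b *\<^sub>R b)" by blast
      have "u a \<in> {- (r / norm a)..r / norm a}"
        using u(1)[rule_format, of a] unfolding atLeastAtMost_iff by linarith
      then have "u a *\<^sub>R a \<in> (\<lambda>t. t *\<^sub>R a) ` {- (r / norm a)..r / norm a}" by (rule imageI)
      moreover have "(\<Sum>b\<in>C. u b *\<^sub>R b) \<in> ?K" using u(1) by blast
      moreover have "x = u a *\<^sub>R a + (\<Sum>b\<in>C. u b *\<^sub>R b)" using u(2) insert(1,2) by simp
      ultimately show "x \<in> ?L" by blast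
    qed
    finally show ?case .
  qed
  from this[OF B(1)] have K: "compact {x. \<exists>u. (\<forall>b. \<bar>u b\<bar> \<le> r / norm b) \<and> x = (\<Sum>b\<in>B. u b *\<^sub>R b)}" (is "compact ?K") .
  have "x \<in> ?K" if "x \<in> cball 0 r" for x
  proof -
    have "\<bar>x \<bullet> b / (b \<bullet> b)\<bar> \<le> r / norm b" for b
    proof (cases "b = 0")
      case False
      have "\<bar>x \<bullet> b\<bar> \<le> r * norm b"
        using Cauchy_Schwarz_ineq2[of x b] that by (smt (verit) mem_cball_0 mult_right_mono norm_ge_zero)
      then show ?thesis using False by (simp add: field_simps abs_divide dot_square_norm power2_eq_square)
    qed (use that in auto)
    then show ?thesis
      by (intro CollectI exI[of _ "\<lambda>b. x \<bullet> b / (b \<bullet> b)"] conjI allI) (assumption, rule B(2))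
  qed
  then have "cball 0 r \<inter> ?K = cball 0 r" by blast
  then have "compact (cball (0::'v) r)"
    using closed_Int_compact[OF closed_cball K, of 0 r] by simp
  then show ?thesis
    using compact_translation[of "cball (0::'v) r" z0] by (simp add: image_add_cball)
qed

section \<open>Smooth functions and derivatives on manifolds\<close>

definition smooth_at ::
  "('a, 'v::real_normed_vector) chart set \<Rightarrow> 'a \<Rightarrow> ('a \<Rightarrow> 'b::real_normed_vector) \<Rightarrow> bool" where
  "smooth_at A p f \<longleftrightarrow> (\<forall>c\<in>charts_at A p. smooth_near (snd c p) (\<lambda>z. f (chart_inv c z)))"

definition chart_deriv ::
  "('a, 'v::real_normed_vector) chart \<Rightarrow> ('a \<Rightarrow> 'b::real_normed_vector) \<Rightarrow> 'a \<Rightarrow> 'v \<Rightarrow> 'b" where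
  "chart_deriv c f p \<xi> = frechet_derivative (\<lambda>z. f (chart_inv c z)) (at (snd c p)) \<xi>"

lemma coord_change_deriv_eq: "coord_change_deriv c c' p \<xi> = chart_deriv c (snd c') p \<xi>"
  by (simp add: coord_change_deriv_def chart_deriv_def o_def)

locale manifold =
  fixes A :: "('a::{t2_space,second_countable_topology}, 'v::real_inner) chart set"
  assumes atlas: "smooth_atlas A"
begin

lemma findim_model: "findim TYPE('v)"
  using atlas unfolding smooth_atlas_def findim_def by blast

lemma charts_atD: "c \<in> charts_at A p \<Longrightarrow> c \<in> A" "c \<in> charts_at A p \<Longrightarrow> p \<in> fst c"
  by (auto simp: charts_at_def)

lemma charts_at_nonempty: "\<exists>c. c \<in> charts_at A p"
  using atlas unfolding smooth_atlas_def charts_at_def by blast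

lemma chart_at: "chart_at A p \<in> charts_at A p"
  unfolding chart_at_def using charts_at_nonempty by (rule someI_ex)

lemma chart_open: "c \<in> A \<Longrightarrow> open (fst c)" "c \<in> A \<Longrightarrow> open (snd c ` fst c)"
  using atlas unfolding smooth_atlas_def by blast+

lemma chart_homeo: "c \<in> A \<Longrightarrow> homeomorphism (fst c) (snd c ` fst c) (snd c) (chart_inv c)"
  using atlas unfolding smooth_atlas_def by blast

lemma chart_inv_chart: "c \<in> A \<Longrightarrow> p \<in> fst c \<Longrightarrow> chart_inv c (snd c p) = p"
  by (rule homeomorphism_apply1[OF chart_homeo])

lemma chart_chart_inv: "z \<in> snd c ` fst c \<Longrightarrow> snd c (chart_inv c z) = z"
  by (rule f_inv_into_f)

lemma filterlim_chart:
  assumes "c \<in> charts_at A p"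
  shows "filterlim (snd c) (nhds (snd c p)) (nhds p)"
    and "filterlim (chart_inv c) (nhds p) (nhds (snd c p))"
proof -
  note c = charts_atD[OF assms]
  have "isCont (snd c) p"
    using homeomorphism_cont1[OF chart_homeo[OF c(1)]] chart_open(1)[OF c(1)] c(2)
    by (simp add: continuous_on_eq_continuous_at)
  then show "filterlim (snd c) (nhds (snd c p)) (nhds p)"
    by (simp add: isCont_def tendsto_at_iff_tendsto_nhds)
  have "isCont (chart_inv c) (snd c p)"
    using homeomorphism_cont2[OF chart_homeo[OF c(1)]] chart_open(2)[OF c(1)] c(2)
    by (simp add: continuous_on_eq_continuous_at)
  then have "filterlim (chart_inv c) (nhds (chart_inv c (snd c p))) (nhds (snd c p))"
    by (simp add: isCont_def tendsto_at_iff_tendsto_nhds)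
  then show "filterlim (chart_inv c) (nhds p) (nhds (snd c p))"
    unfolding chart_inv_chart[OF c] .
qed

lemma eventually_in_chart: "c \<in> charts_at A p \<Longrightarrow> \<forall>\<^sub>F q in nhds p. c \<in> charts_at A q"
  using eventually_nhds_in_open[OF chart_open(1), of c p] by (simp add: charts_at_def)

lemma eventually_in_image: "c \<in> charts_at A p \<Longrightarrow> \<forall>\<^sub>F z in nhds (snd c p). z \<in> snd c ` fst c"
  using eventually_nhds_in_open[OF chart_open(2), of c "snd c p"] by (simp add: charts_at_def)

lemma eventually_chart_iff:
  assumes "c \<in> charts_at A p"
  shows "(\<forall>\<^sub>F z in nhds (snd c p). P (chart_inv c z)) \<longleftrightarrow> (\<forall>\<^sub>F q in nhds p. P q)"
proof
  assume "\<forall>\<^sub>F z in nhds (snd c p). P (chart_inv c z)"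
  then have "\<forall>\<^sub>F q in nhds p. P (chart_inv c (snd c q))"
    using filterlim_chart(1)[OF assms] by (rule eventually_compose_filterlim)
  with eventually_in_chart[OF assms] show "\<forall>\<^sub>F q in nhds p. P q"
    by eventually_elim (simp add: chart_inv_chart[OF charts_atD])
next
  assume "\<forall>\<^sub>F q in nhds p. P q"
  then show "\<forall>\<^sub>F z in nhds (snd c p). P (chart_inv c z)"
    using filterlim_chart(2)[OF assms] by (rule eventually_compose_filterlim)
qed

lemma open_chart_image: "c \<in> A \<Longrightarrow> open W \<Longrightarrow> open (snd c ` (fst c \<inter> W))"
proof -
  assume c: "c \<in> A" and W: "open W"
  have "snd c ` (fst c \<inter> W) = chart_inv c -` W \<inter> snd c ` fst c"
    using chart_inv_chart[OF c] by (auto simp: image_iff)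
  then show ?thesis
    using homeomorphism_cont2[OF chart_homeo[OF c]] chart_open(2)[OF c] W
    by (metis continuous_on_open_vimage)
qed

lemma smooth_near_coord_change:
  assumes "c \<in> charts_at A p" "c' \<in> charts_at A p"
  shows "smooth_near (snd c p) (\<lambda>z. snd c' (chart_inv c z))"
proof -
  note c = charts_atD[OF assms(1)] and c' = charts_atD[OF assms(2)]
  have "smooth_on (snd c ` (fst c \<inter> fst c')) (snd c' \<circ> chart_inv c)"
    using atlas c(1) c'(1) unfolding smooth_atlas_def by blast
  then have "smooth_near (snd c p) (snd c' \<circ> chart_inv c)"
    using smooth_on_iff_near[OF open_chart_image[OF c(1) chart_open(1)[OF c'(1)]]] c(2) c'(2) by blast
  then show ?thesis by (simp add: o_def)
qed

text \<open>Since coordinate changes are smooth, one chart around the point decides.\<close>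

lemma smooth_at_chart:
  assumes "c \<in> charts_at A p"
  shows "smooth_at A p f \<longleftrightarrow> smooth_near (snd c p) (\<lambda>z. f (chart_inv c z))"
proof
  assume "smooth_near (snd c p) (\<lambda>z. f (chart_inv c z))"
  note sc = this
  show "smooth_at A p f"
    unfolding smooth_at_def
  proof
    fix c' assume c': "c' \<in> charts_at A p"
    have e: "snd c (chart_inv c' (snd c' p)) = snd c p"
      using chart_inv_chart[OF charts_atD[OF c']] by simp
    have "smooth_near (snd c' p) (\<lambda>z. f (chart_inv c (snd c (chart_inv c' z))))"
      by (rule smooth_near_compose[OF findim_model smooth_near_coord_change[OF c' assms],
            where g = "\<lambda>z. f (chart_inv c z)"]) (simp add: e sc)
    moreover have "\<forall>\<^sub>F z in nhds (snd c' p). f (chart_inv c (snd c (chart_inv c' z))) = f (chart_inv c' z)"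
      unfolding eventually_chart_iff[OF c', where P = "\<lambda>q. f (chart_inv c (snd c q)) = f q"]
      using eventually_in_chart[OF assms]
      by eventually_elim (simp add: chart_inv_chart[OF charts_atD])
    ultimately show "smooth_near (snd c' p) (\<lambda>z. f (chart_inv c' z))"
      by (rule smooth_near_cong)
  qed
qed (use assms in \<open>simp add: smooth_at_def\<close>)

lemma smooth_at_cong:
  assumes "smooth_at A p f" "\<forall>\<^sub>F q in nhds p. f q = g q"
  shows "smooth_at A p g"
  unfolding smooth_at_def
proof
  fix c assume c: "c \<in> charts_at A p"
  show "smooth_near (snd c p) (\<lambda>z. g (chart_inv c z))"
  proof (rule smooth_near_cong)
    show "smooth_near (snd c p) (\<lambda>z. f (chart_inv c z))" using assms(1) c by (simp add: smooth_at_def)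
    show "\<forall>\<^sub>F z in nhds (snd c p). f (chart_inv c z) = g (chart_inv c z)"
      using assms(2) unfolding eventually_chart_iff[OF c, where P = "\<lambda>q. f q = g q"] .
  qed
qed

lemma smooth_at_eventually:
  assumes "smooth_at A p f" shows "\<forall>\<^sub>F q in nhds p. smooth_at A q f"
proof -
  obtain c where c: "c \<in> charts_at A p" using charts_at_nonempty by blast
  have "\<forall>\<^sub>F z in nhds (snd c p). smooth_near z (\<lambda>z. f (chart_inv c z))"
    using assms smooth_at_chart[OF c] smooth_near_eventually by blast
  then have "\<forall>\<^sub>F q in nhds p. smooth_near (snd c q) (\<lambda>z. f (chart_inv c z))"
    using filterlim_chart(1)[OF c] by (rule eventually_compose_filterlim)
  with eventually_in_chart[OF c] show ?thesis
    by eventually_elim (simp add: smooth_at_chart)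
qed

lemma mfd_smooth_on_iff:
  assumes "open W"
  shows "mfd_smooth_on A W f \<longleftrightarrow> (\<forall>p\<in>W. smooth_at A p f)"
proof -
  have "mfd_smooth_on A W f \<longleftrightarrow> (\<forall>c\<in>A. \<forall>p\<in>fst c \<inter> W. smooth_near (snd c p) (\<lambda>z. f (chart_inv c z)))"
    unfolding mfd_smooth_on_def using smooth_on_iff_near[OF open_chart_image[OF _ assms]]
    by (auto simp: o_def)
  also have "\<dots> \<longleftrightarrow> (\<forall>p\<in>W. smooth_at A p f)"
    unfolding smooth_at_def charts_at_def by blast
  finally show ?thesis .
qed

lemma smooth_at_chart_map: "c \<in> charts_at A p \<Longrightarrow> smooth_at A p (snd c)"
  unfolding smooth_at_def using smooth_near_coord_change by blast

lemma smooth_at_compose: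
  fixes f :: "'a \<Rightarrow> 'b::real_inner"
  assumes "findim TYPE('b)" "smooth_at A p f" "smooth_near (f p) g"
  shows "smooth_at A p (\<lambda>q. g (f q))"
  unfolding smooth_at_def
proof
  fix c assume c: "c \<in> charts_at A p"
  show "smooth_near (snd c p) (\<lambda>z. g (f (chart_inv c z)))"
    by (rule smooth_near_compose[OF assms(1), where f = "\<lambda>z. f (chart_inv c z)" and g = g])
      (use assms c chart_inv_chart[OF charts_atD[OF c]] in \<open>auto simp: smooth_at_def\<close>)
qed

lemma smooth_at_differentiable:
  "smooth_at A p f \<Longrightarrow> c \<in> charts_at A p \<Longrightarrow> (\<lambda>z. f (chart_inv c z)) differentiable at (snd c p)"
  by (simp add: smooth_at_def smooth_near_differentiable)

lemma smooth_at_isCont: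
  assumes "smooth_at A p f" shows "isCont f p"
proof -
  obtain c where c: "c \<in> charts_at A p" using charts_at_nonempty by blast
  have "filterlim (\<lambda>z. f (chart_inv c z)) (nhds (f p)) (nhds (snd c p))"
    using smooth_near_continuous assms c chart_inv_chart[OF charts_atD[OF c]]
    unfolding smooth_at_def isCont_def tendsto_at_iff_tendsto_nhds by fastforce
  from filterlim_compose[OF this filterlim_chart(1)[OF c]]
  have "filterlim (\<lambda>q. f (chart_inv c (snd c q))) (nhds (f p)) (nhds p)" .
  moreover have "\<forall>\<^sub>F q in nhds p. f (chart_inv c (snd c q)) = f q"
    using eventually_in_chart[OF c] by eventually_elim (simp add: chart_inv_chart[OF charts_atD])
  ultimately have "filterlim f (nhds (f p)) (nhds p)"
    by (rule Lim_transform_eventually)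
  then show ?thesis by (simp add: isCont_def tendsto_at_iff_tendsto_nhds)
qed

lemma smooth_at_const [simp, intro]: "smooth_at A p (\<lambda>_. k)"
  by (simp add: smooth_at_def)

lemma smooth_at_add:
  "smooth_at A p f \<Longrightarrow> smooth_at A p g \<Longrightarrow> smooth_at A p (\<lambda>q. f q + g q)"
  unfolding smooth_at_def by (auto intro!: smooth_near_add)

lemma smooth_at_diff:
  "smooth_at A p f \<Longrightarrow> smooth_at A p g \<Longrightarrow> smooth_at A p (\<lambda>q. f q - g q)"
  unfolding smooth_at_def by (auto intro!: smooth_near_diff)

lemma smooth_at_minus:
  "smooth_at A p f \<Longrightarrow> smooth_at A p (\<lambda>q. - f q)"
  unfolding smooth_at_def by (auto intro!: smooth_near_minus)

lemma smooth_at_sum: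
  "(\<And>i. i \<in> I \<Longrightarrow> smooth_at A p (h i)) \<Longrightarrow> smooth_at A p (\<lambda>q. \<Sum>i\<in>I. h i q)"
  unfolding smooth_at_def by (auto intro!: smooth_near_sum)

lemma smooth_at_vec_nth:
  "smooth_at A p u \<Longrightarrow> smooth_at A p (\<lambda>q. u q $ i)"
  unfolding smooth_at_def by (auto intro!: smooth_near_vec_nth)

lemma smooth_at_vec:
  "(\<And>i. smooth_at A p (\<lambda>q. u q $ i)) \<Longrightarrow> smooth_at A p u"
  unfolding smooth_at_def by (auto intro!: smooth_near_vec)

lemma smooth_at_Pair:
  "smooth_at A p f \<Longrightarrow> smooth_at A p u \<Longrightarrow> smooth_at A p (\<lambda>q. (f q, u q))"
  unfolding smooth_at_def by (auto intro!: smooth_near_Pair)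

lemma smooth_at_fst: "smooth_at A p fg \<Longrightarrow> smooth_at A p (\<lambda>q. fst (fg q))"
  unfolding smooth_at_def by (auto intro!: smooth_near_fst)

lemma smooth_at_snd:
  "smooth_at A p fg \<Longrightarrow> smooth_at A p (\<lambda>q. snd (fg q))"
  unfolding smooth_at_def by (auto intro!: smooth_near_snd)

lemma smooth_at_matrix_vector:
  fixes T :: "'a \<Rightarrow> real^'k^'m"
  shows
  "smooth_at A p T \<Longrightarrow> smooth_at A p y \<Longrightarrow> smooth_at A p (\<lambda>q. T q *v y q)"
  unfolding smooth_at_def by (auto intro!: smooth_near_matrix_vector)

lemma smooth_at_bilinear:
  "bounded_bilinear pr \<Longrightarrow> smooth_at A p f \<Longrightarrow> smooth_at A p g \<Longrightarrow> smooth_at A p (\<lambda>q. pr (f q) (g q))"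
  unfolding smooth_at_def by (intro ballI) (rule smooth_near_bilinear, simp_all)

lemmas smooth_at_scaleR = smooth_at_bilinear[OF bounded_bilinear_scaleR]
lemmas smooth_at_mult = smooth_at_bilinear[OF bounded_bilinear_mult]
lemmas smooth_at_inner = smooth_at_bilinear[OF bounded_bilinear_inner]

lemma smooth_at_linear_solution:
  fixes M :: "'a \<Rightarrow> real^'k^'k"
  assumes "smooth_at A p M" "smooth_at A p b" "det (M p) \<noteq> 0" "\<forall>\<^sub>F q in nhds p. M q *v x q = b q"
  shows "smooth_at A p x"
  unfolding smooth_at_def
proof
  fix c assume c: "c \<in> charts_at A p"
  show "smooth_near (snd c p) (\<lambda>z. x (chart_inv c z))"
    by (rule smooth_near_linear_solution[of _ "\<lambda>z. M (chart_inv c z)" "\<lambda>z. b (chart_inv c z)"])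
      (use assms c chart_inv_chart[OF charts_atD[OF c]] in
        \<open>auto simp: smooth_at_def eventually_chart_iff[OF c, where P = "\<lambda>q. M q *v x q = b q"]\<close>)
qed

subsection \<open>Derivatives in a chart\<close>

lemma chart_deriv_cong:
  assumes "c \<in> charts_at A p" "\<forall>\<^sub>F q in nhds p. f q = g q"
  shows "chart_deriv c f p \<xi> = chart_deriv c g p \<xi>"
proof -
  have "\<forall>\<^sub>F z in nhds (snd c p). f (chart_inv c z) = g (chart_inv c z)"
    using assms(2) unfolding eventually_chart_iff[OF assms(1), where P = "\<lambda>q. f q = g q"] .
  from frechet_derivative_cong[OF this] show ?thesis by (simp add: chart_deriv_def)
qed

lemma chart_deriv_linear:
  "c \<in> charts_at A p \<Longrightarrow> smooth_at A p f \<Longrightarrow> linear (chart_deriv c f p)"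
  unfolding chart_deriv_def by (simp add: smooth_at_def smooth_near_linear)

lemma chart_deriv_const [simp]: "chart_deriv c (\<lambda>_. k) p \<xi> = 0"
  by (simp add: chart_deriv_def)

lemma chart_deriv_bilinear:
  assumes "bounded_bilinear pr" "c \<in> charts_at A p" "smooth_at A p f" "smooth_at A p g"
  shows "chart_deriv c (\<lambda>q. pr (f q) (g q)) p \<xi> =
    pr (f p) (chart_deriv c g p \<xi>) + pr (chart_deriv c f p \<xi>) (g p)"
  unfolding chart_deriv_def
  using frechet_derivative_bilinear[OF assms(1) smooth_at_differentiable[OF assms(3,2)] smooth_at_differentiable[OF assms(4,2)]]
    chart_inv_chart[OF charts_atD[OF assms(2)]] by simp

lemma chart_deriv_add:
  assumes "c \<in> charts_at A p" "smooth_at A p f" "smooth_at A p g"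
  shows "chart_deriv c (\<lambda>q. f q + g q) p \<xi> = chart_deriv c f p \<xi> + chart_deriv c g p \<xi>"
  unfolding chart_deriv_def
  by (rule frechet_derivative_add[OF smooth_at_differentiable[OF assms(2,1)] smooth_at_differentiable[OF assms(3,1)]])

lemma chart_deriv_sum:
  assumes "c \<in> charts_at A p" "finite I" "\<And>i. i \<in> I \<Longrightarrow> smooth_at A p (f i)"
  shows "chart_deriv c (\<lambda>q. \<Sum>i\<in>I. f i q) p \<xi> = (\<Sum>i\<in>I. chart_deriv c (f i) p \<xi>)"
  using assms(2,3)
  by (induction I) (simp_all add: chart_deriv_add[OF assms(1)] smooth_at_sum)

lemma chart_deriv_bl:
  assumes "bounded_linear h" "c \<in> charts_at A p" "smooth_at A p f"
  shows "chart_deriv c (\<lambda>q. h (f q)) p \<xi> = h (chart_deriv c f p \<xi>)"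
  unfolding chart_deriv_def
  by (rule frechet_derivative_bl_compose[OF assms(1) smooth_at_differentiable[OF assms(3,2)]])

lemma chart_deriv_compose:
  fixes f :: "'a \<Rightarrow> 'b::real_inner"
  assumes "c \<in> charts_at A p" "smooth_at A p f" "smooth_near (f p) g"
  shows "chart_deriv c (\<lambda>q. g (f q)) p \<xi> = frechet_derivative g (at (f p)) (chart_deriv c f p \<xi>)"
  unfolding chart_deriv_def
  using frechet_derivative_chain[OF smooth_at_differentiable[OF assms(2,1)], of g \<xi>] assms(3)
    chart_inv_chart[OF charts_atD[OF assms(1)]]
  by (simp add: smooth_near_differentiable)

lemma chart_deriv_self: "c \<in> charts_at A p \<Longrightarrow> chart_deriv c (snd c) p \<xi> = \<xi>"
proof -
  assume c: "c \<in> charts_at A p"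
  have "\<forall>\<^sub>F z in nhds (snd c p). snd c (chart_inv c z) = z"
    using eventually_in_image[OF c] by eventually_elim (simp add: chart_chart_inv)
  from frechet_derivative_cong[OF this] show ?thesis by (simp add: chart_deriv_def)
qed

lemma chart_deriv_change:
  assumes "c \<in> charts_at A p" "c' \<in> charts_at A p" "smooth_at A p f"
  shows "chart_deriv c' f p (coord_change_deriv c c' p \<xi>) = chart_deriv c f p \<xi>"
proof -
  have ev: "\<forall>\<^sub>F q in nhds p. f (chart_inv c' (snd c' q)) = f q"
    using eventually_in_chart[OF assms(2)] by eventually_elim (simp add: chart_inv_chart[OF charts_atD])
  have "chart_deriv c f p \<xi> = chart_deriv c (\<lambda>q. f (chart_inv c' (snd c' q))) p \<xi>"
    by (rule chart_deriv_cong[OF assms(1)]) (use ev in eventually_elim, simp)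
  also have "\<dots> = frechet_derivative (\<lambda>z. f (chart_inv c' z)) (at (snd c' p)) (chart_deriv c (snd c') p \<xi>)"
    by (rule chart_deriv_compose[OF assms(1) smooth_at_chart_map[OF assms(2)]])
      (use assms in \<open>simp add: smooth_at_def\<close>)
  finally show ?thesis by (simp add: coord_change_deriv_eq chart_deriv_def)
qed

lemma coord_change_deriv_cocycle:
  assumes "c \<in> charts_at A p" "c' \<in> charts_at A p" "c'' \<in> charts_at A p"
  shows "coord_change_deriv c' c'' p (coord_change_deriv c c' p \<xi>) = coord_change_deriv c c'' p \<xi>"
  using chart_deriv_change[OF assms(1,2) smooth_at_chart_map[OF assms(3)]]
  by (simp add: coord_change_deriv_eq)

lemma coord_change_deriv_linear:
  "c \<in> charts_at A p \<Longrightarrow> c' \<in> charts_at A p \<Longrightarrow> linear (coord_change_deriv c c' p)"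
  using chart_deriv_linear[of c p "snd c'"] smooth_at_chart_map[of c' p]
  by (simp add: coord_change_deriv_eq[abs_def])

lemma tvec_of_in_tangent_space: "c \<in> charts_at A p \<Longrightarrow> tvec_of A c p \<xi> \<in> tangent_space A p"
  by (simp add: tvec_of_def tangent_space_def coord_change_deriv_cocycle)

lemma tvec_of_same: "c \<in> charts_at A p \<Longrightarrow> tvec_of A c p \<xi> c = \<xi>"
  by (simp add: tvec_of_def coord_change_deriv_eq chart_deriv_self)

lemma tangent_space_change:
  "v \<in> tangent_space A p \<Longrightarrow> c \<in> charts_at A p \<Longrightarrow> c' \<in> charts_at A p \<Longrightarrow> v c' = coord_change_deriv c c' p (v c)"
  unfolding tangent_space_def by blast

lemma tangent_space_eq_tvec_of:
  "v \<in> tangent_space A p \<Longrightarrow> c \<in> charts_at A p \<Longrightarrow> v = tvec_of A c p (v c)"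
proof
  fix c' assume v: "v \<in> tangent_space A p" "c \<in> charts_at A p"
  show "v c' = tvec_of A c p (v c) c'"
  proof (cases "c' \<in> charts_at A p")
    case True
    then show ?thesis using tangent_space_change[OF v True] by (simp only: tvec_of_def if_True)
  next
    case False
    then have "v c' = 0" using v(1) unfolding tangent_space_def by blast
    then show ?thesis using False by (simp only: tvec_of_def if_False)
  qed
qed

lemma tvec_apply_eq:
  assumes "v \<in> tangent_space A p" "c \<in> charts_at A p" "smooth_at A p f"
  shows "tvec_apply A p v f = chart_deriv c f p (v c)"
proof -
  have "tvec_apply A p v f = chart_deriv (chart_at A p) f p (v (chart_at A p))"
    by (simp add: tvec_apply_def Let_def chart_deriv_def o_def)
  also have "\<dots> = chart_deriv c f p (v c)"
    unfolding tangent_space_change[OF assms(1,2) chart_at]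
    by (rule chart_deriv_change[OF assms(2) chart_at assms(3)])
  finally show ?thesis .
qed

subsection \<open>Cut-off functions\<close>

text \<open>A bump function in a chart is continued by \<open>0\<close>. The continuation is smooth because the image \<open>K\<close> of a
  ball of the model space is compact, and therefore closed in the whole manifold, which is Hausdorff.\<close>

lemma cutoff_function:
  assumes "open N" "p \<in> N"
  obtains \<phi> :: "'a \<Rightarrow> real" and K where "\<And>q. smooth_at A q \<phi>" "\<forall>\<^sub>F q in nhds p. \<phi> q = 1"
    "closed K" "K \<subseteq> N" "\<And>q. q \<notin> K \<Longrightarrow> \<phi> q = 0"
proof -
  obtain c where c: "c \<in> charts_at A p" using charts_at_nonempty by blast
  note cA = charts_atD[OF c]
  have "open (snd c ` (fst c \<inter> N))" "snd c p \<in> snd c ` (fst c \<inter> N)"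
    using open_chart_image[OF cA(1) assms(1)] cA assms(2) by auto
  then obtain r where r: "r > 0" "cball (snd c p) r \<subseteq> snd c ` (fst c \<inter> N)"
    unfolding open_contains_cball by blast
  obtain \<beta> :: "'v \<Rightarrow> real" where \<beta>: "\<And>z. smooth_near z \<beta>" "\<forall>\<^sub>F z in nhds (snd c p). \<beta> z = 1"
    "\<And>z. z \<notin> cball (snd c p) r \<Longrightarrow> \<beta> z = 0"
    using bump_function[OF r(1)] by blast
  define K where "K = chart_inv c ` cball (snd c p) r"
  define \<phi> where "\<phi> q = (if q \<in> fst c then \<beta> (snd c q) else 0)" for q
  have "compact K"
    unfolding K_def
  proof (rule compact_continuous_image[OF _ compact_cball_findim[OF findim_model]])
    show "continuous_on (cball (snd c p) r) (chart_inv c)"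
      using r(2) by (intro continuous_on_subset[OF homeomorphism_cont2[OF chart_homeo[OF cA(1)]]]) blast
  qed
  then have K: "closed K" by (rule compact_imp_closed)
  have KN: "K \<subseteq> fst c \<inter> N"
    unfolding K_def using r(2) chart_inv_chart[OF cA(1)] by auto
  have 0: "\<phi> q = 0" if "q \<notin> K" for q
  proof (cases "q \<in> fst c")
    case True
    have "snd c q \<notin> cball (snd c p) r"
    proof
      assume "snd c q \<in> cball (snd c p) r"
      then have "chart_inv c (snd c q) \<in> K" unfolding K_def by (rule imageI)
      with that show False by (simp add: chart_inv_chart[OF cA(1) True])
    qed
    then have "\<beta> (snd c q) = 0" by (rule \<beta>(3))
    then show ?thesis by (simp add: \<phi>_def)
  qed (simp add: \<phi>_def)
  have smooth: "smooth_at A q \<phi>" for q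
  proof (cases "q \<in> fst c")
    case True
    then have cq: "c \<in> charts_at A q" using cA by (simp add: charts_at_def)
    have "smooth_at A q (\<lambda>q. \<beta> (snd c q))"
      by (rule smooth_at_compose[OF findim_model smooth_at_chart_map[OF cq] \<beta>(1)])
    then show ?thesis
      by (rule smooth_at_cong) (use eventually_in_chart[OF cq] in \<open>eventually_elim, simp add: \<phi>_def charts_at_def\<close>)
  next
    case False
    then have "q \<in> - K" using KN by blast
    then have ev: "\<forall>\<^sub>F q' in nhds q. q' \<in> - K" using K by (intro eventually_nhds_in_open) auto
    show ?thesis
      by (rule smooth_at_cong[OF smooth_at_const[where k = 0]]) (use ev in \<open>eventually_elim, simp add: 0\<close>)
  qed
  have "\<forall>\<^sub>F q in nhds p. \<beta> (snd c q) = 1"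
    using \<beta>(2) filterlim_chart(1)[OF c] by (rule eventually_compose_filterlim)
  with eventually_in_chart[OF c] have "\<forall>\<^sub>F q in nhds p. \<phi> q = 1"
    by eventually_elim (simp add: \<phi>_def charts_at_def)
  then show ?thesis using that[OF smooth _ K _ 0] KN by blast
qed

text \<open>Multiplication with a cut-off function makes a germ global. The extension vanishes near, and not
  only at, every point outside \<open>N\<close>, so that it may be continued by \<open>0\<close> in a bundle trivial over \<open>N\<close>.\<close>

lemma smooth_extension:
  fixes f :: "'a \<Rightarrow> 'b::real_normed_vector"
  assumes "smooth_at A p f" "open N" "p \<in> N"
  obtains F :: "'a \<Rightarrow> 'b" where "\<forall>q. smooth_at A q F" "\<forall>\<^sub>F q in nhds p. F q = f q"
    "\<forall>q. q \<notin> N \<longrightarrow> (\<forall>\<^sub>F q' in nhds q. F q' = 0)"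
proof -
  obtain N' where N': "open N'" "p \<in> N'" "\<And>q. q \<in> N' \<Longrightarrow> smooth_at A q f"
    using smooth_at_eventually[OF assms(1)] unfolding eventually_nhds by blast
  have "\<exists>(\<phi> :: 'a \<Rightarrow> real) K. (\<forall>q. smooth_at A q \<phi>) \<and> (\<forall>\<^sub>F q in nhds p. \<phi> q = 1) \<and>
      closed K \<and> K \<subseteq> N \<inter> N' \<and> (\<forall>q. q \<notin> K \<longrightarrow> \<phi> q = 0)"
    by (rule cutoff_function[OF open_Int[OF assms(2) N'(1)] IntI[OF assms(3) N'(2)]]) blast
  then obtain \<phi> :: "'a \<Rightarrow> real" and K where \<phi>: "\<And>q. smooth_at A q \<phi>" "\<forall>\<^sub>F q in nhds p. \<phi> q = 1"
    "closed K" "K \<subseteq> N \<inter> N'" "\<And>q. q \<notin> K \<Longrightarrow> \<phi> q = 0"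
    by blast
  have zero: "\<forall>\<^sub>F q' in nhds q. \<phi> q' *\<^sub>R f q' = 0" if "q \<notin> K" for q
  proof -
    have "\<forall>\<^sub>F q' in nhds q. q' \<in> - K" using that \<phi>(3) by (intro eventually_nhds_in_open) auto
    then show ?thesis by eventually_elim (simp add: \<phi>(5))
  qed
  show ?thesis
  proof (rule that[of "\<lambda>q. \<phi> q *\<^sub>R f q"])
    show "\<forall>q. smooth_at A q (\<lambda>q. \<phi> q *\<^sub>R f q)"
    proof
      fix q show "smooth_at A q (\<lambda>q. \<phi> q *\<^sub>R f q)"
      proof (cases "q \<in> K")
      case True
      then show ?thesis using \<phi>(4) by (intro smooth_at_scaleR \<phi>(1) N'(3)) auto
    next
      case False
      show ?thesis
        by (rule smooth_at_cong[OF smooth_at_const[where k = 0]])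
          (use zero[OF False] in \<open>eventually_elim, simp\<close>)
      qed
    qed
  next
    show "\<forall>\<^sub>F q in nhds p. \<phi> q *\<^sub>R f q = f q" using \<phi>(2) by eventually_elim simp
  next
    show "\<forall>q. q \<notin> N \<longrightarrow> (\<forall>\<^sub>F q' in nhds q. \<phi> q' *\<^sub>R f q' = 0)" using \<phi>(4) zero by blast
  qed
qed

end

section \<open>Lie algebroids in adapted coordinates\<close>

definition around :: "('p, 'e, 'x, 'k) algebroid \<Rightarrow> 'p \<Rightarrow> ('p, 'e, 'x, 'k) adapted set" where
  "around G p = {c \<in> adapted G. p \<in> fst (fst c)}"

text \<open>The anchor in adapted coordinates, \<open>a \<mapsto> a\<^sup>\<alpha> \<sigma>\<^sub>\<alpha>\<close>, and the derivative \<open>a\<^sup>\<alpha> \<sigma>\<^sub>\<alpha>(f)\<close>.\<close>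

definition anc ::
  "('p, 'e, 'x, 'k::finite) algebroid \<Rightarrow> ('p, 'e, 'x, 'k) adapted \<Rightarrow> 'p \<Rightarrow> real^'k \<Rightarrow> 'x" where
  "anc G c p a = anchor G (fibre_elem G c p a) (fst c)"

definition base_deriv ::
  "('p, 'e, 'x::real_normed_vector, 'k::finite) algebroid \<Rightarrow> ('p, 'e, 'x, 'k) adapted \<Rightarrow>
   ('p \<Rightarrow> 'b::real_normed_vector) \<Rightarrow> 'p \<Rightarrow> real^'k \<Rightarrow> 'b" where
  "base_deriv G c f p a = chart_deriv (fst c) f p (anc G c p a)"

text \<open>The structure functions as the bilinear map \<open>(a, b) \<mapsto> a\<^sup>\<alpha> b\<^sup>\<beta> L\<^sub>\<alpha>\<^sub>\<beta>\<^sup>\<gamma>\<close>.\<close>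

definition struct ::
  "('p::topological_space, 'e, 'x::real_normed_vector, 'k::finite) algebroid \<Rightarrow>
   ('p, 'e, 'x, 'k) adapted \<Rightarrow> 'p \<Rightarrow> real^'k \<Rightarrow> real^'k \<Rightarrow> real^'k" where
  "struct G c p a b = (\<chi> \<gamma>. \<Sum>\<alpha>\<in>UNIV. \<Sum>\<beta>\<in>UNIV. a $ \<alpha> * b $ \<beta> * structure_fun G c \<alpha> \<beta> \<gamma> p)"

locale Lie_algebroid =
  fixes G :: "('p::{t2_space,second_countable_topology}, 'e::{t2_space,second_countable_topology},
    'x::real_inner, 'k::finite) algebroid"
  assumes lie_algebroid: "lie_algebroid G"
begin

lemma vector_bundle: "vector_bundle G"
  and anchor_axioms: "anchor_axioms G"
  and bracket_axioms: "bracket_axioms G"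
  using lie_algebroid unfolding lie_algebroid_def by blast+

sublocale M: manifold "base_atlas G"
  using vector_bundle by unfold_locales (simp add: vector_bundle_def)

sublocale E: manifold "total_atlas G"
  using vector_bundle by unfold_locales (simp add: vector_bundle_def)

abbreviation "smooth_M \<equiv> smooth_at (base_atlas G)"
abbreviation "smooth_E \<equiv> smooth_at (total_atlas G)"

subsection \<open>Fibre coordinates\<close>

lemma aroundD: "c \<in> around G p \<Longrightarrow> c \<in> adapted G" "c \<in> around G p \<Longrightarrow> p \<in> fst (fst c)"
  by (auto simp: around_def)

lemma around_base_chart: "c \<in> around G p \<Longrightarrow> fst c \<in> charts_at (base_atlas G) p"
  by (simp add: around_def charts_at_def base_atlas_def)

lemma base_chart_around: "d \<in> charts_at (base_atlas G) p \<Longrightarrow> \<exists>c\<in>around G p. fst c = d"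
  by (auto simp: around_def charts_at_def base_atlas_def)

lemma total_chart_at_iff: "c \<in> adapted G \<Longrightarrow>
    total_chart G c \<in> charts_at (total_atlas G) w \<longleftrightarrow> c \<in> around G (proj G w)"
  by (auto simp: around_def charts_at_def total_atlas_def total_chart_def)

lemma around_total_chart: "c \<in> around G (proj G w) \<Longrightarrow> total_chart G c \<in> charts_at (total_atlas G) w"
  using total_chart_at_iff aroundD(1) by blast

lemma around_nonempty: "\<exists>c. c \<in> around G p"
  using M.charts_at_nonempty base_chart_around by blast

lemma adapted_at: "adapted_at G p \<in> around G p"
proof -
  have "adapted_at G p = (SOME c. c \<in> around G p)" by (simp add: adapted_at_def around_def)
  then show ?thesis using someI_ex[OF around_nonempty[of p]] by simp
qed

lemma around_eventually:
  assumes "c \<in> around G p" shows "\<forall>\<^sub>F q in nhds p. c \<in> around G q"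
  using M.eventually_in_chart[OF around_base_chart[OF assms]]
  by eventually_elim (use assms in \<open>simp add: charts_at_def around_def\<close>)

lemma fibre_bij: "c \<in> around G p \<Longrightarrow> bij_betw (snd c) (proj G -` {p}) UNIV"
  using vector_bundle unfolding vector_bundle_def around_def by blast

lemma coord_inj: "c \<in> around G p \<Longrightarrow> proj G e = p \<Longrightarrow> proj G e' = p \<Longrightarrow> snd c e = snd c e' \<Longrightarrow> e = e'"
  by (rule inj_onD[OF bij_betw_imp_inj_on[OF fibre_bij]]) auto

lemma fibre_elem:
  assumes "c \<in> around G p"
  shows "proj G (fibre_elem G c p a) = p" "snd c (fibre_elem G c p a) = a"
proof -
  have "a \<in> snd c ` (proj G -` {p})" using fibre_bij[OF assms] by (simp add: bij_betw_def)
  then obtain e where e: "proj G e = p" "snd c e = a" by auto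
  have "\<exists>!e. proj G e = p \<and> snd c e = a"
    using e coord_inj[OF assms] by (intro ex1I[of _ e]) auto
  from theI'[OF this] show "proj G (fibre_elem G c p a) = p" "snd c (fibre_elem G c p a) = a"
    by (simp_all add: fibre_elem_def)
qed

lemma fibre_elem_coord: "c \<in> around G (proj G e) \<Longrightarrow> fibre_elem G c (proj G e) (snd c e) = e"
  using fibre_elem by (intro coord_inj[of c "proj G e"]) auto

lemma transition:
  assumes "c \<in> around G p" "c' \<in> around G p"
  obtains T :: "'p \<Rightarrow> real^'k^'k" where "smooth_M p T"
    "\<forall>\<^sub>F q in nhds p. \<forall>e. proj G e = q \<longrightarrow> snd c' e = T q *v snd c e"
proof -
  obtain T :: "'x \<Rightarrow> real^'k^'k" where
    T: "smooth_on (snd (fst c) ` (fst (fst c) \<inter> fst (fst c'))) T"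
    "\<And>w. proj G w \<in> fst (fst c) \<inter> fst (fst c') \<Longrightarrow> snd c' w = T (snd (fst c) (proj G w)) *v snd c w"
    using vector_bundle aroundD(1)[OF assms(1)] aroundD(1)[OF assms(2)]
    unfolding vector_bundle_def by blast
  note b = around_base_chart[OF assms(1)] and b' = around_base_chart[OF assms(2)]
  show ?thesis
  proof (rule that[of "\<lambda>q. T (snd (fst c) q)"])
    have "open (snd (fst c) ` (fst (fst c) \<inter> fst (fst c')))"
      by (intro M.open_chart_image M.chart_open M.charts_atD[OF b] M.charts_atD[OF b'])
    then have "smooth_near (snd (fst c) p) T"
      using T(1) aroundD(2)[OF assms(1)] aroundD(2)[OF assms(2)] smooth_on_iff_near by blast
    then show "smooth_M p (\<lambda>q. T (snd (fst c) q))"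
      by (rule M.smooth_at_compose[OF M.findim_model M.smooth_at_chart_map[OF b]])
    show "\<forall>\<^sub>F q in nhds p. \<forall>e. proj G e = q \<longrightarrow> snd c' e = T (snd (fst c) q) *v snd c e"
      using around_eventually[OF assms(1)] around_eventually[OF assms(2)]
      by eventually_elim (simp add: T(2) aroundD(2))
  qed
qed

lemma transition_linear:
  assumes "c \<in> around G p" "c' \<in> around G p"
  obtains T :: "real^'k^'k" where "\<And>e. proj G e = p \<Longrightarrow> snd c' e = T *v snd c e"
proof -
  obtain T :: "'p \<Rightarrow> real^'k^'k" where T: "smooth_M p T"
    "\<forall>\<^sub>F q in nhds p. \<forall>e. proj G e = q \<longrightarrow> snd c' e = T q *v snd c e"
    using transition[OF assms] by blast
  from eventually_nhds_x_imp_x[OF T(2)] show ?thesis by (intro that[of "T p"]) simp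
qed

lemma vb_zero: "proj G (vb_zero G p) = p" "c \<in> around G p \<Longrightarrow> snd c (vb_zero G p) = 0"
proof -
  show p: "proj G (vb_zero G p) = p" unfolding vb_zero_def by (rule fibre_elem(1)[OF adapted_at])
  assume c: "c \<in> around G p"
  obtain T :: "real^'k^'k" where "\<And>e. proj G e = p \<Longrightarrow> snd c e = T *v snd (adapted_at G p) e"
    using transition_linear[OF adapted_at c] by blast
  from this[OF p] show "snd c (vb_zero G p) = 0"
    using fibre_elem(2)[OF adapted_at, of p 0] by (simp add: vb_zero_def)
qed

lemma vb_add:
  assumes "proj G e = p" "proj G e' = p"
  shows "proj G (vb_add G e e') = p" "c \<in> around G p \<Longrightarrow> snd c (vb_add G e e') = snd c e + snd c e'"
proof -
  show p: "proj G (vb_add G e e') = p"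
    using assms fibre_elem(1)[OF adapted_at] by (simp add: vb_add_def Let_def)
  assume c: "c \<in> around G p"
  obtain T :: "real^'k^'k" where T: "\<And>e. proj G e = p \<Longrightarrow> snd c e = T *v snd (adapted_at G p) e"
    using transition_linear[OF adapted_at c] by blast
  have "snd (adapted_at G p) (vb_add G e e') = snd (adapted_at G p) e + snd (adapted_at G p) e'"
    using assms fibre_elem(2)[OF adapted_at] by (simp add: vb_add_def Let_def)
  then show "snd c (vb_add G e e') = snd c e + snd c e'"
    using T[OF p] T[OF assms(1)] T[OF assms(2)] by (simp add: matrix_vector_right_distrib)
qed

lemma vb_scale:
  assumes "proj G e = p"
  shows "proj G (vb_scale G r e) = p" "c \<in> around G p \<Longrightarrow> snd c (vb_scale G r e) = r *\<^sub>R snd c e"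
proof -
  show p: "proj G (vb_scale G r e) = p"
    using assms fibre_elem(1)[OF adapted_at] by (simp add: vb_scale_def Let_def)
  assume c: "c \<in> around G p"
  obtain T :: "real^'k^'k" where T: "\<And>e. proj G e = p \<Longrightarrow> snd c e = T *v snd (adapted_at G p) e"
    using transition_linear[OF adapted_at c] by blast
  have "snd (adapted_at G p) (vb_scale G r e) = r *\<^sub>R snd (adapted_at G p) e"
    using assms fibre_elem(2)[OF adapted_at] by (simp add: vb_scale_def Let_def)
  then show "snd c (vb_scale G r e) = r *\<^sub>R snd c e"
    using T[OF p] T[OF assms(1)] by (simp add: vec_eq_iff matrix_vector_mult_def sum_distrib_left algebra_simps)
qed

subsection \<open>Sections\<close>

lemma sections_iff:
  "s \<in> sections G \<longleftrightarrow> (\<forall>p. proj G (s p) = p) \<and> (\<forall>p. \<forall>c\<in>around G p. smooth_M p (\<lambda>q. snd c (s q)))"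
proof -
  have "mfd_smooth_on (base_atlas G) (fst (fst c)) (\<lambda>q. snd c (s q)) \<longleftrightarrow>
      (\<forall>p\<in>fst (fst c). smooth_M p (\<lambda>q. snd c (s q)))" if "c \<in> adapted G" for c
    using that by (intro M.mfd_smooth_on_iff M.chart_open) (simp add: base_atlas_def)
  then show ?thesis unfolding sections_def around_def by auto
qed

lemma section_proj [simp]: "s \<in> sections G \<Longrightarrow> proj G (s p) = p"
  and section_smooth: "s \<in> sections G \<Longrightarrow> c \<in> around G p \<Longrightarrow> smooth_M p (\<lambda>q. snd c (s q))"
  by (auto simp: sections_iff)

lemma coord_smooth_change:
  assumes "c \<in> around G p" "c' \<in> around G p" "\<And>q. proj G (s q) = q" "smooth_M p (\<lambda>q. snd c (s q))"
  shows "smooth_M p (\<lambda>q. snd c' (s q))"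
proof -
  obtain T :: "'p \<Rightarrow> real^'k^'k" where T: "smooth_M p T"
    "\<forall>\<^sub>F q in nhds p. \<forall>e. proj G e = q \<longrightarrow> snd c' e = T q *v snd c e"
    using transition[OF assms(1,2)] by blast
  show ?thesis
  proof (rule M.smooth_at_cong)
    show "smooth_M p (\<lambda>q. T q *v snd c (s q))" by (rule M.smooth_at_matrix_vector[OF T(1) assms(4)])
    show "\<forall>\<^sub>F q in nhds p. T q *v snd c (s q) = snd c' (s q)"
      using T(2) by eventually_elim (simp add: assms(3))
  qed
qed

lemma sec_add:
  assumes "s \<in> sections G" "t \<in> sections G"
  shows "sec_add G s t \<in> sections G"
    "c \<in> around G p \<Longrightarrow> snd c (sec_add G s t p) = snd c (s p) + snd c (t p)"
proof -
  show co: "snd c (sec_add G s t p) = snd c (s p) + snd c (t p)" if "c \<in> around G p" for c p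
    using that assms by (simp add: sec_add_def vb_add(2)[of _ p])
  show "sec_add G s t \<in> sections G"
    unfolding sections_iff
  proof (intro conjI allI ballI)
    fix p show "proj G (sec_add G s t p) = p" using assms by (simp add: sec_add_def vb_add(1)[of _ p])
  next
    fix p c assume c: "c \<in> around G p"
    show "smooth_M p (\<lambda>q. snd c (sec_add G s t q))"
      by (rule M.smooth_at_cong[OF M.smooth_at_add[OF section_smooth[OF assms(1) c] section_smooth[OF assms(2) c]]])
        (use around_eventually[OF c] in \<open>eventually_elim, simp add: co\<close>)
  qed
qed

lemma sec_scale:
  assumes "s \<in> sections G" "\<And>p. smooth_M p f"
  shows "sec_scale G f s \<in> sections G"
    "c \<in> around G p \<Longrightarrow> snd c (sec_scale G f s p) = f p *\<^sub>R snd c (s p)"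
proof -
  show co: "snd c (sec_scale G f s p) = f p *\<^sub>R snd c (s p)" if "c \<in> around G p" for c p
    using that assms by (simp add: sec_scale_def vb_scale(2)[of _ p])
  show "sec_scale G f s \<in> sections G"
    unfolding sections_iff
  proof (intro conjI allI ballI)
    fix p show "proj G (sec_scale G f s p) = p" using assms by (simp add: sec_scale_def vb_scale(1)[of _ p])
  next
    fix p c assume c: "c \<in> around G p"
    show "smooth_M p (\<lambda>q. snd c (sec_scale G f s q))"
      by (rule M.smooth_at_cong[OF M.smooth_at_scaleR[OF assms(2) section_smooth[OF assms(1) c]]])
        (use around_eventually[OF c] in \<open>eventually_elim, simp add: co\<close>)
  qed
qed

lemma section_eqI:
  "c \<in> around G p \<Longrightarrow> s \<in> sections G \<Longrightarrow> t \<in> sections G \<Longrightarrow> snd c (s p) = snd c (t p) \<Longrightarrow> s p = t p"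
  by (rule coord_inj[of c p]) auto

text \<open>A section given by its components in adapted coordinates, continued by zero. To be smooth it
  needs components that vanish near every point where the coordinates are not defined, which is
  \<open>supported_in\<close>; stated locally, this is visibly preserved by sums and multiples.\<close>

definition ext_sec :: "('p, 'e, 'x, 'k) adapted \<Rightarrow> ('p \<Rightarrow> real^'k) \<Rightarrow> 'p \<Rightarrow> 'e" where
  "ext_sec c \<tau> p = (if p \<in> fst (fst c) then fibre_elem G c p (\<tau> p) else vb_zero G p)"

definition supported_in :: "('p, 'e, 'x, 'k) adapted \<Rightarrow> ('p \<Rightarrow> real^'k) \<Rightarrow> bool" where
  "supported_in c \<tau> \<longleftrightarrow> (\<forall>q. smooth_M q \<tau>) \<and> (\<forall>q. q \<notin> fst (fst c) \<longrightarrow> (\<forall>\<^sub>F q' in nhds q. \<tau> q' = 0))"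

lemma ext_sec_coord: "c \<in> around G p \<Longrightarrow> snd c (ext_sec c \<tau> p) = \<tau> p"
  by (simp add: ext_sec_def aroundD fibre_elem)

lemma ext_sec:
  assumes "c \<in> adapted G" "supported_in c \<tau>"
  shows "ext_sec c \<tau> \<in> sections G"
proof -
  have p: "proj G (ext_sec c \<tau> q) = q" for q
    using assms(1) fibre_elem(1)[of c q] vb_zero(1) by (simp add: ext_sec_def around_def)
  have sm: "smooth_M q (\<lambda>q. snd c' (ext_sec c \<tau> q))" if c': "c' \<in> around G q" for q c'
  proof (cases "q \<in> fst (fst c)")
    case True
    then have c: "c \<in> around G q" using assms(1) by (simp add: around_def)
    have "smooth_M q (\<lambda>q. snd c (ext_sec c \<tau> q))"
    proof (rule M.smooth_at_cong)
      show "smooth_M q \<tau>" using assms(2) by (simp add: supported_in_def)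
      show "\<forall>\<^sub>F q' in nhds q. \<tau> q' = snd c (ext_sec c \<tau> q')"
        using around_eventually[OF c] by eventually_elim (simp add: ext_sec_coord)
    qed
    then show ?thesis by (rule coord_smooth_change[OF c c' p])
  next
    case False
    then have ev: "\<forall>\<^sub>F q' in nhds q. \<tau> q' = 0" using assms(2) by (simp add: supported_in_def)
    have "\<forall>\<^sub>F q' in nhds q. ext_sec c \<tau> q' = vb_zero G q'"
      using ev
    proof eventually_elim
      case (elim q')
      show ?case
      proof (cases "q' \<in> fst (fst c)")
        case True
        then have c: "c \<in> around G q'" using assms(1) by (simp add: around_def)
        show ?thesis
          by (rule coord_inj[OF c p vb_zero(1)]) (simp add: ext_sec_coord[OF c] vb_zero(2)[OF c] elim)
      qed (simp add: ext_sec_def)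
    qed
    with around_eventually[OF c'] have ev0: "\<forall>\<^sub>F q' in nhds q. 0 = snd c' (ext_sec c \<tau> q')"
      by eventually_elim (simp add: vb_zero)
    show ?thesis by (rule M.smooth_at_cong[OF M.smooth_at_const ev0])
  qed
  show ?thesis unfolding sections_iff by (intro conjI allI ballI p sm)
qed

lemma supported_extension:
  assumes "c \<in> around G p" "smooth_M p \<tau>"
  obtains \<tau>' where "supported_in c \<tau>'" "\<forall>\<^sub>F q in nhds p. \<tau>' q = \<tau> q"
proof -
  obtain F where "\<forall>q. smooth_M q F" "\<forall>\<^sub>F q in nhds p. F q = \<tau> q"
    "\<forall>q. q \<notin> fst (fst c) \<longrightarrow> (\<forall>\<^sub>F q' in nhds q. F q' = 0)"
    by (rule M.smooth_extension[OF assms(2) M.chart_open(1)[OF M.charts_atD(1)[OF around_base_chart[OF assms(1)]]]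
          aroundD(2)[OF assms(1)]], rule that)
  then show ?thesis by (intro that[of F]) (simp_all add: supported_in_def)
qed

lemma section_extension:
  assumes "c \<in> around G p" "smooth_M p \<tau>"
  obtains s where "s \<in> sections G" "\<forall>\<^sub>F q in nhds p. snd c (s q) = \<tau> q"
proof -
  obtain \<tau>' where t: "supported_in c \<tau>'" "\<forall>\<^sub>F q in nhds p. \<tau>' q = \<tau> q"
    using supported_extension[OF assms] by blast
  have "\<forall>\<^sub>F q in nhds p. snd c (ext_sec c \<tau>' q) = \<tau> q"
    using t(2) around_eventually[OF assms(1)] by eventually_elim (simp add: ext_sec_coord)
  with ext_sec[OF aroundD(1)[OF assms(1)] t(1)] show ?thesis using that by blast
qed

subsection \<open>The anchor\<close>

lemma anchor_tangent: "anchor G e \<in> tangent_space (base_atlas G) (proj G e)"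
  using anchor_axioms unfolding anchor_axioms_def by blast

lemma anchor_add: "proj G e = proj G e' \<Longrightarrow> anchor G (vb_add G e e') = (\<lambda>c. anchor G e c + anchor G e' c)"
  and anchor_scale: "anchor G (vb_scale G r e) = (\<lambda>c. r *\<^sub>R anchor G e c)"
  using anchor_axioms unfolding anchor_axioms_def by (elim conjE, simp)+

lemma anchor_coord: "c \<in> around G (proj G e) \<Longrightarrow> anchor G e (fst c) = anc G c (proj G e) (snd c e)"
  by (simp add: anc_def fibre_elem_coord)

lemma anc_linear:
  assumes "c \<in> around G p" shows "linear (anc G c p)"
proof
  fix a b :: "real^'k" and r :: real
  note f = fibre_elem[OF assms]
  have "fibre_elem G c p (a + b) = vb_add G (fibre_elem G c p a) (fibre_elem G c p b)"
    by (rule coord_inj[OF assms]) (simp_all add: f vb_add[OF f(1) f(1)] assms)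
  moreover have "proj G (fibre_elem G c p a) = proj G (fibre_elem G c p b)" by (simp add: f)
  ultimately show "anc G c p (a + b) = anc G c p a + anc G c p b"
    unfolding anc_def by (simp add: anchor_add)
  have "fibre_elem G c p (r *\<^sub>R a) = vb_scale G r (fibre_elem G c p a)"
    by (rule coord_inj[OF assms]) (simp_all add: f vb_scale[OF f(1)] assms)
  then show "anc G c p (r *\<^sub>R a) = r *\<^sub>R anc G c p a"
    unfolding anc_def by (simp add: anchor_scale)
qed

lemma total_chart_simps:
  "fst (total_chart G c) = proj G -` fst (fst c)"
  "snd (total_chart G c) w = (snd (fst c) (proj G w), snd c w)"
  by (simp_all add: total_chart_def)

lemma chart_inv_total:
  assumes "c \<in> around G p"
  shows "chart_inv (total_chart G c) (snd (fst c) p, a) = fibre_elem G c p a"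
proof -
  have c: "c \<in> around G (proj G (fibre_elem G c p a))" using assms by (simp add: fibre_elem)
  show ?thesis
    using E.chart_inv_chart[OF E.charts_atD[OF around_total_chart[OF c]]]
    by (simp add: fibre_elem[OF assms] total_chart_simps(2))
qed

lemma smooth_near_anchor:
  assumes "c \<in> around G p"
  shows "smooth_near (snd (fst c) p, a) (\<lambda>z. anchor G (chart_inv (total_chart G c) z) (fst c))"
proof -
  let ?w = "fibre_elem G c p a"
  have c: "c \<in> around G (proj G ?w)" using assms by (simp add: fibre_elem)
  note tc = around_total_chart[OF c]
  have "open (proj G -` fst (fst c))" using E.chart_open(1)[OF E.charts_atD(1)[OF tc]] by (simp add: total_chart_simps)
  moreover have "mfd_smooth_on (total_atlas G) (proj G -` fst (fst c)) (\<lambda>e. anchor G e (fst c))"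
    using anchor_axioms aroundD(1)[OF c] unfolding anchor_axioms_def by blast
  ultimately have "smooth_E ?w (\<lambda>e. anchor G e (fst c))"
    using E.mfd_smooth_on_iff aroundD(2)[OF c] by blast
  then show ?thesis using tc fibre_elem[OF assms] by (auto simp: smooth_at_def total_chart_simps(2))
qed

text \<open>The anchor is smooth on \<open>E\<close>, so its components along a local section are smooth on \<open>M\<close>.\<close>

lemma smooth_M_anc:
  assumes "c \<in> around G p" "smooth_M p a"
  shows "smooth_M p (\<lambda>q. anc G c q (a q))"
proof (rule M.smooth_at_cong)
  show "smooth_M p (\<lambda>q. anchor G (chart_inv (total_chart G c) (snd (fst c) q, a q)) (fst c))"
    by (rule M.smooth_at_compose[OF E.findim_model
          M.smooth_at_Pair[OF M.smooth_at_chart_map[OF around_base_chart[OF assms(1)]] assms(2)]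
          smooth_near_anchor[OF assms(1)]])
  show "\<forall>\<^sub>F q in nhds p. anchor G (chart_inv (total_chart G c) (snd (fst c) q, a q)) (fst c) = anc G c q (a q)"
    using around_eventually[OF assms(1)] by eventually_elim (simp only: chart_inv_total anc_def)
qed

lemma base_deriv_linear: "c \<in> around G p \<Longrightarrow> smooth_M p f \<Longrightarrow> linear (base_deriv G c f p)"
  unfolding base_deriv_def
  using linear_compose[OF anc_linear M.chart_deriv_linear[OF around_base_chart]] by (simp add: o_def)

lemma base_deriv_cong:
  "c \<in> around G p \<Longrightarrow> \<forall>\<^sub>F q in nhds p. f q = g q \<Longrightarrow> base_deriv G c f p a = base_deriv G c g p a"
  unfolding base_deriv_def by (rule M.chart_deriv_cong[OF around_base_chart])

lemma base_deriv_const [simp]: "base_deriv G c (\<lambda>_. k) p a = 0"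
  by (simp add: base_deriv_def)

lemma base_deriv_change:
  assumes "c \<in> around G (proj G e)" "c' \<in> around G (proj G e)" "smooth_M (proj G e) f"
  shows "base_deriv G c f (proj G e) (snd c e) = base_deriv G c' f (proj G e) (snd c' e)"
  unfolding base_deriv_def anchor_coord[OF assms(1), symmetric] anchor_coord[OF assms(2), symmetric]
    M.tangent_space_change[OF anchor_tangent around_base_chart[OF assms(1)] around_base_chart[OF assms(2)]]
  by (rule M.chart_deriv_change[OF around_base_chart[OF assms(1)] around_base_chart[OF assms(2)] assms(3), symmetric])

lemma anchor_apply_coord:
  assumes "s \<in> sections G" "c \<in> around G p" "smooth_M p f"
  shows "anchor_apply G s f p = base_deriv G c f p (snd c (s p))"
  unfolding anchor_apply_def base_deriv_def
  using M.tvec_apply_eq[OF _ around_base_chart[OF assms(2)] assms(3)] anchor_tangent[of "s p"]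
    anchor_coord[of c "s p"] assms(1,2) by simp

lemma smooth_M_base_deriv:
  assumes "c \<in> around G p" "smooth_M p f" "smooth_M p a"
  shows "smooth_M p (\<lambda>q. base_deriv G c f q (a q))"
proof -
  note b = around_base_chart[OF assms(1)]
  have "smooth_near (snd (fst c) p) (\<lambda>z. frechet_derivative (\<lambda>z. f (chart_inv (fst c) z)) (at z)
      (anc G c (chart_inv (fst c) z) (a (chart_inv (fst c) z))))"
    by (rule smooth_near_derivative_along[OF M.findim_model])
      (use assms(2) smooth_M_anc[OF assms(1,3)] b in \<open>auto simp: smooth_at_def\<close>)
  moreover have "\<forall>\<^sub>F z in nhds (snd (fst c) p). frechet_derivative (\<lambda>z. f (chart_inv (fst c) z)) (at z)
      (anc G c (chart_inv (fst c) z) (a (chart_inv (fst c) z))) =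
      base_deriv G c f (chart_inv (fst c) z) (a (chart_inv (fst c) z))"
    using M.eventually_in_image[OF b]
    by eventually_elim (simp add: base_deriv_def chart_deriv_def M.chart_chart_inv)
  ultimately show ?thesis
    unfolding M.smooth_at_chart[OF b] by (rule smooth_near_cong)
qed

subsection \<open>The bracket in coordinates\<close>

lemma bracket_closed: "s \<in> sections G \<Longrightarrow> t \<in> sections G \<Longrightarrow> bracket G s t \<in> sections G"
  by (rule bracket_axioms[unfolded bracket_axioms_def, THEN conjunct1, rule_format])

lemma bracket_antisym:
  assumes "s \<in> sections G" "t \<in> sections G" "c \<in> around G p"
  shows "snd c (bracket G s t p) = - snd c (bracket G t s p)"
proof -
  have "bracket G s t = sec_scale G (\<lambda>_. - 1) (bracket G t s)"
    by (rule bracket_axioms[unfolded bracket_axioms_def, THEN conjunct2, THEN conjunct2, THEN conjunct2,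
          THEN conjunct1, rule_format, OF assms(1,2)])
  then show ?thesis
    using sec_scale(2)[OF bracket_closed[OF assms(2,1)] M.smooth_at_const assms(3), of "- 1"] by simp
qed

lemma bracket_add:
  assumes "s \<in> sections G" "t \<in> sections G" "t' \<in> sections G" "c \<in> around G p"
  shows "snd c (bracket G s (sec_add G t t') p) = snd c (bracket G s t p) + snd c (bracket G s t' p)"
proof -
  have "bracket G (sec_add G t t') s = sec_add G (bracket G t s) (bracket G t' s)"
    by (rule bracket_axioms[unfolded bracket_axioms_def, THEN conjunct2, THEN conjunct1, rule_format,
          OF assms(2,3,1)])
  then have "snd c (bracket G (sec_add G t t') s p) = snd c (bracket G t s p) + snd c (bracket G t' s p)"
    using sec_add(2)[OF bracket_closed bracket_closed] assms by simp
  then show ?thesis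
    using bracket_antisym[OF assms(1) sec_add(1)[OF assms(2,3)] assms(4)]
      bracket_antisym[OF assms(1,2,4)] bracket_antisym[OF assms(1,3,4)] by simp
qed

lemma anchor_apply_smooth:
  assumes "s \<in> sections G" "smooth_M p f" shows "smooth_M p (anchor_apply G s f)"
proof -
  obtain c where c: "c \<in> around G p" using around_nonempty by blast
  show ?thesis
  proof (rule M.smooth_at_cong)
    show "smooth_M p (\<lambda>q. base_deriv G c f q (snd c (s q)))"
      by (rule smooth_M_base_deriv[OF c assms(2) section_smooth[OF assms(1) c]])
    show "\<forall>\<^sub>F q in nhds p. base_deriv G c f q (snd c (s q)) = anchor_apply G s f q"
      using around_eventually[OF c] M.smooth_at_eventually[OF assms(2)]
      by eventually_elim (simp add: anchor_apply_coord[OF assms(1)])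
  qed
qed

lemma bracket_scale:
  assumes "s \<in> sections G" "t \<in> sections G" "\<And>q. smooth_M q f" "c \<in> around G p"
  shows "snd c (bracket G s (sec_scale G f t) p) =
    f p *\<^sub>R snd c (bracket G s t p) + base_deriv G c f p (snd c (s p)) *\<^sub>R snd c (t p)"
proof -
  have "mfd_smooth_on (base_atlas G) UNIV f" using assms(3) by (simp add: M.mfd_smooth_on_iff)
  then have e: "bracket G s (sec_scale G f t) =
      sec_add G (sec_scale G f (bracket G s t)) (sec_scale G (anchor_apply G s f) t)"
    by (rule lie_algebroid[unfolded lie_algebroid_def, THEN conjunct2, THEN conjunct2, THEN conjunct2,
          THEN conjunct2, rule_format, OF assms(1,2)])
  have a: "smooth_M q (anchor_apply G s f)" for q by (rule anchor_apply_smooth[OF assms(1,3)])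
  note b = bracket_closed[OF assms(1,2)]
  show ?thesis
    unfolding e sec_add(2)[OF sec_scale(1)[OF b assms(3)] sec_scale(1)[OF assms(2) a] assms(4)]
      sec_scale(2)[OF b assms(3,4)] sec_scale(2)[OF assms(2) a assms(4)]
      anchor_apply_coord[OF assms(1,4,3)] ..
qed

text \<open>If \<open>t\<close> and \<open>t'\<close> agree near \<open>p\<close> then \<open>F t = F t'\<close> for a cut-off function \<open>F\<close>, and by the Leibniz rule
  multiplication with \<open>F\<close> does not change the bracket at \<open>p\<close>, where \<open>F = 1\<close> and \<open>dF = 0\<close>.\<close>

lemma bracket_local:
  assumes "s \<in> sections G" "t \<in> sections G" "t' \<in> sections G" "\<forall>\<^sub>F q in nhds p. t q = t' q"
  shows "bracket G s t p = bracket G s t' p"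
proof -
  obtain N where N: "open N" "p \<in> N" "\<And>q. q \<in> N \<Longrightarrow> t q = t' q"
    using assms(4) unfolding eventually_nhds by blast
  obtain F :: "'p \<Rightarrow> real" where F: "\<forall>q. smooth_M q F" "\<forall>\<^sub>F q in nhds p. F q = 1"
    "\<forall>q. q \<notin> N \<longrightarrow> (\<forall>\<^sub>F q' in nhds q. F q' = 0)"
    by (rule M.smooth_extension[OF M.smooth_at_const[where k = 1] N(1,2)], rule that)
  have sm: "smooth_M q F" for q using F(1) by blast
  have eq: "sec_scale G F t = sec_scale G F t'"
  proof
    fix q
    obtain c where c: "c \<in> around G q" using around_nonempty by blast
    show "sec_scale G F t q = sec_scale G F t' q"
    proof (cases "q \<in> N")
      case True
      then show ?thesis by (simp add: sec_scale_def N(3))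
    next
      case False
      then have "F q = 0" using F(3) eventually_nhds_x_imp_x by blast
      then show ?thesis
        using c by (intro section_eqI[OF c sec_scale(1)[OF assms(2) sm] sec_scale(1)[OF assms(3) sm]])
          (simp add: sec_scale(2)[OF assms(2) sm] sec_scale(2)[OF assms(3) sm])
    qed
  qed
  obtain c where c: "c \<in> around G p" using around_nonempty by blast
  have 1: "F p = 1" using eventually_nhds_x_imp_x[OF F(2)] .
  have 0: "base_deriv G c F p a = 0" for a
    using base_deriv_cong[OF c F(2), of a] by simp
  have "snd c (bracket G s (sec_scale G F u) p) = snd c (bracket G s u p)" if "u \<in> sections G" for u
    using bracket_scale[OF assms(1) that sm c] by (simp add: 0 1)
  from this[OF assms(2)] this[OF assms(3)] show ?thesis
    by (intro section_eqI[OF c bracket_closed[OF assms(1,2)] bracket_closed[OF assms(1,3)]]) (simp add: eq)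
qed

lemma bracket_local':
  assumes "s \<in> sections G" "s' \<in> sections G" "t \<in> sections G" "t' \<in> sections G"
    and "\<forall>\<^sub>F q in nhds p. s q = s' q" "\<forall>\<^sub>F q in nhds p. t q = t' q"
  shows "bracket G s t p = bracket G s' t' p"
proof -
  obtain c where c: "c \<in> around G p" using around_nonempty by blast
  have "snd c (bracket G s t' p) = snd c (bracket G s' t' p)"
    using bracket_antisym[OF assms(1,4) c] bracket_antisym[OF assms(2,4) c]
      bracket_local[OF assms(4,1,2,5)] by simp
  then have "bracket G s t' p = bracket G s' t' p"
    by (rule section_eqI[OF c bracket_closed[OF assms(1,4)] bracket_closed[OF assms(2,4)]])
  then show ?thesis using bracket_local[OF assms(1,3,4,6)] by simp
qed

lemma coord_eventually_eq:
  assumes "c \<in> around G p" "s \<in> sections G" "t \<in> sections G" "\<forall>\<^sub>F q in nhds p. snd c (s q) = snd c (t q)"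
  shows "\<forall>\<^sub>F q in nhds p. s q = t q"
  using assms(4) around_eventually[OF assms(1)]
  by eventually_elim (rule section_eqI[OF _ assms(2,3)])

lemma supported_in_add: "supported_in c \<sigma> \<Longrightarrow> supported_in c \<tau> \<Longrightarrow> supported_in c (\<lambda>q. \<sigma> q + \<tau> q)"
  unfolding supported_in_def
proof (elim conjE, intro conjI allI impI M.smooth_at_add)
  fix q
  assume "\<forall>q. q \<notin> fst (fst c) \<longrightarrow> (\<forall>\<^sub>F q' in nhds q. \<sigma> q' = 0)"
    "\<forall>q. q \<notin> fst (fst c) \<longrightarrow> (\<forall>\<^sub>F q' in nhds q. \<tau> q' = 0)" "q \<notin> fst (fst c)"
  then have "\<forall>\<^sub>F q' in nhds q. \<sigma> q' = 0" "\<forall>\<^sub>F q' in nhds q. \<tau> q' = 0" by blast+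
  then show "\<forall>\<^sub>F q' in nhds q. \<sigma> q' + \<tau> q' = 0" by eventually_elim simp
qed auto

lemma supported_in_scale: "(\<And>q. smooth_M q f) \<Longrightarrow> supported_in c \<tau> \<Longrightarrow> supported_in c (\<lambda>q. f q *\<^sub>R \<tau> q)"
  unfolding supported_in_def
proof (elim conjE, intro conjI allI impI M.smooth_at_scaleR)
  fix q
  assume "\<forall>q. q \<notin> fst (fst c) \<longrightarrow> (\<forall>\<^sub>F q' in nhds q. \<tau> q' = 0)" "q \<notin> fst (fst c)"
  then have "\<forall>\<^sub>F q' in nhds q. \<tau> q' = 0" by blast
  then show "\<forall>\<^sub>F q' in nhds q. f q' *\<^sub>R \<tau> q' = 0" by eventually_elim simp
qed auto

lemma ext_sec_add:
  assumes "c \<in> adapted G" "supported_in c \<sigma>" "supported_in c \<tau>"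
  shows "ext_sec c (\<lambda>q. \<sigma> q + \<tau> q) = sec_add G (ext_sec c \<sigma>) (ext_sec c \<tau>)"
proof
  fix q
  note s = ext_sec[OF assms(1,2)] and t = ext_sec[OF assms(1,3)]
  note st = ext_sec[OF assms(1) supported_in_add[OF assms(2,3)]]
  show "ext_sec c (\<lambda>q. \<sigma> q + \<tau> q) q = sec_add G (ext_sec c \<sigma>) (ext_sec c \<tau>) q"
  proof (cases "q \<in> fst (fst c)")
    case True
    then have c: "c \<in> around G q" using assms(1) by (simp add: around_def)
    show ?thesis
      by (rule section_eqI[OF c st sec_add(1)[OF s t]]) (simp add: sec_add(2)[OF s t c] ext_sec_coord[OF c])
  next
    case False
    obtain d where d: "d \<in> around G q" using around_nonempty by blast
    show ?thesis
      by (rule section_eqI[OF d st sec_add(1)[OF s t]]) (simp add: sec_add(2)[OF s t d] ext_sec_def False vb_zero d)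
  qed
qed

lemma ext_sec_scale:
  assumes "c \<in> adapted G" "\<And>q. smooth_M q f" "supported_in c \<tau>"
  shows "ext_sec c (\<lambda>q. f q *\<^sub>R \<tau> q) = sec_scale G f (ext_sec c \<tau>)"
proof
  fix q
  note t = ext_sec[OF assms(1,3)]
  note st = ext_sec[OF assms(1) supported_in_scale[OF assms(2,3)]]
  show "ext_sec c (\<lambda>q. f q *\<^sub>R \<tau> q) q = sec_scale G f (ext_sec c \<tau>) q"
  proof (cases "q \<in> fst (fst c)")
    case True
    then have c: "c \<in> around G q" using assms(1) by (simp add: around_def)
    show ?thesis
      by (rule section_eqI[OF c st sec_scale(1)[OF t assms(2)]])
        (simp add: sec_scale(2)[OF t assms(2) c] ext_sec_coord[OF c])
  next
    case False
    obtain d where d: "d \<in> around G q" using around_nonempty by blast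
    show ?thesis
      by (rule section_eqI[OF d st sec_scale(1)[OF t assms(2)]])
        (simp add: sec_scale(2)[OF t assms(2) d] ext_sec_def False vb_zero d)
  qed
qed

text \<open>By locality, a section may be replaced near \<open>p\<close> by a combination of cut-off frame sections
  with globally defined coefficients, to which the Leibniz rule applies.\<close>

lemma bracket_frame:
  assumes c: "c \<in> around G p"
  obtains e :: "'k \<Rightarrow> 'p \<Rightarrow> 'e" where "\<forall>\<beta>. e \<beta> \<in> sections G" "\<forall>\<beta>. \<forall>\<^sub>F q in nhds p. snd c (e \<beta> q) = axis \<beta> 1"
    "\<forall>s\<in>sections G. \<forall>t\<in>sections G. snd c (bracket G s t p) =
      (\<Sum>\<beta>\<in>UNIV. snd c (t p) $ \<beta> *\<^sub>R snd c (bracket G s (e \<beta>) p)) +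
      base_deriv G c (\<lambda>q. snd c (t q)) p (snd c (s p))"
proof -
  note cA = aroundD(1)[OF c]
  have "\<exists>\<tau>. supported_in c \<tau> \<and> (\<forall>\<^sub>F q in nhds p. \<tau> q = axis \<beta> 1)" for \<beta>
    by (rule supported_extension[OF c M.smooth_at_const[where k = "axis \<beta> 1"]]) blast
  then obtain \<tau> where \<tau>: "\<And>\<beta>. supported_in c (\<tau> \<beta>)" "\<And>\<beta>. \<forall>\<^sub>F q in nhds p. \<tau> \<beta> q = axis \<beta> 1"
    by metis
  have \<tau>p: "\<tau> \<beta> p = axis \<beta> 1" for \<beta> using eventually_nhds_x_imp_x[OF \<tau>(2)] .
  define e where "e \<beta> = ext_sec c (\<tau> \<beta>)" for \<beta>
  have e: "e \<beta> \<in> sections G" for \<beta> unfolding e_def by (rule ext_sec[OF cA \<tau>(1)])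
  have e_coord: "\<forall>\<^sub>F q in nhds p. snd c (e \<beta> q) = axis \<beta> 1" for \<beta>
    using \<tau>(2)[of \<beta>] around_eventually[OF c] by eventually_elim (simp add: e_def ext_sec_coord)
  have supp: "supported_in c (\<lambda>q. \<Sum>\<beta>\<in>I. g \<beta> q *\<^sub>R \<tau> \<beta> q)" if "finite I" "\<And>\<beta> q. smooth_M q (g \<beta>)" for I g
    using that(1)
  proof induction
    case empty show ?case by (simp add: supported_in_def)
  next
    case (insert \<beta> I)
    then show ?case
      using supported_in_add[OF supported_in_scale[OF that(2) \<tau>(1)] insert.IH] by simp
  qed
  have lin: "snd c (bracket G s (ext_sec c (\<lambda>q. \<Sum>\<beta>\<in>I. g \<beta> q *\<^sub>R \<tau> \<beta> q)) p) =
      (\<Sum>\<beta>\<in>I. g \<beta> p *\<^sub>R snd c (bracket G s (e \<beta>) p) + base_deriv G c (g \<beta>) p (snd c (s p)) *\<^sub>R axis \<beta> 1)"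
    if "finite I" "s \<in> sections G" "\<And>\<beta> q. smooth_M q (g \<beta>)" for I s g
    using that(1)
  proof induction
    case empty
    have s0: "supported_in c (\<lambda>q. 0)" by (simp add: supported_in_def)
    have "snd c (bracket G s (ext_sec c (\<lambda>q. 0 *\<^sub>R 0)) p) = 0"
      unfolding ext_sec_scale[OF cA M.smooth_at_const s0]
      using bracket_scale[OF that(2) ext_sec[OF cA s0] M.smooth_at_const c, of 0] by simp
    then show ?case by simp
  next
    case (insert \<beta> I)
    note 1 = supported_in_scale[OF that(3) \<tau>(1), of \<beta> \<beta>] and 2 = supp[OF insert(1) that(3)]
    have "snd c (bracket G s (ext_sec c (\<lambda>q. \<Sum>\<beta>\<in>insert \<beta> I. g \<beta> q *\<^sub>R \<tau> \<beta> q)) p) =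
        snd c (bracket G s (sec_add G (sec_scale G (g \<beta>) (e \<beta>)) (ext_sec c (\<lambda>q. \<Sum>\<beta>\<in>I. g \<beta> q *\<^sub>R \<tau> \<beta> q))) p)"
      using insert(1,2) by (simp add: ext_sec_add[OF cA 1 2] ext_sec_scale[OF cA that(3) \<tau>(1)] e_def)
    also have "\<dots> = snd c (bracket G s (sec_scale G (g \<beta>) (e \<beta>)) p) +
        snd c (bracket G s (ext_sec c (\<lambda>q. \<Sum>\<beta>\<in>I. g \<beta> q *\<^sub>R \<tau> \<beta> q)) p)"
      by (rule bracket_add[OF that(2) sec_scale(1)[OF e that(3)] ext_sec[OF cA 2] c])
    also have "snd c (bracket G s (sec_scale G (g \<beta>) (e \<beta>)) p) =
        g \<beta> p *\<^sub>R snd c (bracket G s (e \<beta>) p) + base_deriv G c (g \<beta>) p (snd c (s p)) *\<^sub>R axis \<beta> 1"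
      using bracket_scale[OF that(2) e that(3) c, of \<beta> \<beta>] eventually_nhds_x_imp_x[OF e_coord[of \<beta>]] by simp
    finally show ?case using insert by simp
  qed
  have main: "snd c (bracket G s t p) = (\<Sum>\<beta>\<in>UNIV. snd c (t p) $ \<beta> *\<^sub>R snd c (bracket G s (e \<beta>) p)) +
      base_deriv G c (\<lambda>q. snd c (t q)) p (snd c (s p))" if s: "s \<in> sections G" and t: "t \<in> sections G" for s t
  proof -
    note tc = section_smooth[OF t c]
    have "\<exists>g. (\<forall>q. smooth_M q g) \<and> (\<forall>\<^sub>F q in nhds p. g q = snd c (t q) $ \<beta>)" for \<beta>
      by (rule M.smooth_extension[OF M.smooth_at_vec_nth[OF tc, of \<beta>] open_UNIV UNIV_I]) blast
    then obtain g where g0: "\<forall>\<beta>. (\<forall>q. smooth_M q (g \<beta>)) \<and> (\<forall>\<^sub>F q in nhds p. g \<beta> q = snd c (t q) $ \<beta>)"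
      using choice[of "\<lambda>\<beta> g. (\<forall>q. smooth_M q g) \<and> (\<forall>\<^sub>F q in nhds p. g q = snd c (t q) $ \<beta>)"] by blast
    have g: "\<And>\<beta> q. smooth_M q (g \<beta>)" "\<And>\<beta>. \<forall>\<^sub>F q in nhds p. g \<beta> q = snd c (t q) $ \<beta>"
      using g0 by blast+
    let ?t = "ext_sec c (\<lambda>q. \<Sum>\<beta>\<in>UNIV. g \<beta> q *\<^sub>R \<tau> \<beta> q)"
    have t': "?t \<in> sections G" by (rule ext_sec[OF cA supp[OF finite g(1)]])
    have "\<forall>\<^sub>F q in nhds p. \<forall>\<beta>. \<tau> \<beta> q = axis \<beta> 1 \<and> g \<beta> q = snd c (t q) $ \<beta>"
      by (intro eventually_all_finite eventually_conj \<tau>(2) g(2))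
    then have "\<forall>\<^sub>F q in nhds p. snd c (t q) = snd c (?t q)"
      using around_eventually[OF c]
    proof eventually_elim
      case (elim q)
      have "(\<Sum>\<beta>\<in>UNIV. snd c (t q) $ \<beta> *\<^sub>R axis \<beta> 1) = snd c (t q)"
        using basis_expansion[of "snd c (t q)"] by (simp add: scalar_mult_eq_scaleR)
      then show ?case using elim by (simp add: ext_sec_coord)
    qed
    from bracket_local[OF s t t' coord_eventually_eq[OF c t t' this]]
    have "snd c (bracket G s t p) = (\<Sum>\<beta>\<in>UNIV. g \<beta> p *\<^sub>R snd c (bracket G s (e \<beta>) p) +
        base_deriv G c (g \<beta>) p (snd c (s p)) *\<^sub>R axis \<beta> 1)"
      by (simp add: lin[OF finite s g(1)])
    also have "\<dots> = (\<Sum>\<beta>\<in>UNIV. snd c (t p) $ \<beta> *\<^sub>R snd c (bracket G s (e \<beta>) p)) +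
        (\<Sum>\<beta>\<in>UNIV. base_deriv G c (\<lambda>q. snd c (t q)) p (snd c (s p)) $ \<beta> *\<^sub>R axis \<beta> 1)"
    proof -
      have "base_deriv G c (g \<beta>) p a = base_deriv G c (\<lambda>q. snd c (t q)) p a $ \<beta>" for \<beta> a
        using base_deriv_cong[OF c g(2)] M.chart_deriv_bl[OF bounded_linear_vec_nth around_base_chart[OF c] tc]
        by (simp add: base_deriv_def)
      then show ?thesis
        by (simp add: sum.distrib eventually_nhds_x_imp_x[OF g(2)])
    qed
    also have "(\<Sum>\<beta>\<in>UNIV. base_deriv G c (\<lambda>q. snd c (t q)) p (snd c (s p)) $ \<beta> *\<^sub>R axis \<beta> 1) =
        base_deriv G c (\<lambda>q. snd c (t q)) p (snd c (s p))"
      using basis_expansion[of "base_deriv G c (\<lambda>q. snd c (t q)) p (snd c (s p))"]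
      by (simp add: scalar_mult_eq_scaleR)
    finally show ?thesis .
  qed
  show ?thesis
    by (rule that[of e]) (intro allI ballI e e_coord main)+
qed

lemma sum_axis_linear:
  fixes h :: "real^'k \<Rightarrow> 'b::real_vector"
  assumes "linear h" shows "(\<Sum>\<beta>\<in>UNIV. a $ \<beta> *\<^sub>R h (axis \<beta> 1)) = h a"
proof -
  have "h a = h (\<Sum>\<beta>\<in>UNIV. a $ \<beta> *\<^sub>R axis \<beta> 1)"
    using basis_expansion[of a] by (simp add: scalar_mult_eq_scaleR)
  then show ?thesis by (simp add: linear_sum[OF assms] linear_scale[OF assms])
qed

lemma local_bracket_eq:
  assumes "s' \<in> sections G" "t' \<in> sections G" "\<forall>\<^sub>F q in nhds p. s' q = s q" "\<forall>\<^sub>F q in nhds p. t' q = t q"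
  shows "local_bracket G s t p = bracket G s' t' p"
  unfolding local_bracket_def
proof (rule the_equality)
  show "\<exists>s''\<in>sections G. \<exists>t''\<in>sections G. (\<forall>\<^sub>F q in nhds p. s'' q = s q) \<and> (\<forall>\<^sub>F q in nhds p. t'' q = t q) \<and>
      bracket G s' t' p = bracket G s'' t'' p"
    by (intro bexI[of _ s'] bexI[of _ t'] conjI refl assms)
  fix e
  assume "\<exists>s''\<in>sections G. \<exists>t''\<in>sections G. (\<forall>\<^sub>F q in nhds p. s'' q = s q) \<and> (\<forall>\<^sub>F q in nhds p. t'' q = t q) \<and>
      e = bracket G s'' t'' p"
  then obtain s'' t'' where 1: "s'' \<in> sections G" "t'' \<in> sections G" and 2: "\<forall>\<^sub>F q in nhds p. s'' q = s q"
    and 3: "\<forall>\<^sub>F q in nhds p. t'' q = t q" and e: "e = bracket G s'' t'' p" by (elim bexE conjE)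
  have "\<forall>\<^sub>F q in nhds p. s'' q = s' q" using 2 assms(3) by eventually_elim simp
  moreover have "\<forall>\<^sub>F q in nhds p. t'' q = t' q" using 3 assms(4) by eventually_elim simp
  ultimately show "e = bracket G s' t' p"
    unfolding e by (rule bracket_local'[OF 1(1) assms(1) 1(2) assms(2)])
qed

lemma structure_fun_eq:
  assumes "c \<in> around G p" "s \<in> sections G" "t \<in> sections G"
    and "\<forall>\<^sub>F q in nhds p. snd c (s q) = axis \<alpha> 1" "\<forall>\<^sub>F q in nhds p. snd c (t q) = axis \<beta> 1"
  shows "structure_fun G c \<alpha> \<beta> \<gamma> p = snd c (bracket G s t p) $ \<gamma>"
proof -
  have b: "\<forall>\<^sub>F q in nhds p. u q = local_basis G c \<delta> q"
    if "u \<in> sections G" "\<forall>\<^sub>F q in nhds p. snd c (u q) = axis \<delta> 1" for u \<delta>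
    using that(2) around_eventually[OF assms(1)]
  proof eventually_elim
    case (elim q)
    show ?case
      by (rule coord_inj[OF elim(2)]) (simp_all add: local_basis_def fibre_elem[OF elim(2)] elim(1) that(1))
  qed
  show ?thesis
    unfolding structure_fun_def
      local_bracket_eq[OF assms(2,3) b[OF assms(2,4)] b[OF assms(3,5)]] ..
qed

text \<open>This formula carries all the information about the bracket that is used below: the smoothness,
  skew symmetry, Jacobi identity and change of coordinates of the structure functions are read off by
  applying it to sections with constant components.\<close>

lemma bracket_formula:
  assumes c: "c \<in> around G p" and s: "s \<in> sections G" and t: "t \<in> sections G"
  shows "snd c (bracket G s t p) = base_deriv G c (\<lambda>q. snd c (t q)) p (snd c (s p)) -
    base_deriv G c (\<lambda>q. snd c (s q)) p (snd c (t p)) + struct G c p (snd c (s p)) (snd c (t p))"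
proof -
  obtain e where e1: "\<forall>\<beta>. e \<beta> \<in> sections G" and e2: "\<forall>\<beta>. \<forall>\<^sub>F q in nhds p. snd c (e \<beta> q) = axis \<beta> 1"
    and e3: "\<forall>s\<in>sections G. \<forall>t\<in>sections G. snd c (bracket G s t p) =
      (\<Sum>\<beta>\<in>UNIV. snd c (t p) $ \<beta> *\<^sub>R snd c (bracket G s (e \<beta>) p)) +
      base_deriv G c (\<lambda>q. snd c (t q)) p (snd c (s p))"
    by (rule bracket_frame[OF c], rule that)
  have e: "e \<beta> \<in> sections G" for \<beta> by (rule e1[rule_format])
  define S where "S \<alpha> \<beta> = snd c (bracket G (e \<alpha>) (e \<beta>) p)" for \<alpha> \<beta>
  let ?s = "snd c (s p)" and ?t = "snd c (t p)"
  note Ds = base_deriv_linear[OF c section_smooth[OF s c]]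
  have S': "S \<beta> \<alpha> = - S \<alpha> \<beta>" for \<alpha> \<beta> unfolding S_def by (rule bracket_antisym[OF e e c])
  have "snd c (bracket G s (e \<beta>) p) =
      (\<Sum>\<alpha>\<in>UNIV. ?s $ \<alpha> *\<^sub>R S \<alpha> \<beta>) - base_deriv G c (\<lambda>q. snd c (s q)) p (axis \<beta> 1)" for \<beta>
  proof -
    have "?s $ \<alpha> *\<^sub>R S \<beta> \<alpha> = - (?s $ \<alpha> *\<^sub>R S \<alpha> \<beta>)" for \<alpha>
      unfolding S'[of \<beta> \<alpha>] by (rule scaleR_minus_right)
    then have "(\<Sum>\<alpha>\<in>UNIV. ?s $ \<alpha> *\<^sub>R S \<beta> \<alpha>) = - (\<Sum>\<alpha>\<in>UNIV. ?s $ \<alpha> *\<^sub>R S \<alpha> \<beta>)"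
      unfolding sum_negf[symmetric] by (intro sum.cong refl)
    then have "snd c (bracket G (e \<beta>) s p) = - (\<Sum>\<alpha>\<in>UNIV. ?s $ \<alpha> *\<^sub>R S \<alpha> \<beta>) +
        base_deriv G c (\<lambda>q. snd c (s q)) p (axis \<beta> 1)"
      using e3[rule_format, OF e s, of \<beta>] eventually_nhds_x_imp_x[OF e2[rule_format, of \<beta>]]
      by (simp only: S_def)
    then show ?thesis unfolding bracket_antisym[OF s e c] by simp
  qed
  then have "snd c (bracket G s t p) =
      (\<Sum>\<beta>\<in>UNIV. ?t $ \<beta> *\<^sub>R (\<Sum>\<alpha>\<in>UNIV. ?s $ \<alpha> *\<^sub>R S \<alpha> \<beta>)) -
      (\<Sum>\<beta>\<in>UNIV. ?t $ \<beta> *\<^sub>R base_deriv G c (\<lambda>q. snd c (s q)) p (axis \<beta> 1)) +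
      base_deriv G c (\<lambda>q. snd c (t q)) p ?s"
    by (simp add: e3[rule_format, OF s t] scaleR_diff_right sum_subtractf)
  also have "(\<Sum>\<beta>\<in>UNIV. ?t $ \<beta> *\<^sub>R base_deriv G c (\<lambda>q. snd c (s q)) p (axis \<beta> 1)) =
      base_deriv G c (\<lambda>q. snd c (s q)) p ?t"
    by (rule sum_axis_linear[OF Ds])
  also have "(\<Sum>\<beta>\<in>UNIV. ?t $ \<beta> *\<^sub>R (\<Sum>\<alpha>\<in>UNIV. ?s $ \<alpha> *\<^sub>R S \<alpha> \<beta>)) = struct G c p ?s ?t"
    unfolding vec_eq_iff struct_def
    by (simp add: structure_fun_eq[OF c e e e2[rule_format] e2[rule_format]] S_def sum_component sum_distrib_left
        mult.assoc mult.left_commute, subst sum.swap, simp)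
  finally show ?thesis by simp
qed

subsection \<open>Structure functions\<close>

lemma struct_bounded_bilinear: "bounded_bilinear (struct G c p)"
  unfolding bilinear_conv_bounded_bilinear[symmetric] bilinear_def
  by (auto intro!: linearI simp: vec_eq_iff struct_def algebra_simps sum.distrib sum_distrib_left)

lemma struct_axis: "struct G c p (axis \<alpha> 1) (axis \<beta> 1) = (\<chi> \<gamma>. structure_fun G c \<alpha> \<beta> \<gamma> p)"
proof -
  have "(\<Sum>\<alpha>'\<in>UNIV. \<Sum>\<beta>'\<in>UNIV. (axis \<alpha> 1 :: real^'k) $ \<alpha>' * (axis \<beta> 1 :: real^'k) $ \<beta>' * structure_fun G c \<alpha>' \<beta>' \<gamma> p) =
     structure_fun G c \<alpha> \<beta> \<gamma> p" for \<gamma>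
  proof -
    have "(\<Sum>\<beta>'\<in>UNIV. (axis \<alpha> 1 :: real^'k) $ \<alpha>' * (axis \<beta> 1 :: real^'k) $ \<beta>' * structure_fun G c \<alpha>' \<beta>' \<gamma> p) =
      (if \<alpha>' = \<alpha> then structure_fun G c \<alpha> \<beta> \<gamma> p else 0)" for \<alpha>'
      using sum.delta[of UNIV \<beta> "\<lambda>\<beta>'. structure_fun G c \<alpha>' \<beta>' \<gamma> p"]
      by (simp add: axis_def if_distrib[of "\<lambda>x. x * _"] cong: if_cong)
    then show ?thesis by simp
  qed
  then show ?thesis by (simp add: struct_def)
qed

lemma struct_expand:
  "struct G c p a b = (\<Sum>\<alpha>\<in>UNIV. \<Sum>\<beta>\<in>UNIV. (a $ \<alpha> * b $ \<beta>) *\<^sub>R struct G c p (axis \<alpha> 1) (axis \<beta> 1))"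
  unfolding struct_axis by (simp add: vec_eq_iff struct_def sum_component)

text \<open>For sections with constant components the derivative terms of the bracket formula vanish near
  \<open>p\<close>, which leaves the structure functions in a whole neighbourhood.\<close>

lemma bracket_const:
  assumes "c \<in> around G p" "s \<in> sections G" "t \<in> sections G"
    and "\<forall>\<^sub>F q in nhds p. snd c (s q) = a" "\<forall>\<^sub>F q in nhds p. snd c (t q) = b"
  shows "\<forall>\<^sub>F q in nhds p. snd c (bracket G s t q) = struct G c q a b"
proof -
  have "\<forall>\<^sub>F q in nhds p. \<forall>\<^sub>F q' in nhds q. snd c (s q') = a"
    "\<forall>\<^sub>F q in nhds p. \<forall>\<^sub>F q' in nhds q. snd c (t q') = b"
    using assms(4,5) by (simp_all add: eventually_eventually)
  with around_eventually[OF assms(1)] show ?thesis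
  proof eventually_elim
    case (elim q)
    show ?case
      using bracket_formula[OF elim(1) assms(2,3)] base_deriv_cong[OF elim(1) elim(2)]
        base_deriv_cong[OF elim(1) elim(3)] eventually_nhds_x_imp_x[OF elim(2)]
        eventually_nhds_x_imp_x[OF elim(3)]
      by simp
  qed
qed

lemma const_section:
  assumes "c \<in> around G p"
  obtains s where "s \<in> sections G" "\<forall>\<^sub>F q in nhds p. snd c (s q) = a"
  by (rule section_extension[OF assms M.smooth_at_const[where k = a]])

lemma smooth_M_struct:
  assumes c: "c \<in> around G p" and "smooth_M p a" "smooth_M p b"
  shows "smooth_M p (\<lambda>q. struct G c q (a q) (b q))"
proof -
  have "smooth_M p (\<lambda>q. struct G c q (axis \<alpha> 1) (axis \<beta> 1))" for \<alpha> \<beta>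
  proof -
    obtain s where s: "s \<in> sections G" "\<forall>\<^sub>F q in nhds p. snd c (s q) = axis \<alpha> 1"
      by (rule const_section[OF c])
    obtain t where t: "t \<in> sections G" "\<forall>\<^sub>F q in nhds p. snd c (t q) = axis \<beta> 1"
      by (rule const_section[OF c])
    show ?thesis
      by (rule M.smooth_at_cong[OF section_smooth[OF bracket_closed[OF s(1) t(1)] c]
            bracket_const[OF c s(1) t(1) s(2) t(2)]])
  qed
  then have "smooth_M p (\<lambda>q. \<Sum>\<alpha>\<in>UNIV. \<Sum>\<beta>\<in>UNIV. (a q $ \<alpha> * b q $ \<beta>) *\<^sub>R struct G c q (axis \<alpha> 1) (axis \<beta> 1))"
    by (intro M.smooth_at_sum M.smooth_at_scaleR M.smooth_at_mult M.smooth_at_vec_nth assms(2,3))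
  then show ?thesis by (simp only: struct_expand[symmetric])
qed

lemma struct_antisym:
  assumes c: "c \<in> around G p" shows "struct G c p a b = - struct G c p b a"
proof -
  obtain s where s: "s \<in> sections G" "\<forall>\<^sub>F q in nhds p. snd c (s q) = a" by (rule const_section[OF c])
  obtain t where t: "t \<in> sections G" "\<forall>\<^sub>F q in nhds p. snd c (t q) = b" by (rule const_section[OF c])
  show ?thesis
    using bracket_antisym[OF s(1) t(1) c]
      eventually_nhds_x_imp_x[OF bracket_const[OF c s(1) t(1) s(2) t(2)]]
      eventually_nhds_x_imp_x[OF bracket_const[OF c t(1) s(1) t(2) s(2)]] by simp
qed

lemma struct_jacobi:
  assumes c: "c \<in> around G p"
  shows "(base_deriv G c (\<lambda>q. struct G c q b d) p a + struct G c p a (struct G c p b d)) +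
    (base_deriv G c (\<lambda>q. struct G c q d a) p b + struct G c p b (struct G c p d a)) +
    (base_deriv G c (\<lambda>q. struct G c q a b) p d + struct G c p d (struct G c p a b)) = 0"
proof -
  obtain s where s: "s \<in> sections G" "\<forall>\<^sub>F q in nhds p. snd c (s q) = a" by (rule const_section[OF c])
  obtain t where t: "t \<in> sections G" "\<forall>\<^sub>F q in nhds p. snd c (t q) = b" by (rule const_section[OF c])
  obtain u where u: "u \<in> sections G" "\<forall>\<^sub>F q in nhds p. snd c (u q) = d" by (rule const_section[OF c])
  have br: "snd c (bracket G x (bracket G y z) p) =
      base_deriv G c (\<lambda>q. struct G c q b' d') p a' + struct G c p a' (struct G c p b' d')"
    if x: "x \<in> sections G" "\<forall>\<^sub>F q in nhds p. snd c (x q) = a'"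
      and y: "y \<in> sections G" "\<forall>\<^sub>F q in nhds p. snd c (y q) = b'"
      and z: "z \<in> sections G" "\<forall>\<^sub>F q in nhds p. snd c (z q) = d'" for x y z a' b' d'
    using bracket_formula[OF c x(1) bracket_closed[OF y(1) z(1)]]
      base_deriv_cong[OF c bracket_const[OF c y(1) z(1) y(2) z(2)]]
      eventually_nhds_x_imp_x[OF bracket_const[OF c y(1) z(1) y(2) z(2)]]
      base_deriv_cong[OF c x(2)] eventually_nhds_x_imp_x[OF x(2)] by simp
  note cl = bracket_closed[OF s(1) bracket_closed[OF t(1) u(1)]]
    bracket_closed[OF t(1) bracket_closed[OF u(1) s(1)]] bracket_closed[OF u(1) bracket_closed[OF s(1) t(1)]]
  have "sec_add G (bracket G s (bracket G t u))
      (sec_add G (bracket G t (bracket G u s)) (bracket G u (bracket G s t))) = vb_zero G"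
    by (rule bracket_axioms[unfolded bracket_axioms_def, THEN conjunct2, THEN conjunct2, THEN conjunct2,
          THEN conjunct2, rule_format, OF s(1) t(1) u(1)])
  from arg_cong[OF this, of "\<lambda>v. snd c (v p)"]
  have "snd c (bracket G s (bracket G t u) p) + (snd c (bracket G t (bracket G u s) p) +
      snd c (bracket G u (bracket G s t) p)) = 0"
    by (simp add: sec_add(2)[OF cl(1) sec_add(1)[OF cl(2,3)] c] sec_add(2)[OF cl(2,3) c] vb_zero(2)[OF c])
  then show ?thesis
    by (simp add: br[OF s t u] br[OF t u s] br[OF u s t] add.assoc)
qed

text \<open>The anchor is a homomorphism of Lie algebras, applied to functions cut off near \<open>p\<close>. Taking for
  \<open>f\<close> the linear functionals of the coordinates then gives the identity for the anchor itself.\<close>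

lemma anchor_commutator_apply:
  assumes c: "c \<in> around G p" and f: "smooth_M p (f :: 'p \<Rightarrow> real)"
  shows "base_deriv G c (\<lambda>q. base_deriv G c f q b) p a - base_deriv G c (\<lambda>q. base_deriv G c f q a) p b =
    base_deriv G c f p (struct G c p a b)"
proof -
  obtain s where s: "s \<in> sections G" "\<forall>\<^sub>F q in nhds p. snd c (s q) = a" by (rule const_section[OF c])
  obtain t where t: "t \<in> sections G" "\<forall>\<^sub>F q in nhds p. snd c (t q) = b" by (rule const_section[OF c])
  obtain F where F1: "\<forall>q. smooth_M q F" and Ff: "\<forall>\<^sub>F q in nhds p. F q = f q"
    by (rule M.smooth_extension[OF f open_UNIV UNIV_I], rule that)
  have F: "smooth_M q F" for q by (rule F1[rule_format])
  then have "mfd_smooth_on (base_atlas G) UNIV F" by (simp add: M.mfd_smooth_on_iff)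
  then have "anchor_apply G (bracket G s t) F =
      (\<lambda>p. anchor_apply G s (anchor_apply G t F) p - anchor_apply G t (anchor_apply G s F) p)"
    by (rule lie_algebroid[unfolded lie_algebroid_def, THEN conjunct2, THEN conjunct2, THEN conjunct2,
          THEN conjunct1, rule_format, OF s(1) t(1)])
  then have "anchor_apply G (bracket G s t) F p =
      anchor_apply G s (anchor_apply G t F) p - anchor_apply G t (anchor_apply G s F) p"
    by simp
  moreover have "\<forall>\<^sub>F q in nhds p. anchor_apply G u F q = base_deriv G c f q k"
    if "u \<in> sections G" "\<forall>\<^sub>F q in nhds p. snd c (u q) = k" for u k
  proof -
    have "\<forall>\<^sub>F q in nhds p. \<forall>\<^sub>F q' in nhds q. F q' = f q'" using Ff by (simp add: eventually_eventually)
    with around_eventually[OF c] that(2) show ?thesis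
      by eventually_elim (simp add: anchor_apply_coord[OF that(1) _ F] base_deriv_cong)
  qed
  note ev = this[OF s] this[OF t]
  ultimately show ?thesis
    using anchor_apply_coord[OF bracket_closed[OF s(1) t(1)] c F]
      anchor_apply_coord[OF s(1) c anchor_apply_smooth[OF t(1) F]]
      anchor_apply_coord[OF t(1) c anchor_apply_smooth[OF s(1) F]]
      eventually_nhds_x_imp_x[OF bracket_const[OF c s(1) t(1) s(2) t(2)]]
      base_deriv_cong[OF c ev(1)] base_deriv_cong[OF c ev(2)] base_deriv_cong[OF c Ff]
      eventually_nhds_x_imp_x[OF s(2)] eventually_nhds_x_imp_x[OF t(2)]
    by simp
qed

lemma anchor_commutator:
  assumes c: "c \<in> around G p"
  shows "base_deriv G c (\<lambda>q. anc G c q b) p a - base_deriv G c (\<lambda>q. anc G c q a) p b =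
    anc G c p (struct G c p a b)"
proof -
  note b = around_base_chart[OF c]
  have lin: "base_deriv G c (\<lambda>q. h q \<bullet> v) q k = base_deriv G c h q k \<bullet> v"
    if "c \<in> around G q" "smooth_M q h" for h :: "'p \<Rightarrow> 'x" and v q k
    unfolding base_deriv_def
    by (rule M.chart_deriv_bl[OF bounded_linear_inner_left around_base_chart[OF that(1)] that(2)])
  have "(base_deriv G c (\<lambda>q. anc G c q b) p a - base_deriv G c (\<lambda>q. anc G c q a) p b) \<bullet> v =
      anc G c p (struct G c p a b) \<bullet> v" for v
  proof -
    have x: "\<forall>\<^sub>F q in nhds p. base_deriv G c (\<lambda>q. snd (fst c) q \<bullet> v) q k = anc G c q k \<bullet> v" for k
      using around_eventually[OF c]
    proof eventually_elim
      case (elim q)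
      note bq = around_base_chart[OF elim]
      show ?case
        using lin[OF elim M.smooth_at_chart_map[OF bq]] M.chart_deriv_self[OF bq]
        by (simp add: base_deriv_def)
    qed
    have "smooth_M p (\<lambda>q. snd (fst c) q \<bullet> v)"
      by (intro M.smooth_at_inner M.smooth_at_chart_map b M.smooth_at_const)
    from anchor_commutator_apply[OF c this, of b a] show ?thesis
      using base_deriv_cong[OF c x] eventually_nhds_x_imp_x[OF x] lin[OF c smooth_M_anc[OF c M.smooth_at_const]]
      by (simp add: inner_diff_left)
  qed
  then show ?thesis by (rule vector_eq_rdot[THEN iffD1, OF allI])
qed

text \<open>The structure functions are not tensorial. The inhomogeneous terms arise because sections with
  constant components in one system of coordinates have the components \<open>T a\<close> in another.\<close>

lemma struct_change:
  assumes c: "c \<in> around G p" and c': "c' \<in> around G p"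
    and T: "\<forall>\<^sub>F q in nhds p. \<forall>e. proj G e = q \<longrightarrow> snd c' e = T q *v snd c e"
  shows "T p *v struct G c p a b = base_deriv G c' (\<lambda>q. T q *v b) p (T p *v a) -
    base_deriv G c' (\<lambda>q. T q *v a) p (T p *v b) + struct G c' p (T p *v a) (T p *v b)"
proof -
  obtain s where s: "s \<in> sections G" "\<forall>\<^sub>F q in nhds p. snd c (s q) = a" by (rule const_section[OF c])
  obtain t where t: "t \<in> sections G" "\<forall>\<^sub>F q in nhds p. snd c (t q) = b" by (rule const_section[OF c])
  have ev: "\<forall>\<^sub>F q in nhds p. snd c' (u q) = T q *v k"
    if "u \<in> sections G" "\<forall>\<^sub>F q in nhds p. snd c (u q) = k" for u k
    using T that(2) by eventually_elim (simp add: that(1))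
  have "snd c' (bracket G s t p) = T p *v snd c (bracket G s t p)"
    using eventually_nhds_x_imp_x[OF T] bracket_closed[OF s(1) t(1)] by simp
  then show ?thesis
    using bracket_formula[OF c' s(1) t(1)] base_deriv_cong[OF c' ev[OF s]] base_deriv_cong[OF c' ev[OF t]]
      eventually_nhds_x_imp_x[OF ev[OF s]] eventually_nhds_x_imp_x[OF ev[OF t]]
      eventually_nhds_x_imp_x[OF bracket_const[OF c s(1) t(1) s(2) t(2)]]
    by simp
qed

end

section \<open>The prolongation in adapted coordinates\<close>

text \<open>The derivative \<open>a\<^sup>\<alpha> \<X>\<^sub>\<alpha>(f) + b\<^sup>\<alpha> \<V>\<^sub>\<alpha>(f)\<close> for \<open>z = (a, b)\<close>.\<close>

definition prol_deriv ::
  "('p, 'e, 'x::real_normed_vector, 'k::finite) algebroid \<Rightarrow> ('p, 'e, 'x, 'k) adapted \<Rightarrow>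
   ('e \<Rightarrow> 'b::real_normed_vector) \<Rightarrow> 'e \<Rightarrow> (real^'k) \<times> (real^'k) \<Rightarrow> 'b" where
  "prol_deriv G c f w z = chart_deriv (total_chart G c) f w (anc G c (proj G w) (fst z), snd z)"

text \<open>The values of the dual basis \<open>\<X>\<^sup>\<alpha>\<close>, \<open>\<V>\<^sup>\<alpha>\<close>, as a pair of vectors.\<close>

definition comps ::
  "('p, 'e, 'x, 'k::finite) algebroid \<Rightarrow> ('p, 'e, 'x, 'k) adapted \<Rightarrow> ('e, 'x, 'k) prol \<Rightarrow>
   (real^'k) \<times> (real^'k)" where
  "comps G c z = (snd c (fst z), snd (snd z (total_chart G c)))"

lemma dual_comps: "dual_X c \<alpha> z = fst (comps G c z) $ \<alpha>" "dual_V G c \<alpha> z = snd (comps G c z) $ \<alpha>"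
  by (simp_all add: dual_X_def dual_V_def comps_def)

lemma linear_inl: "linear (\<lambda>a. (a, 0))" and linear_inr: "linear (\<lambda>b. (0, b))"
  by (rule linearI; simp)+

context Lie_algebroid
begin

lemma base_coord_smooth_E:
  assumes "c \<in> around G (proj G w)"
  shows "smooth_E w (\<lambda>w'. snd (fst c) (proj G w'))" and "smooth_E w (snd c)"
proof -
  note s = E.smooth_at_chart_map[OF around_total_chart[OF assms]]
  show "smooth_E w (\<lambda>w'. snd (fst c) (proj G w'))" using E.smooth_at_fst[OF s] by (simp add: total_chart_simps)
  show "smooth_E w (snd c)" using E.smooth_at_snd[OF s] by (simp add: total_chart_simps)
qed

lemma filterlim_proj: "filterlim (proj G) (nhds (proj G w)) (nhds w)"
proof -
  obtain c where c: "c \<in> around G (proj G w)" using around_nonempty by blast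
  note b = around_base_chart[OF c]
  have "filterlim (\<lambda>w'. snd (fst c) (proj G w')) (nhds (snd (fst c) (proj G w))) (nhds w)"
    by (rule tendsto_at_iff_tendsto_nhds[THEN iffD1, OF isCont_def[THEN iffD1,
            OF E.smooth_at_isCont[OF base_coord_smooth_E(1)[OF c]]]])
  from filterlim_compose[OF M.filterlim_chart(2)[OF b] this]
  have 1: "filterlim (\<lambda>w'. chart_inv (fst c) (snd (fst c) (proj G w'))) (nhds (proj G w)) (nhds w)" .
  have "\<forall>\<^sub>F w' in nhds w. chart_inv (fst c) (snd (fst c) (proj G w')) = proj G w'"
    using E.eventually_in_chart[OF around_total_chart[OF c]]
  proof eventually_elim
    case (elim w')
    then have "c \<in> around G (proj G w')" using total_chart_at_iff[OF aroundD(1)[OF c]] by simp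
    then show ?case by (intro M.chart_inv_chart M.charts_atD[OF around_base_chart])
  qed
  with 1 show ?thesis by (rule Lim_transform_eventually)
qed

lemma eventually_proj: "\<forall>\<^sub>F q in nhds (proj G w). P q \<Longrightarrow> \<forall>\<^sub>F w' in nhds w. P (proj G w')"
  by (rule eventually_compose_filterlim[OF _ filterlim_proj])

lemma around_eventually_E: "c \<in> around G (proj G w) \<Longrightarrow> \<forall>\<^sub>F w' in nhds w. c \<in> around G (proj G w')"
  by (rule eventually_proj[OF around_eventually])

lemma smooth_E_pull:
  assumes "smooth_M (proj G w) f" shows "smooth_E w (\<lambda>w'. f (proj G w'))"
proof -
  obtain c where c: "c \<in> around G (proj G w)" using around_nonempty by blast
  note b = around_base_chart[OF c]
  have "smooth_E w (\<lambda>w'. f (chart_inv (fst c) (snd (fst c) (proj G w'))))"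
    by (rule E.smooth_at_compose[OF M.findim_model base_coord_smooth_E(1)[OF c]])
      (use assms b in \<open>simp add: smooth_at_def\<close>)
  then show ?thesis
  proof (rule E.smooth_at_cong)
    show "\<forall>\<^sub>F w' in nhds w. f (chart_inv (fst c) (snd (fst c) (proj G w'))) = f (proj G w')"
      using around_eventually_E[OF c]
      by eventually_elim (simp add: M.chart_inv_chart[OF M.charts_atD[OF around_base_chart]])
  qed
qed

subsection \<open>Rules for derivatives\<close>

lemma prol_deriv_linear:
  assumes "c \<in> around G (proj G w)" "smooth_E w f" shows "linear (prol_deriv G c f w)"
proof -
  interpret A: linear "anc G c (proj G w)" by (rule anc_linear[OF assms(1)])
  interpret D: linear "chart_deriv (total_chart G c) f w"
    by (rule E.chart_deriv_linear[OF around_total_chart[OF assms(1)] assms(2)])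
  show ?thesis
  proof
    fix x y :: "(real^'k) \<times> (real^'k)" and r :: real
    show "prol_deriv G c f w (x + y) = prol_deriv G c f w x + prol_deriv G c f w y"
      unfolding prol_deriv_def D.add[symmetric] by (simp add: A.add)
    show "prol_deriv G c f w (r *\<^sub>R x) = r *\<^sub>R prol_deriv G c f w x"
      unfolding prol_deriv_def D.scale[symmetric] by (simp add: A.scale)
  qed
qed

lemma prol_deriv_cong:
  "c \<in> around G (proj G w) \<Longrightarrow> \<forall>\<^sub>F w' in nhds w. f w' = g w' \<Longrightarrow> prol_deriv G c f w z = prol_deriv G c g w z"
  unfolding prol_deriv_def by (rule E.chart_deriv_cong[OF around_total_chart])

lemma prol_deriv_const [simp]: "prol_deriv G c (\<lambda>_. k) w z = 0"
  by (simp add: prol_deriv_def)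

lemma prol_deriv_bl:
  "bounded_linear h \<Longrightarrow> c \<in> around G (proj G w) \<Longrightarrow> smooth_E w f \<Longrightarrow>
   prol_deriv G c (\<lambda>w'. h (f w')) w z = h (prol_deriv G c f w z)"
  unfolding prol_deriv_def by (rule E.chart_deriv_bl[OF _ around_total_chart])

lemma prol_deriv_add:
  "c \<in> around G (proj G w) \<Longrightarrow> smooth_E w f \<Longrightarrow> smooth_E w g \<Longrightarrow>
   prol_deriv G c (\<lambda>w'. f w' + g w') w z = prol_deriv G c f w z + prol_deriv G c g w z"
  unfolding prol_deriv_def by (rule E.chart_deriv_add[OF around_total_chart])

lemma prol_deriv_diff:
  assumes "c \<in> around G (proj G w)" "smooth_E w f" "smooth_E w g"
  shows "prol_deriv G c (\<lambda>w'. f w' - g w') w z = prol_deriv G c f w z - prol_deriv G c g w z"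
  using prol_deriv_add[OF assms(1) assms(2) E.smooth_at_minus[OF assms(3)]]
    prol_deriv_bl[OF bounded_linear_minus[OF bounded_linear_ident] assms(1,3)] by simp

lemma prol_deriv_bilinear:
  "bounded_bilinear pr \<Longrightarrow> c \<in> around G (proj G w) \<Longrightarrow> smooth_E w f \<Longrightarrow> smooth_E w g \<Longrightarrow>
   prol_deriv G c (\<lambda>w'. pr (f w') (g w')) w z = pr (f w) (prol_deriv G c g w z) + pr (prol_deriv G c f w z) (g w)"
  unfolding prol_deriv_def by (rule E.chart_deriv_bilinear[OF _ around_total_chart])

lemma prol_deriv_sum:
  "c \<in> around G (proj G w) \<Longrightarrow> finite I \<Longrightarrow> (\<And>i. i \<in> I \<Longrightarrow> smooth_E w (f i)) \<Longrightarrow>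
   prol_deriv G c (\<lambda>w'. \<Sum>i\<in>I. f i w') w z = (\<Sum>i\<in>I. prol_deriv G c (f i) w z)"
  unfolding prol_deriv_def by (rule E.chart_deriv_sum[OF around_total_chart])

lemma prol_deriv_coord:
  assumes "c \<in> around G (proj G w)" shows "prol_deriv G c (snd c) w z = snd z"
  using E.chart_deriv_bl[OF bounded_linear_snd around_total_chart[OF assms] E.smooth_at_chart_map[OF around_total_chart[OF assms]]]
    E.chart_deriv_self[OF around_total_chart[OF assms]]
  by (simp add: prol_deriv_def total_chart_simps)

lemma chart_deriv_base_coord:
  assumes "c \<in> around G (proj G w)"
  shows "chart_deriv (total_chart G c) (\<lambda>w'. snd (fst c) (proj G w')) w \<xi> = fst \<xi>"
  using E.chart_deriv_bl[OF bounded_linear_fst around_total_chart[OF assms] E.smooth_at_chart_map[OF around_total_chart[OF assms]]]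
    E.chart_deriv_self[OF around_total_chart[OF assms]]
  by (simp add: total_chart_simps)

lemma prol_deriv_pull:
  assumes c: "c \<in> around G (proj G w)" and f: "smooth_M (proj G w) f"
  shows "prol_deriv G c (\<lambda>w'. f (proj G w')) w z = base_deriv G c f (proj G w) (fst z)"
proof -
  have "prol_deriv G c (\<lambda>w'. f (proj G w')) w z =
      prol_deriv G c (\<lambda>w'. f (chart_inv (fst c) (snd (fst c) (proj G w')))) w z"
    by (rule prol_deriv_cong[OF c])
      (use around_eventually_E[OF c] in \<open>eventually_elim,
        simp add: M.chart_inv_chart[OF M.charts_atD[OF around_base_chart]]\<close>)
  also have "\<dots> = frechet_derivative (\<lambda>z. f (chart_inv (fst c) z)) (at (snd (fst c) (proj G w)))
      (chart_deriv (total_chart G c) (\<lambda>w'. snd (fst c) (proj G w')) w (anc G c (proj G w) (fst z), snd z))"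
    unfolding prol_deriv_def
    by (rule E.chart_deriv_compose[OF around_total_chart[OF c] base_coord_smooth_E(1)[OF c]])
      (use f around_base_chart[OF c] in \<open>simp add: smooth_at_def\<close>)
  finally show ?thesis unfolding chart_deriv_base_coord[OF c] by (simp add: base_deriv_def chart_deriv_def)
qed

text \<open>The product rule for a family of linear maps on \<open>\<real>\<^sup>m\<close>, by expansion in the standard basis. It
  covers the anchor, the transition matrices and the structure functions.\<close>

lemma prol_deriv_family:
  fixes h :: "'e \<Rightarrow> real^'k \<Rightarrow> 'b::real_normed_vector"
  assumes c: "c \<in> around G (proj G w)" and h: "\<And>\<alpha>. smooth_E w (\<lambda>w'. h w' (axis \<alpha> 1))"
    and lin: "\<forall>\<^sub>F w' in nhds w. linear (h w')" and a: "smooth_E w a"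
  shows "prol_deriv G c (\<lambda>w'. h w' (a w')) w z = prol_deriv G c (\<lambda>w'. h w' (a w)) w z + h w (prol_deriv G c a w z)"
    and "smooth_E w (\<lambda>w'. h w' (a w'))"
proof -
  have ex: "\<forall>\<^sub>F w' in nhds w. (\<Sum>\<alpha>\<in>UNIV. b w' $ \<alpha> *\<^sub>R h w' (axis \<alpha> 1)) = h w' (b w')" for b
    using lin by eventually_elim (rule sum_axis_linear)
  have sm: "smooth_E w (\<lambda>w'. \<Sum>\<alpha>\<in>UNIV. b w' $ \<alpha> *\<^sub>R h w' (axis \<alpha> 1))" if "smooth_E w b" for b
    by (intro E.smooth_at_sum E.smooth_at_scaleR E.smooth_at_vec_nth that h)
  show "smooth_E w (\<lambda>w'. h w' (a w'))" by (rule E.smooth_at_cong[OF sm[OF a] ex])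
  have d: "prol_deriv G c (\<lambda>w'. h w' (b w')) w z =
      (\<Sum>\<alpha>\<in>UNIV. b w $ \<alpha> *\<^sub>R prol_deriv G c (\<lambda>w'. h w' (axis \<alpha> 1)) w z) + h w (prol_deriv G c b w z)"
    if b: "smooth_E w b" for b
  proof -
    have "prol_deriv G c (\<lambda>w'. h w' (b w')) w z = prol_deriv G c (\<lambda>w'. \<Sum>\<alpha>\<in>UNIV. b w' $ \<alpha> *\<^sub>R h w' (axis \<alpha> 1)) w z"
      by (rule prol_deriv_cong[OF c]) (use ex[of b] in \<open>eventually_elim, simp\<close>)
    also have "\<dots> = (\<Sum>\<alpha>\<in>UNIV. prol_deriv G c (\<lambda>w'. b w' $ \<alpha> *\<^sub>R h w' (axis \<alpha> 1)) w z)"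
      by (intro prol_deriv_sum c finite E.smooth_at_scaleR E.smooth_at_vec_nth b h)
    also have "\<dots> = (\<Sum>\<alpha>\<in>UNIV. b w $ \<alpha> *\<^sub>R prol_deriv G c (\<lambda>w'. h w' (axis \<alpha> 1)) w z +
        prol_deriv G c b w z $ \<alpha> *\<^sub>R h w (axis \<alpha> 1))"
      by (simp add: prol_deriv_bilinear[OF bounded_bilinear_scaleR c E.smooth_at_vec_nth[OF b] h]
          prol_deriv_bl[OF bounded_linear_vec_nth c b])
    also have "\<dots> = (\<Sum>\<alpha>\<in>UNIV. b w $ \<alpha> *\<^sub>R prol_deriv G c (\<lambda>w'. h w' (axis \<alpha> 1)) w z) + h w (prol_deriv G c b w z)"
      by (simp add: sum.distrib sum_axis_linear[OF eventually_nhds_x_imp_x[OF lin]])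
    finally show ?thesis .
  qed
  show "prol_deriv G c (\<lambda>w'. h w' (a w')) w z = prol_deriv G c (\<lambda>w'. h w' (a w)) w z + h w (prol_deriv G c a w z)"
    using d[OF a] d[OF E.smooth_at_const[where k = "a w"]] linear_0[OF eventually_nhds_x_imp_x[OF lin]] by simp
qed

lemma prol_deriv_anc:
  assumes c: "c \<in> around G (proj G w)" and a: "smooth_E w a"
  shows "prol_deriv G c (\<lambda>w'. anc G c (proj G w') (a w')) w z =
      base_deriv G c (\<lambda>q. anc G c q (a w)) (proj G w) (fst z) + anc G c (proj G w) (prol_deriv G c a w z)"
    and "smooth_E w (\<lambda>w'. anc G c (proj G w') (a w'))"
proof -
  have sm: "smooth_E w (\<lambda>w'. anc G c (proj G w') (axis \<alpha> 1))" for \<alpha>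
    by (rule smooth_E_pull[OF smooth_M_anc[OF c M.smooth_at_const]])
  have lin: "\<forall>\<^sub>F w' in nhds w. linear (anc G c (proj G w'))"
    using around_eventually_E[OF c] by eventually_elim (rule anc_linear)
  note * = prol_deriv_family[where h = "\<lambda>w'. anc G c (proj G w')", OF c sm lin a]
  show "smooth_E w (\<lambda>w'. anc G c (proj G w') (a w'))" by (rule *(2))
  show "prol_deriv G c (\<lambda>w'. anc G c (proj G w') (a w')) w z =
      base_deriv G c (\<lambda>q. anc G c q (a w)) (proj G w) (fst z) + anc G c (proj G w) (prol_deriv G c a w z)"
    unfolding *(1) prol_deriv_pull[OF c smooth_M_anc[OF c M.smooth_at_const]] ..
qed

lemma prol_deriv_matrix:
  fixes T :: "'p \<Rightarrow> real^'k^'k"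
  assumes c: "c \<in> around G (proj G w)" and T: "smooth_M (proj G w) T" and a: "smooth_E w a"
  shows "prol_deriv G c (\<lambda>w'. T (proj G w') *v a w') w z =
      base_deriv G c (\<lambda>q. T q *v a w) (proj G w) (fst z) + T (proj G w) *v prol_deriv G c a w z"
proof -
  have sm: "smooth_M (proj G w) (\<lambda>q. T q *v b)" for b
    by (rule M.smooth_at_matrix_vector[OF T M.smooth_at_const])
  show ?thesis
    using prol_deriv_family(1)[where h = "\<lambda>w'. (*v) (T (proj G w'))", OF c smooth_E_pull[OF sm] _ a]
      prol_deriv_pull[OF c sm] by simp
qed

lemma prol_deriv_struct:
  assumes c: "c \<in> around G (proj G w)" and a: "smooth_E w a" and b: "smooth_E w b"
  shows "prol_deriv G c (\<lambda>w'. struct G c (proj G w') (a w') (b w')) w z =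
      base_deriv G c (\<lambda>q. struct G c q (a w) (b w)) (proj G w) (fst z) +
      struct G c (proj G w) (prol_deriv G c a w z) (b w) + struct G c (proj G w) (a w) (prol_deriv G c b w z)"
    and "smooth_E w (\<lambda>w'. struct G c (proj G w') (a w') (b w'))"
proof -
  note bl = struct_bounded_bilinear
  have l1: "linear (\<lambda>x. struct G c q x y)" and l2: "linear (struct G c q x)" for q x y
    using bounded_bilinear.bounded_linear_left[OF bl] bounded_bilinear.bounded_linear_right[OF bl]
    by (simp_all add: bounded_linear.linear)
  have sm: "smooth_M (proj G w) (\<lambda>q. struct G c q x y)" for x y
    by (rule smooth_M_struct[OF c M.smooth_at_const M.smooth_at_const])
  note 1 = prol_deriv_family[where h = "\<lambda>w' x. struct G c (proj G w') x y" for y, OF c smooth_E_pull[OF sm]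
      always_eventually[OF allI[OF l1]] a]
  note 2 = prol_deriv_family[where h = "\<lambda>w'. struct G c (proj G w') (a w')", OF c 1(2)
      always_eventually[OF allI[OF l2]] b]
  show "smooth_E w (\<lambda>w'. struct G c (proj G w') (a w') (b w'))" by (rule 2(2))
  show "prol_deriv G c (\<lambda>w'. struct G c (proj G w') (a w') (b w')) w z =
      base_deriv G c (\<lambda>q. struct G c q (a w) (b w)) (proj G w) (fst z) +
      struct G c (proj G w) (prol_deriv G c a w z) (b w) + struct G c (proj G w) (a w) (prol_deriv G c b w z)"
    unfolding 2(1) 1(1) prol_deriv_pull[OF c sm] ..
qed

lemma smooth_E_prol_deriv:
  fixes f :: "'e \<Rightarrow> 'b::real_normed_vector"
  assumes c: "c \<in> around G (proj G w)" and f: "smooth_E w f" and \<zeta>: "smooth_E w \<zeta>"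
  shows "smooth_E w (\<lambda>w'. prol_deriv G c f w' (\<zeta> w'))"
proof -
  let ?C = "total_chart G c"
  note C = around_total_chart[OF c]
  let ?X = "\<lambda>w'. (anc G c (proj G w') (fst (\<zeta> w')), snd (\<zeta> w'))"
  have "smooth_E w (\<lambda>w'. fst (\<zeta> w'))"
    by (rule E.smooth_at_fst[OF \<zeta>])
  then have X: "smooth_E w ?X"
    by (intro E.smooth_at_Pair prol_deriv_anc(2)[OF c] E.smooth_at_snd \<zeta>)
  have "smooth_near (snd ?C w) (\<lambda>z. frechet_derivative (\<lambda>z. f (chart_inv ?C z)) (at z) (?X (chart_inv ?C z)))"
    using f X C unfolding smooth_at_def by (intro smooth_near_derivative_along[OF E.findim_model]) blast+
  moreover have "\<forall>\<^sub>F z in nhds (snd ?C w). frechet_derivative (\<lambda>z. f (chart_inv ?C z)) (at z) (?X (chart_inv ?C z)) =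
      prol_deriv G c f (chart_inv ?C z) (\<zeta> (chart_inv ?C z))"
    using E.eventually_in_image[OF C]
    by eventually_elim (simp only: prol_deriv_def chart_deriv_def E.chart_chart_inv)
  ultimately show ?thesis
    unfolding E.smooth_at_chart[OF C] by (rule smooth_near_cong)
qed

text \<open>Second derivatives of \<open>f\<close> cancel by symmetry. What remains is the derivative of \<open>f\<close> along the commutator of
  the vector fields, whose horizontal part is the anchor of a bracket by \<open>anchor_commutator\<close>.\<close>

lemma prol_deriv_commutator:
  fixes f :: "'e \<Rightarrow> 'b::real_inner"
  assumes c: "c \<in> around G (proj G w)" and f: "smooth_E w f" and y: "smooth_E w \<eta>" and z: "smooth_E w \<zeta>"
  shows "prol_deriv G c (\<lambda>w'. prol_deriv G c f w' (\<zeta> w')) w (\<eta> w) -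
      prol_deriv G c (\<lambda>w'. prol_deriv G c f w' (\<eta> w')) w (\<zeta> w) =
    prol_deriv G c f w (prol_deriv G c \<zeta> w (\<eta> w) - prol_deriv G c \<eta> w (\<zeta> w) +
      (struct G c (proj G w) (fst (\<eta> w)) (fst (\<zeta> w)), 0))"
proof -
  let ?C = "total_chart G c" and ?p = "proj G w"
  note C = around_total_chart[OF c]
  define X where "X \<eta> w' = (anc G c (proj G w') (fst (\<eta> w')), snd (\<eta> w'))"
    for \<eta> :: "'e \<Rightarrow> (real^'k) \<times> (real^'k)" and w'
  let ?f = "\<lambda>z. f (chart_inv ?C z)"
  have fs: "smooth_near (snd ?C w) ?f" using f C by (simp add: smooth_at_def)
  have inv: "chart_inv ?C (snd ?C w) = w" by (rule E.chart_inv_chart[OF E.charts_atD[OF C]])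
  have fst_s: "smooth_E w (\<lambda>w'. fst (\<eta> w'))" if "smooth_E w \<eta>" for \<eta> :: "'e \<Rightarrow> (real^'k) \<times> (real^'k)"
    by (rule E.smooth_at_fst[OF that])
  have Xs: "smooth_E w (X \<eta>)" if "smooth_E w \<eta>" for \<eta>
    unfolding X_def by (intro E.smooth_at_Pair prol_deriv_anc(2)[OF c] E.smooth_at_snd that fst_s)
  have DX: "chart_deriv ?C (X \<zeta>) w (X \<eta> w) =
      (base_deriv G c (\<lambda>q. anc G c q (fst (\<zeta> w))) ?p (fst (\<eta> w)) + anc G c ?p (fst (prol_deriv G c \<zeta> w (\<eta> w))),
       snd (prol_deriv G c \<zeta> w (\<eta> w)))" (is "?L = ?R") if z: "smooth_E w \<zeta>" for \<eta> \<zeta>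
  proof (rule prod_eqI)
    have "fst ?L = chart_deriv ?C (\<lambda>w'. fst (X \<zeta> w')) w (X \<eta> w)"
      by (rule E.chart_deriv_bl[OF bounded_linear_fst C Xs[OF z], symmetric])
    also have "\<dots> = prol_deriv G c (\<lambda>w'. anc G c (proj G w') (fst (\<zeta> w'))) w (\<eta> w)"
      by (simp add: prol_deriv_def X_def)
    also have "\<dots> = fst ?R"
      unfolding prol_deriv_anc(1)[OF c fst_s[OF z]] prol_deriv_bl[OF bounded_linear_fst c z] by simp
    finally show "fst ?L = fst ?R" .
    have "snd ?L = chart_deriv ?C (\<lambda>w'. snd (X \<zeta> w')) w (X \<eta> w)"
      by (rule E.chart_deriv_bl[OF bounded_linear_snd C Xs[OF z], symmetric])
    also have "\<dots> = prol_deriv G c (\<lambda>w'. snd (\<zeta> w')) w (\<eta> w)"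
      by (simp add: prol_deriv_def X_def)
    also have "\<dots> = snd ?R"
      unfolding prol_deriv_bl[OF bounded_linear_snd c z] by simp
    finally show "snd ?L = snd ?R" .
  qed
  let ?D2 = "\<lambda>u v. frechet_derivative (\<lambda>z. frechet_derivative ?f (at z) u) (at (snd ?C w)) v"
  have second: "prol_deriv G c (\<lambda>w'. prol_deriv G c f w' (\<zeta> w')) w (\<eta> w) =
      ?D2 (X \<zeta> w) (X \<eta> w) + frechet_derivative ?f (at (snd ?C w)) (chart_deriv ?C (X \<zeta>) w (X \<eta> w))"
    if z: "smooth_E w \<zeta>" for \<eta> \<zeta>
  proof -
    have ev: "\<forall>\<^sub>F z in nhds (snd ?C w). prol_deriv G c f (chart_inv ?C z) (\<zeta> (chart_inv ?C z)) =
        frechet_derivative ?f (at z) (X \<zeta> (chart_inv ?C z))"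
      using E.eventually_in_image[OF C]
      by eventually_elim (simp only: prol_deriv_def chart_deriv_def E.chart_chart_inv X_def)
    have "prol_deriv G c (\<lambda>w'. prol_deriv G c f w' (\<zeta> w')) w (\<eta> w) =
        frechet_derivative (\<lambda>z. prol_deriv G c f (chart_inv ?C z) (\<zeta> (chart_inv ?C z))) (at (snd ?C w)) (X \<eta> w)"
      by (simp only: prol_deriv_def[of G c "\<lambda>w'. prol_deriv G c f w' (\<zeta> w')"] chart_deriv_def X_def)
    also have "\<dots> = frechet_derivative (\<lambda>z. frechet_derivative ?f (at z) (X \<zeta> (chart_inv ?C z))) (at (snd ?C w)) (X \<eta> w)"
      unfolding frechet_derivative_cong[OF ev] ..
    also have "\<dots> = ?D2 (X \<zeta> (chart_inv ?C (snd ?C w))) (X \<eta> w) +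
        frechet_derivative ?f (at (snd ?C w)) (frechet_derivative (\<lambda>z. X \<zeta> (chart_inv ?C z)) (at (snd ?C w)) (X \<eta> w))"
      by (rule frechet_derivative_along[OF E.findim_model fs E.smooth_at_differentiable[OF Xs[OF z] C]])
    finally show ?thesis unfolding inv by (simp only: chart_deriv_def)
  qed
  interpret Df: linear "frechet_derivative ?f (at (snd ?C w))" by (rule smooth_near_linear[OF fs])
  interpret A: linear "anc G c ?p" by (rule anc_linear[OF c])
  have "chart_deriv ?C (X \<zeta>) w (X \<eta> w) - chart_deriv ?C (X \<eta>) w (X \<zeta> w) =
      (anc G c ?p (fst (prol_deriv G c \<zeta> w (\<eta> w) - prol_deriv G c \<eta> w (\<zeta> w) +
        (struct G c ?p (fst (\<eta> w)) (fst (\<zeta> w)), 0))),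
       snd (prol_deriv G c \<zeta> w (\<eta> w) - prol_deriv G c \<eta> w (\<zeta> w) + (struct G c ?p (fst (\<eta> w)) (fst (\<zeta> w)), 0)))"
    unfolding DX[OF y] DX[OF z]
    using anchor_commutator[OF c, of "fst (\<zeta> w)" "fst (\<eta> w)"]
    by (simp add: A.add A.diff algebra_simps)
  then show ?thesis
    unfolding second[OF y] second[OF z] second_derivative_symmetric[OF fs, of "X \<eta> w" "X \<zeta> w"]
    unfolding prol_deriv_def[of G c f w "_ + _"] chart_deriv_def[of ?C f]
    by (simp add: Df.diff[symmetric])
qed

subsection \<open>Elements and sections of the prolongation\<close>

lemma tangent_map_proj:
  assumes v: "v \<in> tangent_space (total_atlas G) w" and c: "c \<in> around G (proj G w)"
  shows "tangent_map (total_atlas G) (base_atlas G) (proj G) w v (fst c) = fst (v (total_chart G c))"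
proof -
  let ?C0 = "chart_at (total_atlas G) w" and ?x = "\<lambda>w'. snd (fst c) (proj G w')"
  have "tangent_map (total_atlas G) (base_atlas G) (proj G) w v (fst c) = chart_deriv ?C0 ?x w (v ?C0)"
    using around_base_chart[OF c] by (simp add: tangent_map_def Let_def chart_deriv_def o_def)
  also have "\<dots> = chart_deriv (total_chart G c) ?x w (v (total_chart G c))"
    unfolding E.tangent_space_change[OF v around_total_chart[OF c] E.chart_at]
    by (rule E.chart_deriv_change[OF around_total_chart[OF c] E.chart_at base_coord_smooth_E(1)[OF c]])
  finally show ?thesis unfolding chart_deriv_base_coord[OF c] .
qed

lemma prol_fibreD:
  assumes "z \<in> prol_fibre G w"
  shows "proj G (fst z) = proj G w" "snd z \<in> tangent_space (total_atlas G) w"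
    "anchor G (fst z) = tangent_map (total_atlas G) (base_atlas G) (proj G) w (snd z)"
  using assms by (auto simp: prol_fibre_def)

lemma tvec_comps:
  assumes z: "z \<in> prol_fibre G w" and c: "c \<in> around G (proj G w)"
  shows "snd z (total_chart G c) = (anc G c (proj G w) (fst (comps G c z)), snd (comps G c z))"
proof -
  note D = prol_fibreD[OF z]
  have "fst (snd z (total_chart G c)) = anchor G (fst z) (fst c)"
    unfolding D(3) by (rule tangent_map_proj[OF D(2) c, symmetric])
  also have "\<dots> = anc G c (proj G w) (snd c (fst z))"
    using anchor_coord[of c "fst z"] c D(1) by simp
  finally show ?thesis by (simp add: comps_def prod_eq_iff)
qed

text \<open>The anchor condition in one system of adapted coordinates implies it in all, since both of its
  sides are tangent vectors of \<open>M\<close>.\<close>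

lemma prol_fibreI:
  assumes c: "c \<in> around G (proj G w)" and u: "proj G u = proj G w"
    and v: "v \<in> tangent_space (total_atlas G) w"
    and a: "fst (v (total_chart G c)) = anc G c (proj G w) (snd c u)"
  shows "(u, v) \<in> prol_fibre G w"
proof -
  let ?p = "proj G w"
  have "anchor G u d = tangent_map (total_atlas G) (base_atlas G) (proj G) w v d" for d
  proof (cases "d \<in> charts_at (base_atlas G) ?p")
    case True
    then obtain c' where c': "c' \<in> around G ?p" and d: "fst c' = d" using base_chart_around by blast
    have "tangent_map (total_atlas G) (base_atlas G) (proj G) w v d = fst (v (total_chart G c'))"
      using tangent_map_proj[OF v c'] d by simp
    also have "\<dots> = fst (chart_deriv (total_chart G c) (snd (total_chart G c')) w (v (total_chart G c)))"
      unfolding E.tangent_space_change[OF v around_total_chart[OF c] around_total_chart[OF c']] coord_change_deriv_eq ..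
    also have "\<dots> = chart_deriv (total_chart G c) (\<lambda>w'. fst (snd (total_chart G c') w')) w (v (total_chart G c))"
      by (rule E.chart_deriv_bl[OF bounded_linear_fst around_total_chart[OF c]
            E.smooth_at_chart_map[OF around_total_chart[OF c']], symmetric])
    also have "\<dots> = prol_deriv G c (\<lambda>w'. snd (fst c') (proj G w')) w (snd c u, snd (v (total_chart G c)))"
      unfolding prol_deriv_def by (simp add: a[symmetric] total_chart_simps)
    also have "\<dots> = base_deriv G c (snd (fst c')) ?p (snd c u)"
      using prol_deriv_pull[OF c M.smooth_at_chart_map[OF around_base_chart[OF c']]] by simp
    also have "\<dots> = coord_change_deriv (fst c) (fst c') ?p (anchor G u (fst c))"
      using anchor_coord[of c u] c u by (simp add: base_deriv_def coord_change_deriv_eq)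
    also have "\<dots> = anchor G u (fst c')"
      using M.tangent_space_change[OF anchor_tangent, of "fst c" u "fst c'"] around_base_chart[OF c]
        around_base_chart[OF c'] u by simp
    finally show ?thesis using d by simp
  next
    case False
    have "anchor G u \<in> tangent_space (base_atlas G) ?p" using anchor_tangent[of u] u by simp
    with False have "anchor G u d = 0" unfolding tangent_space_def by blast
    then show ?thesis using False by (simp add: tangent_map_def Let_def)
  qed
  then show ?thesis using u v by (simp add: prol_fibre_def fun_eq_iff)
qed

lemma prol_elem_eq:
  assumes c: "c \<in> around G (proj G w)"
  shows "prol_elem G c w a b = (fibre_elem G c (proj G w) a,
    tvec_of (total_atlas G) (total_chart G c) w (anc G c (proj G w) a, b))"
proof -
  let ?t = "\<lambda>\<xi>. tvec_of (total_atlas G) (total_chart G c) w \<xi>"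
  have "(\<Sum>\<alpha>\<in>UNIV. a $ \<alpha> *\<^sub>R ?t (anc G c (proj G w) (axis \<alpha> 1), 0) c' + b $ \<alpha> *\<^sub>R ?t (0, axis \<alpha> 1) c') =
      ?t (anc G c (proj G w) a, b) c'" for c'
  proof (cases "c' \<in> charts_at (total_atlas G) w")
    case True
    interpret L: linear "coord_change_deriv (total_chart G c) c' w"
      by (rule E.coord_change_deriv_linear[OF around_total_chart[OF c] True])
    have 1: "linear (\<lambda>a. coord_change_deriv (total_chart G c) c' w (anc G c (proj G w) a, 0))"
      using linear_compose[OF linear_compose[OF anc_linear[OF c] linear_inl] L.linear_axioms] by (simp add: o_def)
    have 2: "linear (\<lambda>b. coord_change_deriv (total_chart G c) c' w (0, b))"
      using linear_compose[OF linear_inr L.linear_axioms] by (simp add: o_def)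
    show ?thesis
      using True sum_axis_linear[OF 1, of a] sum_axis_linear[OF 2, of b]
      by (simp add: tvec_of_def sum.distrib L.add[symmetric])
  qed (simp add: tvec_of_def)
  then show ?thesis
    by (simp add: prol_elem_def basis_X_def basis_V_def local_basis_def anc_def fun_eq_iff)
qed

lemma prol_elem:
  assumes c: "c \<in> around G (proj G w)"
  shows "prol_elem G c w a b \<in> prol_fibre G w" "comps G c (prol_elem G c w a b) = (a, b)"
proof -
  note C = around_total_chart[OF c]
  show "prol_elem G c w a b \<in> prol_fibre G w"
    unfolding prol_elem_eq[OF c]
    by (rule prol_fibreI[OF c fibre_elem(1)[OF c] E.tvec_of_in_tangent_space[OF C]])
      (simp add: E.tvec_of_same[OF C] fibre_elem(2)[OF c])
  show "comps G c (prol_elem G c w a b) = (a, b)"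
    by (simp add: prol_elem_eq[OF c] comps_def fibre_elem(2)[OF c] E.tvec_of_same[OF C])
qed

lemma comps_inj:
  assumes z: "z \<in> prol_fibre G w" "z' \<in> prol_fibre G w" and c: "c \<in> around G (proj G w)"
    and e: "comps G c z = comps G c z'"
  shows "z = z'"
proof (rule prod_eqI)
  note D = prol_fibreD[OF z(1)] and D' = prol_fibreD[OF z(2)]
  show "fst z = fst z'" using e by (intro coord_inj[OF c D(1) D'(1)]) (simp add: comps_def)
  have "snd z (total_chart G c) = snd z' (total_chart G c)"
    unfolding tvec_comps[OF z(1) c] tvec_comps[OF z(2) c] e ..
  then show "snd z = snd z'"
    using E.tangent_space_eq_tvec_of[OF D(2) around_total_chart[OF c]]
      E.tangent_space_eq_tvec_of[OF D'(2) around_total_chart[OF c]] by simp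
qed

lemma prol_deriv_change:
  assumes z: "z \<in> prol_fibre G w" and c: "c \<in> around G (proj G w)" and c': "c' \<in> around G (proj G w)"
    and f: "smooth_E w f"
  shows "prol_deriv G c f w (comps G c z) = prol_deriv G c' f w (comps G c' z)"
  unfolding prol_deriv_def tvec_comps[OF z c, symmetric] tvec_comps[OF z c', symmetric]
    E.tangent_space_change[OF prol_fibreD(2)[OF z] around_total_chart[OF c] around_total_chart[OF c']]
  by (rule E.chart_deriv_change[OF around_total_chart[OF c] around_total_chart[OF c'] f, symmetric])

lemma prol_apply_eq:
  assumes "Z w \<in> prol_fibre G w" "c \<in> around G (proj G w)" "smooth_E w f"
  shows "prol_apply G Z f w = prol_deriv G c f w (comps G c (Z w))"
  unfolding prol_apply_def prol_deriv_def tvec_comps[OF assms(1,2), symmetric]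
  by (rule E.tvec_apply_eq[OF prol_fibreD(2)[OF assms(1)] around_total_chart[OF assms(2)] assms(3)])

lemma snd_comps_change:
  assumes "z \<in> prol_fibre G w" "c \<in> around G (proj G w)" "c' \<in> around G (proj G w)"
  shows "snd (comps G c' z) = prol_deriv G c (snd c') w (comps G c z)"
  unfolding prol_deriv_change[OF assms base_coord_smooth_E(2)[OF assms(3)]]
  by (rule prol_deriv_coord[OF assms(3), symmetric])

lemma comps_smooth_change:
  assumes c: "c \<in> around G (proj G w)" and c': "c' \<in> around G (proj G w)"
    and Z: "\<forall>\<^sub>F w' in nhds w. Z w' \<in> prol_fibre G w'"
  shows "smooth_E w (\<lambda>w'. fst (comps G c (Z w'))) \<Longrightarrow> smooth_E w (\<lambda>w'. fst (comps G c' (Z w')))"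
    and "smooth_E w (\<lambda>w'. comps G c (Z w')) \<Longrightarrow> smooth_E w (\<lambda>w'. comps G c' (Z w'))"
proof -
  obtain T :: "'p \<Rightarrow> real^'k^'k" where T: "smooth_M (proj G w) T"
    "\<forall>\<^sub>F q in nhds (proj G w). \<forall>e. proj G e = q \<longrightarrow> snd c' e = T q *v snd c e"
    using transition[OF c c'] by blast
  show fst_s: "smooth_E w (\<lambda>w'. fst (comps G c' (Z w')))" if "smooth_E w (\<lambda>w'. fst (comps G c (Z w')))"
  proof (rule E.smooth_at_cong)
    show "smooth_E w (\<lambda>w'. T (proj G w') *v fst (comps G c (Z w')))"
      by (rule E.smooth_at_matrix_vector[OF smooth_E_pull[OF T(1)] that])
    show "\<forall>\<^sub>F w' in nhds w. T (proj G w') *v fst (comps G c (Z w')) = fst (comps G c' (Z w'))"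
      using eventually_proj[OF T(2)] Z by eventually_elim (simp add: comps_def prol_fibreD(1))
  qed
  assume s: "smooth_E w (\<lambda>w'. comps G c (Z w'))"
  have "smooth_E w (\<lambda>w'. snd (comps G c' (Z w')))"
  proof (rule E.smooth_at_cong)
    show "smooth_E w (\<lambda>w'. prol_deriv G c (snd c') w' (comps G c (Z w')))"
      by (rule smooth_E_prol_deriv[OF c base_coord_smooth_E(2)[OF c'] s])
    show "\<forall>\<^sub>F w' in nhds w. prol_deriv G c (snd c') w' (comps G c (Z w')) = snd (comps G c' (Z w'))"
      using Z around_eventually_E[OF c] around_eventually_E[OF c']
      by eventually_elim (simp add: snd_comps_change)
  qed
  from E.smooth_at_Pair[OF fst_s[OF E.smooth_at_fst[OF s]] this]
  show "smooth_E w (\<lambda>w'. comps G c' (Z w'))" by simp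
qed

text \<open>The bracket of two smooth sections is only ever evaluated through its \<open>\<X>\<close>-components near a
  point and its value at the point, so smoothness of the \<open>\<X>\<close>-components is singled out.\<close>

definition X_smooth_at :: "'e \<Rightarrow> ('e, 'x, 'k) psec \<Rightarrow> bool" where
  "X_smooth_at w Z \<longleftrightarrow> (\<forall>\<^sub>F w' in nhds w. Z w' \<in> prol_fibre G w') \<and>
     (\<forall>c\<in>around G (proj G w). smooth_E w (\<lambda>w'. fst (comps G c (Z w'))))"

definition sec_smooth_at :: "'e \<Rightarrow> ('e, 'x, 'k) psec \<Rightarrow> bool" where
  "sec_smooth_at w Z \<longleftrightarrow> (\<forall>\<^sub>F w' in nhds w. Z w' \<in> prol_fibre G w') \<and>
     (\<forall>c\<in>around G (proj G w). smooth_E w (\<lambda>w'. comps G c (Z w')))"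

lemma X_smooth_atD:
  assumes "X_smooth_at w Z"
  shows "\<forall>\<^sub>F w' in nhds w. Z w' \<in> prol_fibre G w'" "Z w \<in> prol_fibre G w"
    "c \<in> around G (proj G w) \<Longrightarrow> smooth_E w (\<lambda>w'. fst (comps G c (Z w')))"
  using assms eventually_nhds_x_imp_x[of "\<lambda>w'. Z w' \<in> prol_fibre G w'" w] by (auto simp: X_smooth_at_def)

lemma sec_smooth_atD: "sec_smooth_at w Z \<Longrightarrow> c \<in> around G (proj G w) \<Longrightarrow> smooth_E w (\<lambda>w'. comps G c (Z w'))"
  by (simp add: sec_smooth_at_def)

lemma sec_smooth_at_X: "sec_smooth_at w Z \<Longrightarrow> X_smooth_at w Z"
  by (simp add: sec_smooth_at_def X_smooth_at_def E.smooth_at_fst)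

lemma X_smooth_atI:
  assumes "\<forall>\<^sub>F w' in nhds w. Z w' \<in> prol_fibre G w'" "c \<in> around G (proj G w)"
    "smooth_E w (\<lambda>w'. fst (comps G c (Z w')))"
  shows "X_smooth_at w Z"
  unfolding X_smooth_at_def using comps_smooth_change(1)[OF assms(2) _ assms(1) assms(3)] assms(1) by simp

lemma sec_smooth_atI:
  assumes "\<forall>\<^sub>F w' in nhds w. Z w' \<in> prol_fibre G w'" "c \<in> around G (proj G w)"
    "smooth_E w (\<lambda>w'. comps G c (Z w'))"
  shows "sec_smooth_at w Z"
  unfolding sec_smooth_at_def using comps_smooth_change(2)[OF assms(2) _ assms(1) assms(3)] assms(1) by simp

lemma sec_smooth_at_eventually:
  assumes "sec_smooth_at w Z" shows "\<forall>\<^sub>F w' in nhds w. sec_smooth_at w' Z"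
proof -
  obtain c where c: "c \<in> around G (proj G w)" using around_nonempty by blast
  have "\<forall>\<^sub>F w' in nhds w. \<forall>\<^sub>F w'' in nhds w'. Z w'' \<in> prol_fibre G w''"
    using assms by (simp add: sec_smooth_at_def eventually_eventually)
  then show ?thesis
    using around_eventually_E[OF c] E.smooth_at_eventually[OF sec_smooth_atD[OF assms c]]
    by eventually_elim (rule sec_smooth_atI)
qed

lemma prol_sections_iff:
  assumes W: "open W"
  shows "Z \<in> prol_sections G W \<longleftrightarrow> Z \<in> (\<Pi>\<^sub>E w\<in>W. prol_fibre G w) \<and> (\<forall>w\<in>W. sec_smooth_at w Z)"
proof -
  have pair: "smooth_E w (\<lambda>w'. comps G c (Z w')) \<longleftrightarrow>
      (\<forall>\<alpha>. smooth_E w (\<lambda>w'. dual_X c \<alpha> (Z w')) \<and> smooth_E w (\<lambda>w'. dual_V G c \<alpha> (Z w')))" for w c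
  proof
    assume "smooth_E w (\<lambda>w'. comps G c (Z w'))"
    then show "\<forall>\<alpha>. smooth_E w (\<lambda>w'. dual_X c \<alpha> (Z w')) \<and> smooth_E w (\<lambda>w'. dual_V G c \<alpha> (Z w'))"
      unfolding dual_comps[where G = G] by (intro allI conjI E.smooth_at_vec_nth E.smooth_at_fst E.smooth_at_snd)
  next
    assume "\<forall>\<alpha>. smooth_E w (\<lambda>w'. dual_X c \<alpha> (Z w')) \<and> smooth_E w (\<lambda>w'. dual_V G c \<alpha> (Z w'))"
    then have "smooth_E w (\<lambda>w'. (fst (comps G c (Z w')), snd (comps G c (Z w'))))"
      unfolding dual_comps[where G = G] by (intro E.smooth_at_Pair E.smooth_at_vec) simp_all
    then show "smooth_E w (\<lambda>w'. comps G c (Z w'))" by simp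
  qed
  have mfd: "mfd_smooth_on (total_atlas G) (W \<inter> proj G -` fst (fst c)) h \<longleftrightarrow>
      (\<forall>w\<in>W. c \<in> around G (proj G w) \<longrightarrow> smooth_E w h)" if c: "c \<in> adapted G" for c and h :: "'e \<Rightarrow> real"
  proof -
    have "total_chart G c \<in> total_atlas G" using c by (simp add: total_atlas_def)
    then have "open (proj G -` fst (fst c))" using E.chart_open(1) by (metis total_chart_simps(1))
    with W have "open (W \<inter> proj G -` fst (fst c))" by blast
    from E.mfd_smooth_on_iff[OF this] show ?thesis using c by (auto simp: around_def)
  qed
  have "Z \<in> prol_sections G W \<longleftrightarrow> Z \<in> (\<Pi>\<^sub>E w\<in>W. prol_fibre G w) \<and>
      (\<forall>w\<in>W. \<forall>c\<in>around G (proj G w). smooth_E w (\<lambda>w'. comps G c (Z w')))"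
    unfolding prol_sections_def pair using aroundD(1) by (auto simp: mfd)
  moreover have "\<forall>\<^sub>F w' in nhds w. Z w' \<in> prol_fibre G w'" if "Z \<in> (\<Pi>\<^sub>E w\<in>W. prol_fibre G w)" "w \<in> W" for w
    using eventually_nhds_in_open[OF W that(2)] by eventually_elim (rule PiE_mem[OF that(1)])
  ultimately show ?thesis unfolding sec_smooth_at_def by blast
qed

lemma sec_smooth_at_cong:
  assumes "sec_smooth_at w Y" "\<forall>\<^sub>F w' in nhds w. Y w' = Z w'" shows "sec_smooth_at w Z"
proof -
  obtain c where c: "c \<in> around G (proj G w)" using around_nonempty by blast
  have "\<forall>\<^sub>F w' in nhds w. Y w' \<in> prol_fibre G w'" using assms(1) by (simp add: sec_smooth_at_def)
  with assms(2) have 1: "\<forall>\<^sub>F w' in nhds w. Z w' \<in> prol_fibre G w'" by eventually_elim simp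
  have 2: "\<forall>\<^sub>F w' in nhds w. comps G c (Y w') = comps G c (Z w')" using assms(2) by eventually_elim simp
  show ?thesis
    by (rule sec_smooth_atI[OF 1 c E.smooth_at_cong[OF sec_smooth_atD[OF assms(1) c] 2]])
qed

lemma prol_sectionsI:
  assumes "open W" "\<And>w. w \<in> W \<Longrightarrow> Z w \<in> prol_fibre G w" "\<And>w. w \<in> W \<Longrightarrow> sec_smooth_at w Z"
  shows "restrict Z W \<in> prol_sections G W"
  unfolding prol_sections_iff[OF assms(1)]
proof (intro conjI ballI)
  show "restrict Z W \<in> (\<Pi>\<^sub>E w\<in>W. prol_fibre G w)" using assms(2) by auto
  fix w assume w: "w \<in> W"
  show "sec_smooth_at w (restrict Z W)"
    by (rule sec_smooth_at_cong[OF assms(3)[OF w]])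
      (use eventually_nhds_in_open[OF assms(1) w] in \<open>eventually_elim, simp\<close>)
qed

lemma zero_prol:
  "(vb_zero G (proj G w), \<lambda>_. 0) \<in> prol_fibre G w" (is "?z \<in> _")
  "c \<in> around G (proj G w) \<Longrightarrow> comps G c (vb_zero G (proj G w), \<lambda>_. 0) = 0"
proof -
  show c0: "comps G c ?z = 0" if "c \<in> around G (proj G w)" for c
    using vb_zero(2)[OF that] by (simp add: comps_def zero_prod_def)
  obtain c where c: "c \<in> around G (proj G w)" using around_nonempty by blast
  have "(\<lambda>_. 0) \<in> tangent_space (total_atlas G) w"
    using linear_0[OF E.coord_change_deriv_linear] by (simp add: tangent_space_def)
  then show "?z \<in> prol_fibre G w"
    by (rule prol_fibreI[OF c vb_zero(1)]) (simp add: vb_zero(2)[OF c] linear_0[OF anc_linear[OF c]])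
qed

text \<open>Forms are tested on globally defined sections only, so pointwise statements require that these
  pass through every element of every fibre.\<close>

lemma section_through:
  assumes z: "z \<in> prol_fibre G w"
  obtains Z where "\<forall>w'. Z w' \<in> prol_fibre G w'" "\<forall>w'. sec_smooth_at w' Z" "Z w = z"
proof -
  obtain c where c: "c \<in> around G (proj G w)" using around_nonempty by blast
  let ?N = "fst (total_chart G c)"
  have N: "w' \<in> ?N \<longleftrightarrow> c \<in> around G (proj G w')" for w'
    using aroundD(1)[OF c] by (simp add: total_chart_simps around_def)
  have No: "open ?N" by (rule E.chart_open(1)[OF E.charts_atD(1)[OF around_total_chart[OF c]]])
  obtain F where F1: "\<forall>q. smooth_E q F" and F2: "\<forall>\<^sub>F q in nhds w. F q = comps G c z"
    and F3: "\<forall>q. q \<notin> ?N \<longrightarrow> (\<forall>\<^sub>F q' in nhds q. F q' = 0)"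
    by (rule E.smooth_extension[OF E.smooth_at_const[where k = "comps G c z"] No], rule N[THEN iffD2, OF c], rule that)
  define Z where "Z w' = (if w' \<in> ?N then prol_elem G c w' (fst (F w')) (snd (F w'))
      else (vb_zero G (proj G w'), \<lambda>_. 0))" for w'
  have Zf: "Z w' \<in> prol_fibre G w'" for w'
  proof (cases "w' \<in> ?N")
    case True
    then show ?thesis using prol_elem(1) N by (simp add: Z_def)
  next
    case False
    then show ?thesis using zero_prol(1) by (simp add: Z_def)
  qed
  have Zc: "comps G c (Z w') = F w'" if "w' \<in> ?N" for w'
    using that prol_elem(2) N by (simp add: Z_def)
  have Zs: "sec_smooth_at w' Z" for w'
  proof (cases "w' \<in> ?N")
    case True
    have ev: "\<forall>\<^sub>F v in nhds w'. F v = comps G c (Z v)"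
      using eventually_nhds_in_open[OF No True] by eventually_elim (simp add: Zc)
    show ?thesis
      by (rule sec_smooth_atI[OF always_eventually[OF allI[OF Zf]] N[THEN iffD1, OF True]
            E.smooth_at_cong[OF F1[rule_format] ev]])
  next
    case False
    obtain d where d: "d \<in> around G (proj G w')" using around_nonempty by blast
    have "\<forall>\<^sub>F v in nhds w'. F v = 0" by (rule F3[rule_format, OF False])
    then have "\<forall>\<^sub>F v in nhds w'. 0 = comps G d (Z v)"
      using around_eventually_E[OF d]
    proof eventually_elim
      case (elim v)
      have "Z v = (vb_zero G (proj G v), \<lambda>_. 0)"
      proof (cases "v \<in> ?N")
        case True
        show ?thesis
          by (rule comps_inj[OF Zf zero_prol(1)], rule N[THEN iffD1, OF True])
            (use zero_prol(2) N True Zc elim(1) in auto)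
      qed (simp add: Z_def)
      then show ?case using zero_prol(2)[OF elim(2)] by simp
    qed
    then have "smooth_E w' (\<lambda>v. comps G d (Z v))" by (rule E.smooth_at_cong[OF E.smooth_at_const])
    then show ?thesis by (rule sec_smooth_atI[OF always_eventually[OF allI[OF Zf]] d])
  qed
  have "Z w = z"
    by (rule comps_inj[OF Zf z c]) (use Zc N c eventually_nhds_x_imp_x[OF F2] in auto)
  with Zf Zs show ?thesis by (intro that[of Z] allI)
qed

subsection \<open>Derivatives along sections\<close>

text \<open>The derivative \<open>Z(f)\<close> also of vector-valued \<open>f\<close>, which makes it applicable to the components of sections.\<close>

definition along :: "('e, 'x, 'k) psec \<Rightarrow> ('e \<Rightarrow> 'b::real_normed_vector) \<Rightarrow> 'e \<Rightarrow> 'b" where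
  "along Z f w = prol_deriv G (adapted_at G (proj G w)) f w (comps G (adapted_at G (proj G w)) (Z w))"

lemma along_eq:
  "Z w \<in> prol_fibre G w \<Longrightarrow> c \<in> around G (proj G w) \<Longrightarrow> smooth_E w f \<Longrightarrow>
   along Z f w = prol_deriv G c f w (comps G c (Z w))"
  unfolding along_def by (rule prol_deriv_change[OF _ adapted_at])

lemma prol_apply_along: "Z w \<in> prol_fibre G w \<Longrightarrow> smooth_E w f \<Longrightarrow> prol_apply G Z f w = along Z f w"
  unfolding along_def by (rule prol_apply_eq[OF _ adapted_at])

lemma along_cong: "\<forall>\<^sub>F w' in nhds w. f w' = g w' \<Longrightarrow> along Z f w = along Z g w"
  unfolding along_def by (rule prol_deriv_cong[OF adapted_at])

lemma along_smooth:
  assumes Z: "sec_smooth_at w Z" and f: "smooth_E w f" shows "smooth_E w (along Z f)"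
proof -
  obtain c where c: "c \<in> around G (proj G w)" using around_nonempty by blast
  show ?thesis
  proof (rule E.smooth_at_cong[OF smooth_E_prol_deriv[OF c f sec_smooth_atD[OF Z c]]])
    show "\<forall>\<^sub>F w' in nhds w. prol_deriv G c f w' (comps G c (Z w')) = along Z f w'"
      using around_eventually_E[OF c] E.smooth_at_eventually[OF f] X_smooth_atD(1)[OF sec_smooth_at_X[OF Z]]
      by eventually_elim (simp add: along_eq)
  qed
qed

lemma prol_bracket_in_fibre: "prol_bracket G Y Z w \<in> prol_fibre G w"
  unfolding prol_bracket_def Let_def by (rule prol_elem(1)[OF adapted_at])

lemma comps_prol_bracket:
  assumes "c = adapted_at G (proj G w)"
  shows "comps G c (prol_bracket G Y Z w) =
    ((\<chi> \<gamma>. prol_apply G Y (\<lambda>w'. dual_X c \<gamma> (Z w')) w - prol_apply G Z (\<lambda>w'. dual_X c \<gamma> (Y w')) w +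
         (\<Sum>\<alpha>\<in>UNIV. \<Sum>\<beta>\<in>UNIV.
            dual_X c \<alpha> (Y w) * dual_X c \<beta> (Z w) * structure_fun G c \<alpha> \<beta> \<gamma> (proj G w))),
     (\<chi> \<gamma>. prol_apply G Y (\<lambda>w'. dual_V G c \<gamma> (Z w')) w - prol_apply G Z (\<lambda>w'. dual_V G c \<gamma> (Y w')) w))"
  unfolding assms prol_bracket_def Let_def by (rule prol_elem(2)[OF adapted_at])

lemma prol_bracket_fst_adapted:
  assumes Y: "X_smooth_at w Y" and Z: "X_smooth_at w Z" and c_def: "c = adapted_at G (proj G w)"
  shows "fst (comps G c (prol_bracket G Y Z w)) = along Y (\<lambda>w'. fst (comps G c (Z w'))) w -
    along Z (\<lambda>w'. fst (comps G c (Y w'))) w +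
    struct G c (proj G w) (fst (comps G c (Y w))) (fst (comps G c (Z w)))"
proof -
  have c: "c \<in> around G (proj G w)" unfolding c_def by (rule adapted_at)
  have ap: "prol_apply G Y (\<lambda>w'. dual_X c \<gamma> (Z w')) w = along Y (\<lambda>w'. fst (comps G c (Z w'))) w $ \<gamma>"
    if Y: "X_smooth_at w Y" and Z: "X_smooth_at w Z" for Y Z \<gamma>
    unfolding dual_comps(1)[where G = G] along_eq[where Z = Y, OF X_smooth_atD(2)[OF Y] c X_smooth_atD(3)[OF Z c]]
      prol_apply_eq[where Z = Y, OF X_smooth_atD(2)[OF Y] c E.smooth_at_vec_nth[OF X_smooth_atD(3)[OF Z c]]]
    by (rule prol_deriv_bl[OF bounded_linear_vec_nth c X_smooth_atD(3)[OF Z c]])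
  show ?thesis
    unfolding comps_prol_bracket[OF c_def] fst_conv ap[OF Y Z] ap[OF Z Y]
    by (simp add: vec_eq_iff struct_def dual_comps(1)[where G = G])
qed

lemma prol_bracket_snd_adapted:
  assumes Y: "sec_smooth_at w Y" and Z: "sec_smooth_at w Z" and c_def: "c = adapted_at G (proj G w)"
  shows "snd (comps G c (prol_bracket G Y Z w)) = along Y (\<lambda>w'. snd (comps G c (Z w'))) w -
    along Z (\<lambda>w'. snd (comps G c (Y w'))) w"
proof -
  have c: "c \<in> around G (proj G w)" unfolding c_def by (rule adapted_at)
  have ap: "prol_apply G Y (\<lambda>w'. dual_V G c \<gamma> (Z w')) w = along Y (\<lambda>w'. snd (comps G c (Z w'))) w $ \<gamma>"
    if Y: "sec_smooth_at w Y" and Z: "sec_smooth_at w Z" for Y Z \<gamma>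
  proof -
    note Yf = X_smooth_atD(2)[OF sec_smooth_at_X[OF Y]]
    note s = E.smooth_at_snd[OF sec_smooth_atD[OF Z c]]
    show ?thesis
      unfolding dual_comps(2) along_eq[where Z = Y, OF Yf c s] prol_apply_eq[where Z = Y, OF Yf c E.smooth_at_vec_nth[OF s]]
      by (rule prol_deriv_bl[OF bounded_linear_vec_nth c s])
  qed
  show ?thesis
    unfolding comps_prol_bracket[OF c_def] snd_conv ap[OF Y Z] ap[OF Z Y] by (simp add: vec_eq_iff)
qed

text \<open>The anchor of \<open>\<T>E\<close> is a homomorphism; equivalently, \<open>d\<^sup>E d\<^sup>E f = 0\<close>.\<close>

lemma along_bracket:
  fixes f :: "'e \<Rightarrow> 'b::real_inner"
  assumes Y: "sec_smooth_at w Y" and Z: "sec_smooth_at w Z" and f: "smooth_E w f"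
  shows "along (prol_bracket G Y Z) f w = along Y (along Z f) w - along Z (along Y f) w"
proof -
  define c where "c = adapted_at G (proj G w)"
  have c: "c \<in> around G (proj G w)" unfolding c_def by (rule adapted_at)
  note Yx = sec_smooth_at_X[OF Y] and Zx = sec_smooth_at_X[OF Z]
  note Yf = X_smooth_atD(2)[OF Yx] and Zf = X_smooth_atD(2)[OF Zx]
  note Ys = sec_smooth_atD[OF Y c] and Zs = sec_smooth_atD[OF Z c]
  have ev: "\<forall>\<^sub>F w' in nhds w. along V f w' = prol_deriv G c f w' (comps G c (V w'))" if V: "X_smooth_at w V" for V
    using around_eventually_E[OF c] E.smooth_at_eventually[OF f] X_smooth_atD(1)[OF V]
    by eventually_elim (simp add: along_eq)
  have "comps G c (prol_bracket G Y Z w) =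
      prol_deriv G c (\<lambda>w'. comps G c (Z w')) w (comps G c (Y w)) -
      prol_deriv G c (\<lambda>w'. comps G c (Y w')) w (comps G c (Z w)) +
      (struct G c (proj G w) (fst (comps G c (Y w))) (fst (comps G c (Z w))), 0)" (is "?B = ?R")
  proof (rule prod_eqI)
    show "fst ?B = fst ?R"
      unfolding prol_bracket_fst_adapted[OF Yx Zx c_def] along_eq[where Z = Y, OF Yf c E.smooth_at_fst[OF Zs]]
        along_eq[where Z = Z, OF Zf c E.smooth_at_fst[OF Ys]] prol_deriv_bl[OF bounded_linear_fst c Ys]
        prol_deriv_bl[OF bounded_linear_fst c Zs] by simp
    show "snd ?B = snd ?R"
      unfolding prol_bracket_snd_adapted[OF Y Z c_def] along_eq[where Z = Y, OF Yf c E.smooth_at_snd[OF Zs]]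
        along_eq[where Z = Z, OF Zf c E.smooth_at_snd[OF Ys]] prol_deriv_bl[OF bounded_linear_snd c Ys]
        prol_deriv_bl[OF bounded_linear_snd c Zs] by simp
  qed
  then have "along (prol_bracket G Y Z) f w = prol_deriv G c f w ?R"
    unfolding along_eq[where Z = "prol_bracket G Y Z", OF prol_bracket_in_fibre c f] by simp
  also have "\<dots> = prol_deriv G c (\<lambda>w'. prol_deriv G c f w' (comps G c (Z w'))) w (comps G c (Y w)) -
      prol_deriv G c (\<lambda>w'. prol_deriv G c f w' (comps G c (Y w'))) w (comps G c (Z w))"
    by (rule prol_deriv_commutator[OF c f Ys Zs, symmetric])
  also have "prol_deriv G c (\<lambda>w'. prol_deriv G c f w' (comps G c (Z w'))) w (comps G c (Y w)) = along Y (along Z f) w"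
    unfolding along_cong[OF ev[OF Zx]] by (rule along_eq[where Z = Y, OF Yf c smooth_E_prol_deriv[OF c f Zs], symmetric])
  also have "prol_deriv G c (\<lambda>w'. prol_deriv G c f w' (comps G c (Y w'))) w (comps G c (Z w)) = along Z (along Y f) w"
    unfolding along_cong[OF ev[OF Yx]] by (rule along_eq[where Z = Z, OF Zf c smooth_E_prol_deriv[OF c f Ys], symmetric])
  finally show ?thesis .
qed

text \<open>The formula defining the bracket is evaluated in coordinates that are chosen anew at each point. That
  it may be evaluated in fixed coordinates, and so be differentiated, rests on the transformation rule
  of the structure functions: their inhomogeneous terms compensate the derivatives of \<open>T\<close>.\<close>

lemma prol_bracket_fst:
  assumes Y: "X_smooth_at w Y" and Z: "X_smooth_at w Z" and c': "c' \<in> around G (proj G w)"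
  shows "fst (comps G c' (prol_bracket G Y Z w)) = along Y (\<lambda>w'. fst (comps G c' (Z w'))) w -
    along Z (\<lambda>w'. fst (comps G c' (Y w'))) w +
    struct G c' (proj G w) (fst (comps G c' (Y w))) (fst (comps G c' (Z w)))"
proof -
  let ?p = "proj G w"
  define c where "c = adapted_at G ?p"
  have c: "c \<in> around G ?p" unfolding c_def by (rule adapted_at)
  obtain T :: "'p \<Rightarrow> real^'k^'k" where T: "smooth_M ?p T"
    "\<forall>\<^sub>F q in nhds ?p. \<forall>e. proj G e = q \<longrightarrow> snd c' e = T q *v snd c e"
    using transition[OF c c'] by blast
  note Tp = eventually_nhds_x_imp_x[OF T(2), rule_format]
  have Tz: "fst (comps G c' z) = T ?p *v fst (comps G c z)" if "z \<in> prol_fibre G w" for z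
    using Tp[OF prol_fibreD(1)[OF that]] by (simp add: comps_def)
  have al: "along Y (\<lambda>w'. fst (comps G c' (Z w'))) w =
      base_deriv G c' (\<lambda>q. T q *v fst (comps G c (Z w))) ?p (T ?p *v fst (comps G c (Y w))) +
      T ?p *v along Y (\<lambda>w'. fst (comps G c (Z w'))) w"
    if Y: "X_smooth_at w Y" and Z: "X_smooth_at w Z" for Y Z
  proof -
    have Zs: "smooth_E w (\<lambda>w'. fst (comps G c (Z w')))" by (rule X_smooth_atD(3)[OF Z c])
    note Yf = X_smooth_atD(2)[OF Y]
    have "\<forall>\<^sub>F w' in nhds w. fst (comps G c' (Z w')) = T (proj G w') *v fst (comps G c (Z w'))"
      using eventually_proj[OF T(2)] X_smooth_atD(1)[OF Z]
      by eventually_elim (simp add: comps_def prol_fibreD(1))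
    then have "along Y (\<lambda>w'. fst (comps G c' (Z w'))) w = along Y (\<lambda>w'. T (proj G w') *v fst (comps G c (Z w'))) w"
      by (rule along_cong)
    also have "\<dots> = base_deriv G c (\<lambda>q. T q *v fst (comps G c (Z w))) ?p (fst (comps G c (Y w))) +
        T ?p *v prol_deriv G c (\<lambda>w'. fst (comps G c (Z w'))) w (comps G c (Y w))"
      unfolding along_eq[where Z = Y, OF Yf c E.smooth_at_matrix_vector[OF smooth_E_pull[OF T(1)] Zs]]
      by (rule prol_deriv_matrix[OF c T(1) Zs])
    also have "prol_deriv G c (\<lambda>w'. fst (comps G c (Z w'))) w (comps G c (Y w)) = along Y (\<lambda>w'. fst (comps G c (Z w'))) w"
      by (rule along_eq[where Z = Y, OF Yf c Zs, symmetric])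
    also have "base_deriv G c (\<lambda>q. T q *v fst (comps G c (Z w))) ?p (fst (comps G c (Y w))) =
        base_deriv G c' (\<lambda>q. T q *v fst (comps G c (Z w))) ?p (T ?p *v fst (comps G c (Y w)))"
      using base_deriv_change[of c "fst (Y w)" c' "\<lambda>q. T q *v fst (comps G c (Z w))"] c c'
        prol_fibreD(1)[OF Yf] M.smooth_at_matrix_vector[OF T(1) M.smooth_at_const] Tz[OF Yf]
      by (simp add: comps_def)
    finally show ?thesis .
  qed
  show ?thesis
    unfolding Tz[OF prol_bracket_in_fibre] Tz[OF X_smooth_atD(2)[OF Y]] Tz[OF X_smooth_atD(2)[OF Z]]
      al[OF Y Z] al[OF Z Y] prol_bracket_fst_adapted[OF Y Z c_def]
    using struct_change[OF c c' T(2), of "fst (comps G c (Y w))" "fst (comps G c (Z w))"]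
    by (simp add: matrix_vector_right_distrib matrix_vector_mult_diff_distrib)
qed

lemma prol_bracket_X_smooth:
  assumes Y: "sec_smooth_at w Y" and Z: "sec_smooth_at w Z"
  shows "X_smooth_at w (prol_bracket G Y Z)"
proof -
  obtain c where c: "c \<in> around G (proj G w)" using around_nonempty by blast
  note Ys = E.smooth_at_fst[OF sec_smooth_atD[OF Y c]] and Zs = E.smooth_at_fst[OF sec_smooth_atD[OF Z c]]
  have ev: "\<forall>\<^sub>F w' in nhds w. along Y (\<lambda>w'. fst (comps G c (Z w'))) w' -
      along Z (\<lambda>w'. fst (comps G c (Y w'))) w' +
      struct G c (proj G w') (fst (comps G c (Y w'))) (fst (comps G c (Z w'))) =
      fst (comps G c (prol_bracket G Y Z w'))"
    using around_eventually_E[OF c] sec_smooth_at_eventually[OF Y] sec_smooth_at_eventually[OF Z]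
    by eventually_elim (rule prol_bracket_fst[symmetric, OF sec_smooth_at_X sec_smooth_at_X])
  have sm: "smooth_E w (\<lambda>w'. along Y (\<lambda>w'. fst (comps G c (Z w'))) w' -
      along Z (\<lambda>w'. fst (comps G c (Y w'))) w' +
      struct G c (proj G w') (fst (comps G c (Y w'))) (fst (comps G c (Z w'))))"
    by (intro E.smooth_at_add E.smooth_at_diff along_smooth[OF Y Zs] along_smooth[OF Z Ys]
        prol_deriv_struct(2)[OF c Ys Zs])
  have "smooth_E w (\<lambda>w'. fst (comps G c (prol_bracket G Y Z w')))"
    by (rule E.smooth_at_cong[OF sm ev])
  then show ?thesis
    by (rule X_smooth_atI[OF always_eventually[OF allI[OF prol_bracket_in_fibre]] c])
qed

end

section \<open>The exterior derivative in low degrees\<close>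

lemma ext_d_1: "ext_d G \<omega> [Z] w = prol_apply G Z (\<omega> []) w"
  by (simp add: ext_d_def)

lemma nths_pair: "nths [Y, Z] (- {0}) = [Z]" "nths [Y, Z] (- {Suc 0}) = [Y]" "nths [Y, Z] (- {0, Suc 0}) = []"
  by (simp_all add: nths_Cons)

lemma ext_d_2:
  "ext_d G \<omega> [Y, Z] w = prol_apply G Y (\<omega> [Z]) w - prol_apply G Z (\<omega> [Y]) w - \<omega> [prol_bracket G Y Z] w"
  by (simp add: ext_d_def lessThan_Suc nths_pair)

lemma nths_triple:
  "nths [X, Y, Z] (- {0}) = [Y, Z]" "nths [X, Y, Z] (- {Suc 0}) = [X, Z]"
  "nths [X, Y, Z] (- {Suc (Suc 0)}) = [X, Y]" "nths [X, Y, Z] (- {0, Suc 0}) = [Z]"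
  "nths [X, Y, Z] (- {0, Suc (Suc 0)}) = [Y]" "nths [X, Y, Z] (- {Suc 0, Suc (Suc 0)}) = [X]"
  by (simp_all add: nths_Cons)

lemma ext_d_3:
  "ext_d G \<omega> [X, Y, Z] w = prol_apply G X (\<omega> [Y, Z]) w - prol_apply G Y (\<omega> [X, Z]) w + prol_apply G Z (\<omega> [X, Y]) w -
    \<omega> [prol_bracket G X Y, Z] w + \<omega> [prol_bracket G X Z, Y] w - \<omega> [prol_bracket G Y Z, X] w"
  by (simp add: ext_d_def lessThan_Suc nths_triple)

lemma prol_apply_zero [simp]: "prol_apply G Z (\<lambda>_. 0) w = 0"
  by (simp add: prol_apply_def tvec_apply_def Let_def o_def)

text \<open>Forms are operators on lists of any length; a form of degree \<open>k\<close> has its exterior derivative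
  in degree \<open>k + 1\<close> only.\<close>

definition form_degree :: "nat \<Rightarrow> ('e, 'x, 'k) pform \<Rightarrow> bool" where
  "form_degree k \<omega> \<longleftrightarrow> (\<forall>Zs. length Zs \<noteq> k \<longrightarrow> \<omega> Zs = (\<lambda>_. 0))"

lemma form_degreeD: "form_degree k \<omega> \<Longrightarrow> length Zs \<noteq> k \<Longrightarrow> \<omega> Zs = (\<lambda>_. 0)"
  by (simp add: form_degree_def)

lemma form_degree_ext_d:
  fixes \<omega> :: "('e, 'x::real_normed_vector, 'k::finite) pform"
  assumes "form_degree k \<omega>" shows "form_degree (Suc k) (ext_d G \<omega>)"
  unfolding form_degree_def
proof (intro allI impI ext)
  fix Zs :: "('e, 'x, 'k) psec list" and w
  assume len: "length Zs \<noteq> Suc k"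
  have 1: "\<omega> (nths Zs (- {i})) = (\<lambda>_. 0)" if "i < length Zs" for i
  proof (rule form_degreeD[OF assms])
    have "{j. j < length Zs \<and> j \<in> - {i}} = {..<length Zs} - {i}" by auto
    then show "length (nths Zs (- {i})) \<noteq> k" using that len by (simp add: length_nths)
  qed
  have 2: "\<omega> (V # nths Zs (- {i, j})) = (\<lambda>_. 0)" if "i < j" "j < length Zs" for i j V
  proof (rule form_degreeD[OF assms])
    have "{l. l < length Zs \<and> l \<in> - {i, j}} = {..<length Zs} - {i, j}" by auto
    then have "length (nths Zs (- {i, j})) = length Zs - 2"
      using that by (simp add: length_nths card_Diff_subset)
    then show "length (V # nths Zs (- {i, j})) \<noteq> k" using that len by simp
  qed
  show "ext_d G \<omega> Zs w = 0"
    unfolding ext_d_def by (simp add: 1 2)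
qed

lemma form_degree_inner_prod: "form_degree (Suc k) \<omega> \<Longrightarrow> form_degree k (inner_prod X \<omega>)"
  by (simp add: form_degree_def inner_prod_def)

lemma form_degree_fun_form: "form_degree 0 (fun_form f)"
  by (auto simp: form_degree_def fun_form_def)

lemma fun_form_Nil [simp]: "fun_form f [] = f"
  by (simp add: fun_form_def fun_eq_iff)

lemma inner_prod_fun_form [simp]: "inner_prod X (fun_form f) Zs = (\<lambda>_. 0)"
  by (simp add: inner_prod_def fun_form_def fun_eq_iff)

lemma ext_d_zero: "ext_d G (\<lambda>_ _. 0) Zs w = 0"
  by (simp add: ext_d_def)

lemma form_degree_lie_deriv:
  fixes \<omega> :: "('e, 'x::real_normed_vector, 'k::finite) pform"
  assumes "form_degree k \<omega>" shows "form_degree k (lie_deriv G X \<omega>)"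
proof -
  have 1: "form_degree k (inner_prod X (ext_d G \<omega>))"
    by (rule form_degree_inner_prod[OF form_degree_ext_d[OF assms]])
  have 2: "form_degree k (ext_d G (inner_prod X \<omega>))"
  proof (cases k)
    case 0
    have "inner_prod X \<omega> Zs w = 0" for Zs w
      using form_degreeD[OF assms, of "X # Zs"] 0 by (simp add: inner_prod_def)
    then have e: "inner_prod X \<omega> = (\<lambda>_ _. 0)" by (intro ext)
    show ?thesis unfolding e by (simp add: form_degree_def fun_eq_iff ext_d_zero)
  next
    case (Suc j)
    show ?thesis
      unfolding Suc by (rule form_degree_ext_d[OF form_degree_inner_prod[OF assms[unfolded Suc]]])
  qed
  show ?thesis
    unfolding form_degree_def
  proof (intro allI impI ext)
    fix Zs :: "('e, 'x, 'k) psec list" and w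
    assume "length Zs \<noteq> k"
    then show "lie_deriv G X \<omega> Zs w = 0"
      using form_degreeD[OF 1, of Zs] form_degreeD[OF 2, of Zs] by (simp add: lie_deriv_def)
  qed
qed

lemma form_degree_cartan_1: "form_degree 1 (cartan_1 G L)"
  unfolding form_degree_def cartan_1_def by (auto simp: fun_eq_iff split: list.splits)

lemma form_degree_cartan_2: "form_degree 2 (cartan_2 G L)"
  using form_degree_ext_d[OF form_degree_cartan_1] by (simp add: cartan_2_def numeral_2_eq_2)

context Lie_algebroid
begin

lemma along_add: "smooth_E w f \<Longrightarrow> smooth_E w g \<Longrightarrow> along Z (\<lambda>w'. f w' + g w') w = along Z f w + along Z g w"
  unfolding along_def by (rule prol_deriv_add[OF adapted_at])

lemma along_diff: "smooth_E w f \<Longrightarrow> smooth_E w g \<Longrightarrow> along Z (\<lambda>w'. f w' - g w') w = along Z f w - along Z g w"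
  unfolding along_def by (rule prol_deriv_diff[OF adapted_at])

lemma along_struct:
  assumes Z: "X_smooth_at w Z" and c: "c \<in> around G (proj G w)" and a: "smooth_E w a" and b: "smooth_E w b"
  shows "along Z (\<lambda>w'. struct G c (proj G w') (a w') (b w')) w =
      base_deriv G c (\<lambda>q. struct G c q (a w) (b w)) (proj G w) (fst (comps G c (Z w))) +
      struct G c (proj G w) (along Z a w) (b w) + struct G c (proj G w) (a w) (along Z b w)"
  unfolding along_eq[where Z = Z, OF X_smooth_atD(2)[OF Z] c prol_deriv_struct(2)[OF c a b]]
    along_eq[where Z = Z, OF X_smooth_atD(2)[OF Z] c a] along_eq[where Z = Z, OF X_smooth_atD(2)[OF Z] c b]
  by (rule prol_deriv_struct(1)[OF c a b])

text \<open>The second derivatives of the components cancel by \<open>along_bracket\<close>, the products of a first derivative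
  with a structure function by skew symmetry, and the rest is the Jacobi identity of the structure
  functions. The order of the terms is the one in which they appear in \<open>d\<^sup>E\<close> of a 2-form.\<close>

lemma prol_bracket_jacobi:
  assumes X: "sec_smooth_at w X" and Y: "sec_smooth_at w Y" and Z: "sec_smooth_at w Z"
    and c: "c \<in> around G (proj G w)"
  shows "fst (comps G c (prol_bracket G (prol_bracket G X Y) Z w)) -
    fst (comps G c (prol_bracket G (prol_bracket G X Z) Y w)) +
    fst (comps G c (prol_bracket G (prol_bracket G Y Z) X w)) = 0"
proof -
  let ?p = "proj G w"
  let ?S = "struct G c ?p"
  define x where "x V w' = fst (comps G c (V w'))" for V :: "('e, 'x, 'k) psec" and w'
  have xs: "smooth_E w (x V)" if "sec_smooth_at w V" for V
    unfolding x_def by (rule E.smooth_at_fst[OF sec_smooth_atD[OF that c]])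
  interpret S: bounded_bilinear ?S by (rule struct_bounded_bilinear)
  have br: "fst (comps G c (prol_bracket G (prol_bracket G X Y) Z w)) =
      along X (along Y (x Z)) w - along Y (along X (x Z)) w - along Z (along X (x Y)) w + along Z (along Y (x X)) w -
      base_deriv G c (\<lambda>q. struct G c q (x X w) (x Y w)) ?p (x Z w) -
      ?S (along Z (x X) w) (x Y w) - ?S (x X w) (along Z (x Y) w) +
      ?S (along X (x Y) w) (x Z w) - ?S (along Y (x X) w) (x Z w) + ?S (?S (x X w) (x Y w)) (x Z w)"
    if X: "sec_smooth_at w X" and Y: "sec_smooth_at w Y" and Z: "sec_smooth_at w Z" for X Y Z
  proof -
    note XYx = prol_bracket_X_smooth[OF X Y]
    have ev: "\<forall>\<^sub>F w' in nhds w. x (prol_bracket G X Y) w' =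
        along X (x Y) w' - along Y (x X) w' + struct G c (proj G w') (x X w') (x Y w')"
      using around_eventually_E[OF c] sec_smooth_at_eventually[OF X] sec_smooth_at_eventually[OF Y]
      unfolding x_def by eventually_elim (rule prol_bracket_fst[OF sec_smooth_at_X sec_smooth_at_X])
    have "along Z (x (prol_bracket G X Y)) w =
        along Z (along X (x Y)) w - along Z (along Y (x X)) w +
        along Z (\<lambda>w'. struct G c (proj G w') (x X w') (x Y w')) w"
      unfolding along_cong[OF ev]
      by (simp add: along_add along_diff E.smooth_at_diff along_smooth X Y xs prol_deriv_struct(2)[OF c])
    moreover have "along (prol_bracket G X Y) (x Z) w = along X (along Y (x Z)) w - along Y (along X (x Z)) w"
      by (rule along_bracket[OF X Y xs[OF Z]])
    moreover have "fst (comps G c (prol_bracket G (prol_bracket G X Y) Z w)) =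
        along (prol_bracket G X Y) (x Z) w - along Z (x (prol_bracket G X Y)) w +
        ?S (x (prol_bracket G X Y) w) (x Z w)"
      unfolding x_def by (rule prol_bracket_fst[OF XYx sec_smooth_at_X[OF Z] c])
    ultimately show ?thesis
      using along_struct[OF sec_smooth_at_X[OF Z] c xs[OF X] xs[OF Y]] eventually_nhds_x_imp_x[OF ev]
      by (simp add: S.add_left S.diff_left x_def[symmetric])
  qed
  have anti: "?S a b = - ?S b a" for a b by (rule struct_antisym[OF c])
  have "base_deriv G c (\<lambda>q. struct G c q (x X w) (x Z w)) ?p (x Y w) =
      - base_deriv G c (\<lambda>q. struct G c q (x Z w) (x X w)) ?p (x Y w)"
  proof -
    have "\<forall>\<^sub>F q in nhds ?p. struct G c q (x X w) (x Z w) = - struct G c q (x Z w) (x X w)"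
      using around_eventually[OF c] by eventually_elim (rule struct_antisym)
    from base_deriv_cong[OF c this, of "x Y w"] show ?thesis
      using M.chart_deriv_bl[OF bounded_linear_minus[OF bounded_linear_ident] around_base_chart[OF c]
          smooth_M_struct[OF c M.smooth_at_const M.smooth_at_const]]
      by (simp add: base_deriv_def)
  qed
  moreover note struct_jacobi[OF c, of "x Y w" "x Z w" "x X w"]
  moreover have "?S (?S (x X w) (x Y w)) (x Z w) = - ?S (x Z w) (?S (x X w) (x Y w))"
    "?S (?S (x X w) (x Z w)) (x Y w) = ?S (x Y w) (?S (x Z w) (x X w))"
    "?S (?S (x Y w) (x Z w)) (x X w) = - ?S (x X w) (?S (x Y w) (x Z w))"
  proof -
    show "?S (?S (x X w) (x Z w)) (x Y w) = ?S (x Y w) (?S (x Z w) (x X w))"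
      unfolding anti[of "x X w" "x Z w"] S.minus_left anti[of "?S (x Z w) (x X w)" "x Y w"] by simp
  qed (rule anti)+
  moreover have "?S (x X w) (along Z (x Y) w) = - ?S (along Z (x Y) w) (x X w)"
    "?S (x X w) (along Y (x Z) w) = - ?S (along Y (x Z) w) (x X w)"
    "?S (x Y w) (along X (x Z) w) = - ?S (along X (x Z) w) (x Y w)" by (rule anti)+
  ultimately show ?thesis
    unfolding br[OF X Y Z] br[OF X Z Y] br[OF Y Z X] by (simp add: algebra_simps)
qed

subsection \<open>Vertical derivatives\<close>

lemma partial_y_eq:
  assumes "c \<in> around G (proj G w)"
  shows "partial_y G c \<alpha> f w = prol_deriv G c f w (0, axis \<alpha> 1)"
  using linear_0[OF anc_linear[OF assms]]
  by (simp add: partial_y_def prol_deriv_def chart_deriv_def o_def)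

lemma partial_y_smooth:
  assumes c: "c \<in> around G (proj G w)" and f: "smooth_E w f"
  shows "smooth_E w (partial_y G c \<alpha> f)"
proof (rule E.smooth_at_cong[OF smooth_E_prol_deriv[OF c f E.smooth_at_const]])
  show "\<forall>\<^sub>F w' in nhds w. prol_deriv G c f w' (0, axis \<alpha> 1) = partial_y G c \<alpha> f w'"
    using around_eventually_E[OF c] by eventually_elim (simp add: partial_y_eq)
qed

text \<open>The vertical lift of an element of \<open>E\<close> does not depend on the coordinates because the fibre
  coordinates change linearly. It makes the Cartan 1-section and the energy well defined.\<close>

lemma vertical_deriv_change:
  assumes e: "proj G e = proj G w" and c: "c \<in> around G (proj G w)" and c': "c' \<in> around G (proj G w)"
    and f: "smooth_E w f"
  shows "prol_deriv G c f w (0, snd c e) = prol_deriv G c' f w (0, snd c' e)"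
proof -
  let ?p = "proj G w"
  obtain T :: "'p \<Rightarrow> real^'k^'k" where T: "smooth_M ?p T"
    "\<forall>\<^sub>F q in nhds ?p. \<forall>e. proj G e = q \<longrightarrow> snd c' e = T q *v snd c e"
    using transition[OF c c'] by blast
  note Tp = eventually_nhds_x_imp_x[OF T(2), rule_format]
  let ?z = "prol_elem G c w 0 (snd c e)"
  have z: "?z \<in> prol_fibre G w" and zc: "comps G c ?z = (0, snd c e)" using prol_elem[OF c] by simp_all
  have "fst (comps G c' ?z) = T ?p *v fst (comps G c ?z)"
    using Tp[OF prol_fibreD(1)[OF z]] by (simp add: comps_def)
  moreover have "snd (comps G c' ?z) = snd c' e"
  proof -
    have ev: "\<forall>\<^sub>F w' in nhds w. snd c' w' = T (proj G w') *v snd c w'"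
      using eventually_proj[OF T(2)] by eventually_elim simp
    have "snd (comps G c' ?z) = prol_deriv G c (snd c') w (0, snd c e)"
      unfolding snd_comps_change[OF z c c'] zc ..
    also have "\<dots> = T ?p *v snd c e"
      unfolding prol_deriv_cong[OF c ev] prol_deriv_matrix[OF c T(1) base_coord_smooth_E(2)[OF c]]
        prol_deriv_coord[OF c]
      using linear_0[OF base_deriv_linear[OF c M.smooth_at_matrix_vector[OF T(1) M.smooth_at_const]]] by simp
    finally show ?thesis using Tp[OF e] by simp
  qed
  ultimately have "comps G c' ?z = (0, snd c' e)" by (simp add: zc prod_eq_iff)
  with prol_deriv_change[OF z c c' f] show ?thesis by (simp add: zc)
qed

end

section \<open>The Cartan forms of a regular Lagrangian\<close>

locale regular_Lagrangian = Lie_algebroid G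
  for G :: "('p::{t2_space,second_countable_topology}, 'e::{t2_space,second_countable_topology},
    'x::real_inner, 'k::finite) algebroid" +
  fixes L :: "'e \<Rightarrow> real"
  assumes regular: "regular_lagrangian G L"
begin

lemma L_smooth: "smooth_E w L"
  using regular E.mfd_smooth_on_iff[OF open_UNIV] unfolding regular_lagrangian_def by blast

lemma det_hessian: "c \<in> around G (proj G w) \<Longrightarrow> det (fibre_hessian G c L w) \<noteq> 0"
proof -
  assume c: "c \<in> around G (proj G w)"
  have "rank (fibre_hessian G c L w) = CARD('k)"
    using regular c unfolding regular_lagrangian_def around_def by blast
  then have "inj ((*v) (fibre_hessian G c L w))" by (simp add: full_rank_injective)
  then show ?thesis
    unfolding matrix_left_invertible_injective[symmetric] using invertible_det_nz
    by (metis invertible_left_inverse)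
qed

definition momentum :: "('p, 'e, 'x, 'k) adapted \<Rightarrow> 'e \<Rightarrow> real^'k" where
  "momentum c w = (\<chi> \<alpha>. partial_y G c \<alpha> L w)"

lemma momentum_smooth: "c \<in> around G (proj G w) \<Longrightarrow> smooth_E w (momentum c)"
  by (rule E.smooth_at_vec) (simp add: momentum_def partial_y_smooth L_smooth)

lemma momentum_inner:
  assumes "c \<in> around G (proj G w)"
  shows "momentum c w \<bullet> a = prol_deriv G c L w (0, a)"
proof -
  have "linear (\<lambda>b. prol_deriv G c L w (0, b))"
    using linear_compose[OF linear_inr prol_deriv_linear[OF assms L_smooth]] by (simp add: o_def)
  from sum_axis_linear[OF this, of a] show ?thesis
    by (simp add: momentum_def inner_vec_def partial_y_eq[OF assms] mult.commute)
qed

lemma cartan_1_eq: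
  assumes Z: "Z w \<in> prol_fibre G w" and c: "c \<in> around G (proj G w)"
  shows "cartan_1 G L [Z] w = momentum c w \<bullet> fst (comps G c (Z w))"
proof -
  let ?c = "adapted_at G (proj G w)"
  have "cartan_1 G L [Z] w = momentum ?c w \<bullet> fst (comps G ?c (Z w))"
    by (simp add: cartan_1_def Let_def momentum_def inner_vec_def dual_comps(1)[where G = G])
  also have "\<dots> = momentum c w \<bullet> fst (comps G c (Z w))"
    unfolding momentum_inner[OF adapted_at] momentum_inner[OF c]
    using vertical_deriv_change[OF prol_fibreD(1)[OF Z] adapted_at c L_smooth] by (simp add: comps_def)
  finally show ?thesis .
qed

lemma cartan_1_smooth:
  assumes Z: "X_smooth_at w Z" shows "smooth_E w (cartan_1 G L [Z])"
proof -
  obtain c where c: "c \<in> around G (proj G w)" using around_nonempty by blast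
  have ev: "\<forall>\<^sub>F w' in nhds w. momentum c w' \<bullet> fst (comps G c (Z w')) = cartan_1 G L [Z] w'"
    using around_eventually_E[OF c] X_smooth_atD(1)[OF Z] by eventually_elim (simp add: cartan_1_eq)
  show ?thesis
    by (rule E.smooth_at_cong[OF E.smooth_at_inner[OF momentum_smooth[OF c] X_smooth_atD(3)[OF Z c]] ev])
qed

lemma cartan_2_pair:
  "cartan_2 G L [Y, Z] w = prol_apply G Y (cartan_1 G L [Z]) w - prol_apply G Z (cartan_1 G L [Y]) w -
     cartan_1 G L [prol_bracket G Y Z] w"
  unfolding cartan_2_def by (rule ext_d_2)

subsection \<open>The Cartan 2-section at a point\<close>

text \<open>In coordinates \<open>\<omega>\<^sub>L = d(p\<^sub>\<alpha> \<X>\<^sup>\<alpha>)\<close> with the momenta \<open>p\<^sub>\<alpha>\<close>; the derivatives of the components of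
  the sections cancel against those in the bracket, which leaves a bilinear form on each fibre.\<close>

definition omega_coord ::
  "('p, 'e, 'x, 'k) adapted \<Rightarrow> 'e \<Rightarrow> (real^'k) \<times> (real^'k) \<Rightarrow> (real^'k) \<times> (real^'k) \<Rightarrow> real" where
  "omega_coord c w z z' = prol_deriv G c (momentum c) w z \<bullet> fst z' - prol_deriv G c (momentum c) w z' \<bullet> fst z -
     momentum c w \<bullet> struct G c (proj G w) (fst z) (fst z')"

definition omega :: "'e \<Rightarrow> ('e, 'x, 'k) prol \<Rightarrow> ('e, 'x, 'k) prol \<Rightarrow> real" where
  "omega w z z' = (let c = adapted_at G (proj G w) in omega_coord c w (comps G c z) (comps G c z'))"

lemma cartan_2_coord:
  assumes Y: "X_smooth_at w Y" and Z: "X_smooth_at w Z" and c: "c \<in> around G (proj G w)"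
  shows "cartan_2 G L [Y, Z] w = omega_coord c w (comps G c (Y w)) (comps G c (Z w))"
proof -
  have ap: "prol_apply G Y (cartan_1 G L [Z]) w =
      momentum c w \<bullet> along Y (\<lambda>w'. fst (comps G c (Z w'))) w +
      prol_deriv G c (momentum c) w (comps G c (Y w)) \<bullet> fst (comps G c (Z w))"
    if Y: "X_smooth_at w Y" and Z: "X_smooth_at w Z" for Y Z
  proof -
    note Zs = X_smooth_atD(3)[OF Z c] and Yf = X_smooth_atD(2)[OF Y]
    have ev: "\<forall>\<^sub>F w' in nhds w. cartan_1 G L [Z] w' = momentum c w' \<bullet> fst (comps G c (Z w'))"
      using around_eventually_E[OF c] X_smooth_atD(1)[OF Z] by eventually_elim (simp add: cartan_1_eq)
    show ?thesis
      unfolding prol_apply_along[where Z = Y, OF Yf cartan_1_smooth[OF Z]] along_cong[OF ev]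
        along_eq[where Z = Y, OF Yf c E.smooth_at_inner[OF momentum_smooth[OF c] Zs]]
        prol_deriv_bilinear[OF bounded_bilinear_inner c momentum_smooth[OF c] Zs]
        along_eq[where Z = Y, OF Yf c Zs] ..
  qed
  show ?thesis
    unfolding cartan_2_pair ap[OF Y Z] ap[OF Z Y] omega_coord_def
      cartan_1_eq[where Z = "prol_bracket G Y Z", OF prol_bracket_in_fibre c] prol_bracket_fst[OF Y Z c]
    by (simp add: inner_add_right inner_diff_right)
qed

text \<open>Both sides are the value of \<open>\<omega>\<^sub>L\<close> on sections through \<open>z\<close> and \<open>z'\<close>, computed in different coordinates.\<close>

lemma omega_coord_indep:
  assumes z: "z \<in> prol_fibre G w" and z': "z' \<in> prol_fibre G w" and c: "c \<in> around G (proj G w)"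
  shows "omega w z z' = omega_coord c w (comps G c z) (comps G c z')"
proof -
  obtain Y where Y: "\<forall>w'. sec_smooth_at w' Y" "Y w = z" using section_through[OF z] by blast
  obtain Z where Z: "\<forall>w'. sec_smooth_at w' Z" "Z w = z'" using section_through[OF z'] by blast
  note YZ = sec_smooth_at_X[OF Y(1)[rule_format]] sec_smooth_at_X[OF Z(1)[rule_format]]
  show ?thesis
    using cartan_2_coord[OF YZ adapted_at, of w] cartan_2_coord[OF YZ c] by (simp add: omega_def Let_def Y(2) Z(2))
qed

lemma cartan_2_omega:
  "X_smooth_at w Y \<Longrightarrow> X_smooth_at w Z \<Longrightarrow> cartan_2 G L [Y, Z] w = omega w (Y w) (Z w)"
  by (simp add: cartan_2_coord[OF _ _ adapted_at] omega_def Let_def)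

lemma omega_antisym: "omega w z z' = - omega w z' z"
  using struct_antisym[OF adapted_at, of "proj G w" "fst (comps G (adapted_at G (proj G w)) z)"]
  by (simp add: omega_def Let_def omega_coord_def)

subsection \<open>Hamiltonian sections\<close>

text \<open>On the fibre, \<open>\<omega>\<^sub>L\<close> vanishes on pairs of vertical elements and pairs vertical with other elements
  through the Hessian. The equation \<open>i\<^sub>z \<omega>\<^sub>L = - dh\<close> is therefore triangular: tested on vertical
  elements it determines the \<open>\<X>\<close>-components of \<open>z\<close>, and then its \<open>\<V>\<close>-components are determined by a linear
  equation with the transposed Hessian and the right-hand side \<open>X_rhs\<close>.\<close>

definition V_grad :: "('p, 'e, 'x, 'k) adapted \<Rightarrow> ('e \<Rightarrow> real) \<Rightarrow> 'e \<Rightarrow> real^'k" where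
  "V_grad c h w = (\<chi> \<alpha>. prol_deriv G c h w (0, axis \<alpha> 1))"

definition X_rhs :: "('p, 'e, 'x, 'k) adapted \<Rightarrow> ('e \<Rightarrow> real) \<Rightarrow> (real^'k) \<Rightarrow> 'e \<Rightarrow> real^'k" where
  "X_rhs c h a w = (\<chi> \<alpha>. - prol_deriv G c h w (axis \<alpha> 1, 0) - prol_deriv G c (momentum c) w (a, 0) $ \<alpha> +
     prol_deriv G c (momentum c) w (axis \<alpha> 1, 0) \<bullet> a + momentum c w \<bullet> struct G c (proj G w) a (axis \<alpha> 1))"

lemma momentum_vertical:
  assumes c: "c \<in> around G (proj G w)"
  shows "prol_deriv G c (momentum c) w (0, b) = transpose (fibre_hessian G c L w) *v b"
proof -
  have "linear (\<lambda>b. prol_deriv G c (momentum c) w (0, b))"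
    using linear_compose[OF linear_inr prol_deriv_linear[OF c momentum_smooth[OF c]]] by (simp add: o_def)
  note sum_axis_linear[OF this, of b, symmetric]
  also have "(\<Sum>\<beta>\<in>UNIV. b $ \<beta> *\<^sub>R prol_deriv G c (momentum c) w (0, axis \<beta> 1)) = transpose (fibre_hessian G c L w) *v b"
  proof -
    have "prol_deriv G c (momentum c) w (0, axis \<beta> 1) $ \<alpha> = fibre_hessian G c L w $ \<beta> $ \<alpha>" for \<alpha> \<beta>
    proof -
      have "prol_deriv G c (momentum c) w (0, axis \<beta> 1) $ \<alpha> = prol_deriv G c (\<lambda>w'. momentum c w' $ \<alpha>) w (0, axis \<beta> 1)"
        by (rule prol_deriv_bl[OF bounded_linear_vec_nth c momentum_smooth[OF c], symmetric])
      also have "(\<lambda>w'. momentum c w' $ \<alpha>) = partial_y G c \<alpha> L" by (simp add: momentum_def)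
      finally show ?thesis by (simp add: fibre_hessian_def partial_y_eq[OF c])
    qed
    then show ?thesis
      by (simp add: vec_eq_iff matrix_vector_mult_def transpose_def sum_component mult.commute)
  qed
  finally show ?thesis .
qed

lemma hamilton_iff:
  assumes c: "c \<in> around G (proj G w)" and h: "smooth_E w h"
  shows "(\<forall>z'. omega_coord c w (a, b) z' = - prol_deriv G c h w z') \<longleftrightarrow>
    fibre_hessian G c L w *v a = V_grad c h w \<and> transpose (fibre_hessian G c L w) *v b = X_rhs c h a w"
proof -
  let ?H = "fibre_hessian G c L w" and ?D = "prol_deriv G c (momentum c) w"
  interpret D: linear ?D by (rule prol_deriv_linear[OF c momentum_smooth[OF c]])
  interpret dh: linear "prol_deriv G c h w" by (rule prol_deriv_linear[OF c h])
  interpret S: bounded_bilinear "struct G c (proj G w)" by (rule struct_bounded_bilinear)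
  define F where "F z' = omega_coord c w (a, b) z' + prol_deriv G c h w z'" for z'
  have F: "linear F"
    by (rule linearI) (simp_all add: F_def omega_coord_def D.add D.scale dh.add dh.scale S.add_right S.scaleR_right
        inner_add_left inner_add_right algebra_simps)
  note FX = linear_compose[OF linear_inl F, unfolded o_def] and FV = linear_compose[OF linear_inr F, unfolded o_def]
  have ab: "?D (a, b) = ?D (a, 0) + transpose ?H *v b"
    unfolding momentum_vertical[OF c, symmetric] D.add[symmetric] by simp
  have V: "F (0, axis \<alpha> 1) = V_grad c h w $ \<alpha> - (?H *v a) $ \<alpha>" for \<alpha>
  proof -
    have "(transpose ?H *v axis \<alpha> 1) \<bullet> a = (?H *v a) $ \<alpha>"
      using dot_lmul_matrix[of "axis \<alpha> 1" ?H a] by (simp add: inner_axis_axis inner_axis' transpose_matrix_vector)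
    then show ?thesis
      by (simp add: F_def omega_coord_def momentum_vertical[OF c] V_grad_def S.zero_right)
  qed
  have X: "F (axis \<alpha> 1, 0) = (transpose ?H *v b) $ \<alpha> - X_rhs c h a w $ \<alpha>" for \<alpha>
    by (simp add: F_def omega_coord_def ab X_rhs_def inner_axis algebra_simps)
  have "(\<forall>z'. omega_coord c w (a, b) z' = - prol_deriv G c h w z') \<longleftrightarrow> (\<forall>z'. F z' = 0)"
    by (simp add: F_def eq_neg_iff_add_eq_0)
  also have "\<dots> \<longleftrightarrow> (\<forall>\<alpha>. F (0, axis \<alpha> 1) = 0) \<and> (\<forall>\<alpha>. F (axis \<alpha> 1, 0) = 0)"
  proof (intro iffI conjI allI)
    fix z' assume 0: "(\<forall>\<alpha>. F (0, axis \<alpha> 1) = 0) \<and> (\<forall>\<alpha>. F (axis \<alpha> 1, 0) = 0)"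
    have "F z' = F (fst z', 0) + F (0, snd z')" using linear_add[OF F, of "(fst z', 0)" "(0, snd z')"] by simp
    also have "F (fst z', 0) = 0" using sum_axis_linear[OF FX, of "fst z'"] 0 by simp
    also have "F (0, snd z') = 0" using sum_axis_linear[OF FV, of "snd z'"] 0 by simp
    finally show "F z' = 0" by simp
  qed auto
  also have "\<dots> \<longleftrightarrow> ?H *v a = V_grad c h w \<and> transpose ?H *v b = X_rhs c h a w"
    unfolding V X by (auto simp: vec_eq_iff)
  finally show ?thesis .
qed

definition differential :: "('e \<Rightarrow> real) \<Rightarrow> 'e \<Rightarrow> ('e, 'x, 'k) prol \<Rightarrow> real" where
  "differential h w z =
     prol_deriv G (adapted_at G (proj G w)) h w (comps G (adapted_at G (proj G w)) z)"

lemma along_differential: "along Z h w = differential h w (Z w)"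
  by (simp add: along_def differential_def)

lemma hamilton_solution_iff:
  assumes z: "z \<in> prol_fibre G w" and c: "c \<in> around G (proj G w)" and h: "smooth_E w h"
  shows "(\<forall>z'\<in>prol_fibre G w. omega w z z' = - differential h w z') \<longleftrightarrow>
      fibre_hessian G c L w *v fst (comps G c z) = V_grad c h w \<and>
      transpose (fibre_hessian G c L w) *v snd (comps G c z) = X_rhs c h (fst (comps G c z)) w"
proof -
  have d: "differential h w z' = prol_deriv G c h w (comps G c z')" if "z' \<in> prol_fibre G w" for z'
    unfolding differential_def by (rule prol_deriv_change[OF that adapted_at c h])
  have "(\<forall>z'\<in>prol_fibre G w. omega w z z' = - differential h w z') \<longleftrightarrow>
      (\<forall>z'. omega_coord c w (comps G c z) z' = - prol_deriv G c h w z')"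
  proof (intro iffI allI ballI)
    fix z' assume *: "\<forall>z'\<in>prol_fibre G w. omega w z z' = - differential h w z'"
    have e: "prol_elem G c w (fst z') (snd z') \<in> prol_fibre G w" "comps G c (prol_elem G c w (fst z') (snd z')) = z'"
      using prol_elem[OF c] by simp_all
    show "omega_coord c w (comps G c z) z' = - prol_deriv G c h w z'"
      using *[rule_format, OF e(1)] unfolding omega_coord_indep[OF z e(1) c] d[OF e(1)] e(2) .
  next
    fix z' assume *: "\<forall>z'. omega_coord c w (comps G c z) z' = - prol_deriv G c h w z'" "z' \<in> prol_fibre G w"
    show "omega w z z' = - differential h w z'"
      unfolding omega_coord_indep[OF z *(2) c] d[OF *(2)] by (rule *(1)[rule_format])
  qed
  then show ?thesis using hamilton_iff[OF c h, of "fst (comps G c z)" "snd (comps G c z)"] by simp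
qed

lemma hamilton_pointwise_unique:
  assumes h: "smooth_E w h"
  shows "\<exists>!z. z \<in> prol_fibre G w \<and> (\<forall>z'\<in>prol_fibre G w. omega w z z' = - differential h w z')"
proof -
  obtain c where c: "c \<in> around G (proj G w)" using around_nonempty by blast
  let ?H = "fibre_hessian G c L w"
  have det: "det ?H \<noteq> 0" "det (transpose ?H) \<noteq> 0" using det_hessian[OF c] by (simp_all add: det_transpose)
  obtain a where a: "?H *v a = V_grad c h w" using cramer[OF det(1)] by blast
  obtain b where b: "transpose ?H *v b = X_rhs c h a w" using cramer[OF det(2)] by blast
  show ?thesis
  proof (rule ex1I)
    note z = prol_elem[OF c, of a b]
    show "prol_elem G c w a b \<in> prol_fibre G w \<and> (\<forall>z'\<in>prol_fibre G w.
        omega w (prol_elem G c w a b) z' = - differential h w z')"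
      using hamilton_solution_iff[OF z(1) c h] z a b by simp
    fix z assume *: "z \<in> prol_fibre G w \<and> (\<forall>z'\<in>prol_fibre G w. omega w z z' = - differential h w z')"
    then have zf: "z \<in> prol_fibre G w" by simp
    have e: "?H *v fst (comps G c z) = V_grad c h w"
      "transpose ?H *v snd (comps G c z) = X_rhs c h (fst (comps G c z)) w"
      using hamilton_solution_iff[OF zf c h] * by simp_all
    have ca: "fst (comps G c z) = a"
      using e(1) a unfolding cramer[OF det(1)] by simp
    have "snd (comps G c z) = b"
      using e(2) b unfolding ca cramer[OF det(2)] by simp
    with ca have "comps G c z = comps G c (prol_elem G c w a b)" by (simp add: z(2) prod_eq_iff)
    then show "z = prol_elem G c w a b" by (rule comps_inj[OF zf z(1) c])
  qed
qed

text \<open>The pointwise solution is smooth because its components solve linear systems with smooth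
  coefficients, first for the \<open>\<X>\<close>-components, which enter the right-hand side of the second.\<close>

lemma hamilton_smooth:
  assumes h: "\<forall>\<^sub>F w' in nhds w. smooth_E w' h"
    and X: "\<forall>\<^sub>F w' in nhds w. X w' \<in> prol_fibre G w' \<and> (\<forall>z'\<in>prol_fibre G w'. omega w' (X w') z' = - differential h w' z')"
  shows "sec_smooth_at w X"
proof -
  obtain c where c: "c \<in> around G (proj G w)" using around_nonempty by blast
  let ?H = "fibre_hessian G c L" and ?a = "\<lambda>w'. fst (comps G c (X w'))" and ?b = "\<lambda>w'. snd (comps G c (X w'))"
  have hw: "smooth_E w h" using eventually_nhds_x_imp_x[OF h] .
  have Hs: "smooth_E w ?H"
    by (intro E.smooth_at_vec) (simp add: fibre_hessian_def partial_y_smooth c L_smooth)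
  have Hts: "smooth_E w (\<lambda>w'. transpose (?H w'))"
    by (intro E.smooth_at_vec) (simp add: transpose_def fibre_hessian_def partial_y_smooth c L_smooth)
  have sol: "\<forall>\<^sub>F w' in nhds w. ?H w' *v ?a w' = V_grad c h w' \<and> transpose (?H w') *v ?b w' = X_rhs c h (?a w') w'"
    using around_eventually_E[OF c] h X
  proof eventually_elim
    case (elim w')
    then show ?case using hamilton_solution_iff[OF _ elim(1,2)] by blast
  qed
  have Vs: "smooth_E w (V_grad c h)"
    by (intro E.smooth_at_vec) (simp add: V_grad_def smooth_E_prol_deriv[OF c hw E.smooth_at_const])
  have as: "smooth_E w ?a"
    by (rule E.smooth_at_linear_solution[OF Hs Vs det_hessian[OF c]])
      (use sol in \<open>eventually_elim, simp\<close>)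
  note ms = momentum_smooth[OF c]
  have Rs: "smooth_E w (\<lambda>w'. X_rhs c h (?a w') w')"
  proof (rule E.smooth_at_vec)
    fix \<alpha>
    show "smooth_E w (\<lambda>w'. X_rhs c h (?a w') w' $ \<alpha>)"
      unfolding X_rhs_def vec_lambda_beta
      by (intro E.smooth_at_add E.smooth_at_diff E.smooth_at_minus E.smooth_at_inner E.smooth_at_vec_nth
          smooth_E_prol_deriv[OF c hw] smooth_E_prol_deriv[OF c ms] E.smooth_at_Pair E.smooth_at_const as ms
          prol_deriv_struct(2)[OF c])
  qed
  have dt: "det (transpose (?H w)) \<noteq> 0" using det_hessian[OF c] by (simp add: det_transpose)
  have bs: "smooth_E w ?b"
    by (rule E.smooth_at_linear_solution[OF Hts Rs dt])
      (use sol in \<open>eventually_elim, simp\<close>)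
  have "\<forall>\<^sub>F w' in nhds w. X w' \<in> prol_fibre G w'" using X by eventually_elim simp
  then show ?thesis
    by (rule sec_smooth_atI[OF _ c]) (use E.smooth_at_Pair[OF as bs] in simp)
qed

lemma section_at:
  assumes "open W" "Z \<in> prol_sections G W" "w \<in> W"
  shows "sec_smooth_at w Z" "X_smooth_at w Z" "Z w \<in> prol_fibre G w"
  using assms prol_sections_iff[OF assms(1)] sec_smooth_at_X X_smooth_atD(2)[OF sec_smooth_at_X] by blast+

lemma ext_d_fun_form:
  assumes "open W" "Z \<in> prol_sections G W" "w \<in> W" "smooth_E w h"
  shows "ext_d G (fun_form h) [Z] w = differential h w (Z w)"
  unfolding ext_d_1 fun_form_Nil
  using prol_apply_along[where Z = Z, OF section_at(3)[OF assms(1-3)] assms(4)] by (simp add: along_differential)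

lemma section_through_on:
  assumes "open W" "w \<in> W" "z \<in> prol_fibre G w"
  obtains Z where "Z \<in> prol_sections G W" "Z w = z"
proof -
  obtain Z where Z: "\<forall>w'. Z w' \<in> prol_fibre G w'" "\<forall>w'. sec_smooth_at w' Z" "Z w = z"
    using section_through[OF assms(3)] by blast
  have "restrict Z W \<in> prol_sections G W" by (rule prol_sectionsI[OF assms(1) Z(1)[rule_format] Z(2)[rule_format]])
  then show ?thesis by (rule that) (simp add: Z(3) assms(2))
qed

text \<open>An identity of forms becomes an identity on each fibre: sections pass through every element, and in
  the degrees other than \<open>1\<close> both sides vanish.\<close>

lemma hamiltonian_on_iff:
  assumes W: "open W" and X: "X \<in> prol_sections G W" and h: "\<And>w. w \<in> W \<Longrightarrow> smooth_E w h"
  shows "hamiltonian_on G L W h X \<longleftrightarrow>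
    (\<forall>w\<in>W. \<forall>z\<in>prol_fibre G w. omega w (X w) z = - differential h w z)"
proof
  assume H: "hamiltonian_on G L W h X"
  show "\<forall>w\<in>W. \<forall>z\<in>prol_fibre G w. omega w (X w) z = - differential h w z"
  proof (intro ballI)
    fix w z assume w: "w \<in> W" and z: "z \<in> prol_fibre G w"
    obtain Z where Z: "Z \<in> prol_sections G W" "Z w = z" by (rule section_through_on[OF W w z])
    have "inner_prod X (cartan_2 G L) [Z] w = - ext_d G (fun_form h) [Z] w"
      using H Z(1) w unfolding hamiltonian_on_def form_eq_on_def by simp
    then show "omega w (X w) z = - differential h w z"
      unfolding inner_prod_def ext_d_fun_form[OF W Z(1) w h[OF w]]
        cartan_2_omega[OF section_at(2)[OF W X w] section_at(2)[OF W Z(1) w]] Z(2) .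
  qed
next
  assume H: "\<forall>w\<in>W. \<forall>z\<in>prol_fibre G w. omega w (X w) z = - differential h w z"
  show "hamiltonian_on G L W h X"
    unfolding hamiltonian_on_def form_eq_on_def
  proof (intro allI impI ballI)
    fix Zs w assume Zs: "set Zs \<subseteq> prol_sections G W" and w: "w \<in> W"
    show "inner_prod X (cartan_2 G L) Zs w = - ext_d G (fun_form h) Zs w"
    proof (cases "length Zs = 1")
      case True
      then obtain Z where Z: "Zs = [Z]" by (auto simp: length_Suc_conv)
      then have Zw: "Z \<in> prol_sections G W" using Zs by simp
      show ?thesis
        unfolding Z inner_prod_def ext_d_fun_form[OF W Zw w h[OF w]]
          cartan_2_omega[OF section_at(2)[OF W X w] section_at(2)[OF W Zw w]]
        using H w section_at(3)[OF W Zw w] by blast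
    next
      case False
      have "form_degree 1 (inner_prod X (cartan_2 G L))"
        using form_degree_inner_prod[of 1 "cartan_2 G L" X] form_degree_cartan_2[of G L] by (simp add: numeral_2_eq_2)
      moreover have "form_degree 1 (ext_d G (fun_form h))"
        using form_degree_ext_d[OF form_degree_fun_form, of G h] by simp
      ultimately show ?thesis using False by (simp add: form_degreeD)
    qed
  qed
qed

lemma hamiltonian_unique_existence:
  assumes W: "open W" and h: "\<And>w. w \<in> W \<Longrightarrow> smooth_E w h"
  shows "\<exists>!X. X \<in> prol_sections G W \<and> hamiltonian_on G L W h X"
proof -
  define P where "P w z \<longleftrightarrow> z \<in> prol_fibre G w \<and> (\<forall>z'\<in>prol_fibre G w. omega w z z' = - differential h w z')" for w z
  define X0 where "X0 w = (THE z. P w z)" for w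
  have ex1: "\<exists>!z. P w z" if "w \<in> W" for w
    unfolding P_def by (rule hamilton_pointwise_unique[OF h[OF that]])
  have X0: "P w (X0 w)" if "w \<in> W" for w
    unfolding X0_def by (rule theI'[OF ex1[OF that]])
  have X0s: "sec_smooth_at w X0" if w: "w \<in> W" for w
  proof (rule hamilton_smooth)
    show "\<forall>\<^sub>F w' in nhds w. smooth_E w' h"
      using eventually_nhds_in_open[OF W w] by eventually_elim (rule h)
    show "\<forall>\<^sub>F w' in nhds w. X0 w' \<in> prol_fibre G w' \<and> (\<forall>z'\<in>prol_fibre G w'. omega w' (X0 w') z' = - differential h w' z')"
      using eventually_nhds_in_open[OF W w] by eventually_elim (rule X0[unfolded P_def])
  qed
  have sec: "restrict X0 W \<in> prol_sections G W"
    by (rule prol_sectionsI[OF W X0[unfolded P_def, THEN conjunct1] X0s])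
  have ham: "hamiltonian_on G L W h X \<longleftrightarrow> (\<forall>w\<in>W. P w (X w))" if X: "X \<in> prol_sections G W" for X
  proof -
    have "hamiltonian_on G L W h X \<longleftrightarrow> (\<forall>w\<in>W. \<forall>z\<in>prol_fibre G w. omega w (X w) z = - differential h w z)"
      by (rule hamiltonian_on_iff[OF W X], rule h)
    also have "\<dots> \<longleftrightarrow> (\<forall>w\<in>W. P w (X w))"
      unfolding P_def by (rule ball_cong[OF refl]) (simp add: section_at(3)[OF W X])
    finally show ?thesis .
  qed
  show ?thesis
  proof (rule ex1I)
    show "restrict X0 W \<in> prol_sections G W \<and> hamiltonian_on G L W h (restrict X0 W)"
      using sec ham[OF sec] X0 by simp
    fix X assume X: "X \<in> prol_sections G W \<and> hamiltonian_on G L W h X"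
    then have PX: "P w (X w)" if "w \<in> W" for w using ham that by blast
    show "X = restrict X0 W"
    proof (rule PiE_ext)
      show "X \<in> (\<Pi>\<^sub>E w\<in>W. prol_fibre G w)" using X prol_sections_iff[OF W] by blast
      show "restrict X0 W \<in> (\<Pi>\<^sub>E w\<in>W. prol_fibre G w)" using sec prol_sections_iff[OF W] by blast
      fix w assume w: "w \<in> W"
      show "X w = restrict X0 W w" using ex1[OF w] PX[OF w] X0[OF w] w by auto
    qed
  qed
qed

lemma energy_smooth: "smooth_E w (energy G L)"
proof -
  obtain c where c: "c \<in> around G (proj G w)" using around_nonempty by blast
  have "\<forall>\<^sub>F w' in nhds w. prol_deriv G c L w' (0, snd c w') - L w' = energy G L w'"
    using around_eventually_E[OF c]
  proof eventually_elim
    case (elim w')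
    let ?c = "adapted_at G (proj G w')"
    note e = prol_elem[OF adapted_at, of w' 0 "snd ?c w'"]
    have "prol_apply G (euler_section G) L w' = prol_deriv G ?c L w' (comps G ?c (euler_section G w'))"
      using e(1) by (intro prol_apply_eq[OF _ adapted_at L_smooth]) (simp add: euler_section_def Let_def)
    also have "\<dots> = prol_deriv G ?c L w' (0, snd ?c w')"
      using e(2) by (simp add: euler_section_def Let_def)
    also have "\<dots> = prol_deriv G c L w' (0, snd c w')"
      by (rule vertical_deriv_change[OF refl adapted_at elim L_smooth])
    finally show ?case by (simp add: energy_def)
  qed
  then show ?thesis
    by (rule E.smooth_at_cong[rotated])
      (intro E.smooth_at_diff smooth_E_prol_deriv[OF c L_smooth] E.smooth_at_Pair E.smooth_at_const
        base_coord_smooth_E(2)[OF c] L_smooth)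
qed

lemma canonical_semispray:
  shows "canonical_semispray G L \<in> prol_sections G UNIV"
    and "z \<in> prol_fibre G w \<Longrightarrow> omega w (canonical_semispray G L w) z = - differential (energy G L) w z"
proof -
  have *: "canonical_semispray G L \<in> prol_sections G UNIV \<and>
      hamiltonian_on G L UNIV (energy G L) (canonical_semispray G L)"
    unfolding canonical_semispray_def
    by (rule theI'[OF hamiltonian_unique_existence[OF open_UNIV energy_smooth]])
  then show "canonical_semispray G L \<in> prol_sections G UNIV" by simp
  show "omega w (canonical_semispray G L w) z = - differential (energy G L) w z" if "z \<in> prol_fibre G w"
    using * that hamiltonian_on_iff[OF open_UNIV _ energy_smooth] by blast
qed

lemma slit_open: "open (slit G)"
proof (subst open_subopen, intro ballI)
  fix w assume w: "w \<in> slit G"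
  obtain c where c: "c \<in> around G (proj G w)" using around_nonempty by blast
  have "snd c w \<noteq> 0"
    using w coord_inj[OF c refl vb_zero(1)] vb_zero(2)[OF c] by (auto simp: slit_def)
  moreover have "(snd c \<longlongrightarrow> snd c w) (nhds w)"
    using E.smooth_at_isCont[OF base_coord_smooth_E(2)[OF c]] by (simp add: isCont_def tendsto_at_iff_tendsto_nhds)
  ultimately have "\<forall>\<^sub>F w' in nhds w. snd c w' \<noteq> 0" by (simp add: tendsto_imp_eventually_ne)
  with around_eventually_E[OF c] have "\<forall>\<^sub>F w' in nhds w. w' \<in> slit G"
  proof eventually_elim
    case (elim w')
    then show ?case using vb_zero(2)[OF elim(1)] by (auto simp: slit_def)
  qed
  then show "\<exists>T. open T \<and> w \<in> T \<and> T \<subseteq> slit G" unfolding eventually_nhds by blast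
qed

text \<open>\<open>d\<^sup>E d\<^sup>E \<theta>\<^sub>L = 0\<close>: the derivatives of the values of \<open>\<theta>\<^sub>L\<close> cancel by \<open>along_bracket\<close>, and what is left is
  \<open>\<theta>\<^sub>L\<close> of a Jacobi sum. This vanishes because \<open>\<theta>\<^sub>L\<close> only sees \<open>\<X>\<close>-components, for which
  there is \<open>prol_bracket_jacobi\<close>.\<close>

lemma cartan_2_closed:
  assumes X: "sec_smooth_at w X" and Y: "sec_smooth_at w Y" and Z: "sec_smooth_at w Z"
  shows "ext_d G (cartan_2 G L) [X, Y, Z] w = 0"
proof -
  let ?t = "\<lambda>V. cartan_1 G L [V]" and ?B = "prol_bracket G"
  have pa: "prol_apply G V f w = along V f w" if "X_smooth_at w V" "smooth_E w f" for V w f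
    by (rule prol_apply_along[where Z = V, OF X_smooth_atD(2)[OF that(1)] that(2)])
  have pair: "prol_apply G X (cartan_2 G L [Y, Z]) w =
      along X (along Y (?t Z)) w - along X (along Z (?t Y)) w - along X (?t (?B Y Z)) w"
    if X: "sec_smooth_at w X" and Y: "sec_smooth_at w Y" and Z: "sec_smooth_at w Z" for X Y Z
  proof -
    note ty = cartan_1_smooth[OF sec_smooth_at_X[OF Y]] and tz = cartan_1_smooth[OF sec_smooth_at_X[OF Z]]
    note tb = cartan_1_smooth[OF prol_bracket_X_smooth[OF Y Z]]
    note ys = along_smooth[OF Y tz] and zs = along_smooth[OF Z ty]
    have ev: "\<forall>\<^sub>F w' in nhds w. along Y (?t Z) w' - along Z (?t Y) w' - ?t (?B Y Z) w' = cartan_2 G L [Y, Z] w'"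
      using sec_smooth_at_eventually[OF Y] sec_smooth_at_eventually[OF Z]
      by eventually_elim (simp add: cartan_2_pair pa sec_smooth_at_X cartan_1_smooth)
    have "smooth_E w (cartan_2 G L [Y, Z])"
      by (rule E.smooth_at_cong[OF E.smooth_at_diff[OF E.smooth_at_diff[OF ys zs] tb] ev])
    then have "prol_apply G X (cartan_2 G L [Y, Z]) w = along X (cartan_2 G L [Y, Z]) w"
      by (rule pa[OF sec_smooth_at_X[OF X]])
    also have "\<dots> = along X (\<lambda>w'. along Y (?t Z) w' - along Z (?t Y) w' - ?t (?B Y Z) w') w"
      by (rule along_cong) (use ev in \<open>eventually_elim, simp\<close>)
    also have "\<dots> = along X (along Y (?t Z)) w - along X (along Z (?t Y)) w - along X (?t (?B Y Z)) w"
      by (simp add: along_diff[OF E.smooth_at_diff[OF ys zs] tb] along_diff[OF ys zs])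
    finally show ?thesis .
  qed
  have bra: "cartan_2 G L [?B X Y, Z] w = along X (along Y (?t Z)) w - along Y (along X (?t Z)) w -
      along Z (?t (?B X Y)) w - ?t (?B (?B X Y) Z) w"
    if X: "sec_smooth_at w X" and Y: "sec_smooth_at w Y" and Z: "sec_smooth_at w Z" for X Y Z
  proof -
    note tz = cartan_1_smooth[OF sec_smooth_at_X[OF Z]]
    note b = prol_bracket_X_smooth[OF X Y]
    show ?thesis
      unfolding cartan_2_pair pa[OF b tz] pa[OF sec_smooth_at_X[OF Z] cartan_1_smooth[OF b]] along_bracket[OF X Y tz] ..
  qed
  obtain c where c: "c \<in> around G (proj G w)" using around_nonempty by blast
  have "?t (?B (?B X Y) Z) w - ?t (?B (?B X Z) Y) w + ?t (?B (?B Y Z) X) w = 0"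
    using arg_cong[OF prol_bracket_jacobi[OF X Y Z c], of "\<lambda>v. momentum c w \<bullet> v"]
    by (simp add: cartan_1_eq[where Z = "?B _ _", OF prol_bracket_in_fibre c] inner_add_right inner_diff_right)
  then show ?thesis
    unfolding ext_d_3 pair[OF X Y Z] pair[OF Y X Z] pair[OF Z X Y] bra[OF X Y Z] bra[OF X Z Y] bra[OF Y Z X]
    by simp
qed

section \<open>Conservation laws and exact Cartan symmetries\<close>

text \<open>Cartan's formula \<open>\<L>\<^sub>X \<theta>\<^sub>L = i\<^sub>X \<omega>\<^sub>L + d\<^sup>E(\<theta>\<^sub>L(X))\<close>, evaluated at a point.\<close>

lemma lie_deriv_cartan_1:
  assumes W: "open W" and X: "X \<in> prol_sections G W" and Z: "Z \<in> prol_sections G W" and w: "w \<in> W"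
  shows "lie_deriv G X (cartan_1 G L) [Z] w = omega w (X w) (Z w) + differential (cartan_1 G L [X]) w (Z w)"
proof -
  have i: "inner_prod X (cartan_1 G L) [] = cartan_1 G L [X]" by (simp add: inner_prod_def fun_eq_iff)
  have "ext_d G (inner_prod X (cartan_1 G L)) [Z] w = differential (cartan_1 G L [X]) w (Z w)"
    unfolding ext_d_1 i
    using prol_apply_along[where Z = Z, OF section_at(3)[OF W Z w] cartan_1_smooth[OF section_at(2)[OF W X w]]]
    by (simp add: along_differential)
  then show ?thesis
    using cartan_2_omega[OF section_at(2)[OF W X w] section_at(2)[OF W Z w]]
    by (simp add: lie_deriv_def inner_prod_def cartan_2_def)
qed

lemma differential_diff:
  "smooth_E w f \<Longrightarrow> smooth_E w g \<Longrightarrow> differential (\<lambda>w'. f w' - g w') w z = differential f w z - differential g w z"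
  unfolding differential_def by (rule prol_deriv_diff[OF adapted_at])

lemma restrict_section:
  assumes "open W" "Z \<in> prol_sections G UNIV" shows "restrict Z W \<in> prol_sections G W"
  using section_at[OF open_UNIV assms(2)] by (intro prol_sectionsI[OF assms(1)]) auto

text \<open>The assumption says \<open>i\<^sub>X \<omega>\<^sub>L = d\<^sup>E(f - \<theta>\<^sub>L(X))\<close>. Contracted with the semispray \<open>\<S>\<close> this is
  \<open>\<S>(f - \<theta>\<^sub>L(X)) = \<omega>\<^sub>L(X, \<S>) = X(E\<^sub>L) = 0\<close>.\<close>

lemma conservation_law_of_exact_symmetry:
  assumes X: "exact_cartan_symmetry G L X" and f: "mfd_smooth_on (total_atlas G) UNIV f"
    and e: "form_eq_on G (slit G) (lie_deriv G X (cartan_1 G L)) (ext_d G (fun_form f))"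
  shows "conservation_law_on G L (slit G) (\<lambda>w. f w - cartan_1 G L [X] w)"
proof -
  note W = slit_open
  let ?S = "canonical_semispray G L" and ?g = "\<lambda>w. f w - cartan_1 G L [X] w"
  have fs: "smooth_E w f" for w using f E.mfd_smooth_on_iff[OF open_UNIV] by blast
  have Xs: "X \<in> prol_sections G (slit G)"
    using X by (simp add: exact_cartan_symmetry_def cartan_symmetry_def)
  have ts: "smooth_E w (cartan_1 G L [X])" if "w \<in> slit G" for w
    by (rule cartan_1_smooth[OF section_at(2)[OF W Xs that]])
  have gs: "smooth_E w ?g" if "w \<in> slit G" for w by (rule E.smooth_at_diff[OF fs ts[OF that]])
  have "prol_apply G ?S ?g w = 0" if w: "w \<in> slit G" for w
  proof -
    note Sf = section_at(3)[OF open_UNIV canonical_semispray(1) UNIV_I, of w]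
    note Xf = section_at(3)[OF W Xs w]
    note R = restrict_section[OF W canonical_semispray(1)]
    have Rw: "restrict ?S (slit G) w = ?S w" using w by simp
    have "omega w (X w) (?S w) + differential (cartan_1 G L [X]) w (?S w) = differential f w (?S w)"
      using e[unfolded form_eq_on_def, rule_format, of "[restrict ?S (slit G)]" w] R w
      unfolding lie_deriv_cartan_1[OF W Xs R w] ext_d_fun_form[OF W R w fs] Rw by simp
    then have "prol_apply G ?S ?g w = omega w (X w) (?S w)"
      using prol_apply_along[where Z = ?S, OF Sf gs[OF w]]
      by (simp add: along_differential differential_diff[OF fs ts[OF w]])
    also have "\<dots> = differential (energy G L) w (X w)"
      using omega_antisym[of w "X w" "?S w"] canonical_semispray(2)[OF Xf] by simp
    also have "\<dots> = 0"
    proof -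
      have "lie_deriv G X (fun_form (energy G L)) [] w = 0"
        using X w unfolding exact_cartan_symmetry_def cartan_symmetry_def form_eq_on_def by simp
      then have "ext_d G (fun_form (energy G L)) [X] w = 0"
        by (simp add: lie_deriv_def inner_prod_def ext_d_def)
      then show ?thesis using ext_d_fun_form[OF W Xs w energy_smooth] by simp
    qed
    finally show ?thesis .
  qed
  then show ?thesis
    unfolding conservation_law_on_def E.mfd_smooth_on_iff[OF W] using gs by blast
qed

text \<open>Here \<open>\<L>\<^sub>X \<omega>\<^sub>L = i\<^sub>X d\<^sup>E\<omega>\<^sub>L - d\<^sup>E d\<^sup>E f = 0\<close> and \<open>X(E\<^sub>L) = \<omega>\<^sub>L(X, \<S>) = - \<S>(f) = 0\<close>. A potential of \<open>\<L>\<^sub>X \<theta>\<^sub>L\<close> is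
  \<open>\<theta>\<^sub>L(X) - f\<close>, but \<open>X\<close> lives outside the zero section only.\<close>

lemma exact_symmetry_of_conservation_law:
  assumes f: "conservation_law_on G L UNIV f"
    and X: "X \<in> prol_sections G (slit G)" and H: "hamiltonian_on G L (slit G) f X"
  shows "exact_cartan_symmetry G L X"
proof -
  note W = slit_open
  let ?S = "canonical_semispray G L"
  have fs: "smooth_E w f" for w
    using f E.mfd_smooth_on_iff[OF open_UNIV] unfolding conservation_law_on_def by blast
  have om: "omega w (X w) z = - differential f w z" if "w \<in> slit G" "z \<in> prol_fibre G w" for w z
    using H that hamiltonian_on_iff[OF W X fs] by blast
  have sym2: "form_eq_on G (slit G) (lie_deriv G X (cartan_2 G L)) (\<lambda>_ _. 0)"
    unfolding form_eq_on_def
  proof (intro allI impI ballI)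
    fix Zs w assume Zs: "set Zs \<subseteq> prol_sections G (slit G)" and w: "w \<in> slit G"
    show "lie_deriv G X (cartan_2 G L) Zs w = 0"
    proof (cases "length Zs = 2")
      case True
      then obtain Y Z where YZ: "Zs = [Y, Z]" by (auto simp: length_Suc_conv numeral_2_eq_2)
      then have Y: "Y \<in> prol_sections G (slit G)" and Z: "Z \<in> prol_sections G (slit G)" using Zs by simp_all
      note Xs = section_at(1)[OF W X w] and Ys = section_at(1)[OF W Y w] and Zs = section_at(1)[OF W Z w]
      let ?i = "inner_prod X (cartan_2 G L)"
      have ap: "prol_apply G Y (?i [Z]) w = - along Y (along Z f) w"
        if Y: "Y \<in> prol_sections G (slit G)" and Z: "Z \<in> prol_sections G (slit G)" for Y Z
      proof -
        have ev: "\<forall>\<^sub>F w' in nhds w. - along Z f w' = ?i [Z] w'"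
          using eventually_nhds_in_open[OF W w]
        proof eventually_elim
          case (elim w')
          show ?case
            using cartan_2_omega[OF section_at(2)[OF W X elim] section_at(2)[OF W Z elim]]
              om[OF elim section_at(3)[OF W Z elim]]
            by (simp add: inner_prod_def along_differential)
        qed
        note s = along_smooth[OF section_at(1)[OF W Z w] fs]
        have "prol_apply G Y (?i [Z]) w = along Y (?i [Z]) w"
          by (rule prol_apply_along[where Z = Y, OF section_at(3)[OF W Y w]
                E.smooth_at_cong[OF E.smooth_at_minus[OF s] ev]])
        also have "\<dots> = along Y (\<lambda>w'. - along Z f w') w"
          by (rule along_cong) (use ev in \<open>eventually_elim, simp\<close>)
        also have "\<dots> = - along Y (along Z f) w"
          unfolding along_def[of Y]
          by (rule prol_deriv_bl[OF bounded_linear_minus[OF bounded_linear_ident] adapted_at s])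
        finally show ?thesis .
      qed
      have "?i [prol_bracket G Y Z] w = - along (prol_bracket G Y Z) f w"
        using cartan_2_omega[OF sec_smooth_at_X[OF Xs] prol_bracket_X_smooth[OF Ys Zs]]
          om[OF w prol_bracket_in_fibre]
        by (simp add: inner_prod_def along_differential)
      then have "ext_d G ?i [Y, Z] w = 0"
        unfolding ext_d_2 ap[OF Y Z] ap[OF Z Y] along_bracket[OF Ys Zs fs] by simp
      moreover have "inner_prod X (ext_d G (cartan_2 G L)) [Y, Z] w = 0"
        using cartan_2_closed[OF Xs Ys Zs] by (simp add: inner_prod_def)
      ultimately show ?thesis by (simp add: lie_deriv_def YZ)
    next
      case False
      show ?thesis by (simp add: form_degreeD[OF form_degree_lie_deriv[OF form_degree_cartan_2] False])
    qed
  qed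
  have symE: "form_eq_on G (slit G) (lie_deriv G X (fun_form (energy G L))) (\<lambda>_ _. 0)"
    unfolding form_eq_on_def
  proof (intro allI impI ballI)
    fix Zs w assume "set Zs \<subseteq> prol_sections G (slit G)" and w: "w \<in> slit G"
    show "lie_deriv G X (fun_form (energy G L)) Zs w = 0"
    proof (cases "length Zs = 0")
      case True
      note Sf = section_at(3)[OF open_UNIV canonical_semispray(1) UNIV_I, of w]
      have "lie_deriv G X (fun_form (energy G L)) Zs w = ext_d G (fun_form (energy G L)) [X] w"
        using True by (simp add: lie_deriv_def inner_prod_def ext_d_def)
      also have "\<dots> = differential (energy G L) w (X w)" by (rule ext_d_fun_form[OF W X w energy_smooth])
      also have "\<dots> = omega w (X w) (?S w)"
        using omega_antisym[of w "X w" "?S w"] canonical_semispray(2)[OF section_at(3)[OF W X w]] by simp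
      also have "\<dots> = - differential f w (?S w)" by (rule om[OF w Sf])
      also have "\<dots> = - prol_apply G ?S f w"
        using prol_apply_along[where Z = ?S, OF Sf fs] by (simp add: along_differential)
      also have "\<dots> = 0" using f by (simp add: conservation_law_on_def)
      finally show ?thesis .
    next
      case False
      then show ?thesis by (simp add: form_degreeD[OF form_degree_lie_deriv[OF form_degree_fun_form]])
    qed
  qed
  \<comment> \<open>The Hamiltonian section of \<open>f\<close> on all of \<open>E\<close> extends \<open>X\<close>, and its \<open>\<theta>\<^sub>L\<close>-value is smooth on \<open>E\<close>.\<close>
  obtain X' where X': "X' \<in> prol_sections G UNIV" and H': "hamiltonian_on G L UNIV f X'"
    using hamiltonian_unique_existence[OF open_UNIV fs] by blast
  note R = restrict_section[OF W X']
  have "hamiltonian_on G L (slit G) f (restrict X' (slit G))"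
    unfolding hamiltonian_on_iff[OF W R fs] using H' unfolding hamiltonian_on_iff[OF open_UNIV X' fs] by simp
  then have XX': "X = restrict X' (slit G)"
    using hamiltonian_unique_existence[OF W fs] X H R by blast
  let ?F = "\<lambda>w. cartan_1 G L [X'] w - f w"
  have ts: "smooth_E w (cartan_1 G L [X'])" for w
    by (rule cartan_1_smooth[OF section_at(2)[OF open_UNIV X' UNIV_I]])
  have Fs: "smooth_E w ?F" for w by (rule E.smooth_at_diff[OF ts fs])
  have "form_eq_on G (slit G) (lie_deriv G X (cartan_1 G L)) (ext_d G (fun_form ?F))"
    unfolding form_eq_on_def
  proof (intro allI impI ballI)
    fix Zs w assume Zs: "set Zs \<subseteq> prol_sections G (slit G)" and w: "w \<in> slit G"
    show "lie_deriv G X (cartan_1 G L) Zs w = ext_d G (fun_form ?F) Zs w"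
    proof (cases "length Zs = 1")
      case True
      then obtain Z where Zs': "Zs = [Z]" by (auto simp: length_Suc_conv)
      then have Z: "Z \<in> prol_sections G (slit G)" using Zs by simp
      have "\<forall>\<^sub>F w' in nhds w. cartan_1 G L [X] w' = cartan_1 G L [X'] w'"
        using eventually_nhds_in_open[OF W w]
        by eventually_elim (simp add: XX' cartan_1_def)
      from along_cong[OF this, of Z]
      have "differential (cartan_1 G L [X]) w (Z w) = differential (cartan_1 G L [X']) w (Z w)"
        by (simp add: along_differential)
      then show ?thesis
        unfolding Zs' lie_deriv_cartan_1[OF W X Z w] ext_d_fun_form[OF W Z w Fs] differential_diff[OF ts fs]
        using om[OF w section_at(3)[OF W Z w]] by simp
    next
      case False
      have "form_degree 1 (ext_d G (fun_form ?F))"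
        using form_degree_ext_d[OF form_degree_fun_form, of G ?F] by simp
      from form_degreeD[OF this False] show ?thesis
        by (simp add: form_degreeD[OF form_degree_lie_deriv[OF form_degree_cartan_1] False])
    qed
  qed
  moreover have "mfd_smooth_on (total_atlas G) UNIV ?F" using Fs E.mfd_smooth_on_iff[OF open_UNIV] by blast
  ultimately show ?thesis
    unfolding exact_cartan_symmetry_def cartan_symmetry_def using X sym2 symE by blast
qed

end

theorem proposition19:
  fixes G :: "('p::{t2_space,second_countable_topology}, 'e::{t2_space,second_countable_topology},
               'x::real_inner, 'k::finite) algebroid"
    and L :: "'e \<Rightarrow> real"
  assumes "lie_algebroid G" and "regular_lagrangian G L"
  shows "(\<forall>X f. exact_cartan_symmetry G L X \<and> mfd_smooth_on (total_atlas G) UNIV f \<and>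
            form_eq_on G (slit G) (lie_deriv G X (cartan_1 G L)) (ext_d G (fun_form f)) \<longrightarrow>
            conservation_law_on G L (slit G) (\<lambda>w. f w - cartan_1 G L [X] w)) \<and>
         (\<forall>f. mfd_smooth_on (total_atlas G) UNIV f \<and> conservation_law_on G L UNIV f \<longrightarrow>
            (\<exists>!X. X \<in> prol_sections G (slit G) \<and> hamiltonian_on G L (slit G) f X) \<and>
            (\<forall>X. X \<in> prol_sections G (slit G) \<and> hamiltonian_on G L (slit G) f X \<longrightarrow>
                 exact_cartan_symmetry G L X))"
proof -
  interpret regular_Lagrangian G L using assms by unfold_locales
  have smooth: "smooth_E w f" if "conservation_law_on G L UNIV f" for f w
    using that E.mfd_smooth_on_iff[OF open_UNIV] unfolding conservation_law_on_def by blast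
  show ?thesis
  proof (intro conjI allI impI)
    fix X f
    assume "exact_cartan_symmetry G L X \<and> mfd_smooth_on (total_atlas G) UNIV f \<and>
      form_eq_on G (slit G) (lie_deriv G X (cartan_1 G L)) (ext_d G (fun_form f))"
    then show "conservation_law_on G L (slit G) (\<lambda>w. f w - cartan_1 G L [X] w)"
      by (elim conjE) (rule conservation_law_of_exact_symmetry)
  next
    fix f
    assume "mfd_smooth_on (total_atlas G) UNIV f \<and> conservation_law_on G L UNIV f"
    then have f: "conservation_law_on G L UNIV f" by simp
    show "\<exists>!X. X \<in> prol_sections G (slit G) \<and> hamiltonian_on G L (slit G) f X"
      by (rule hamiltonian_unique_existence[OF slit_open smooth[OF f]])
    fix X
    assume "X \<in> prol_sections G (slit G) \<and> hamiltonian_on G L (slit G) f X"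
    then show "exact_cartan_symmetry G L X"
      by (elim conjE) (rule exact_symmetry_of_conservation_law[OF f])
  qed
qed

end
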